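(* Assume Schanuel's conjecture (as stated in the context). Let $\mathbf{t}=(t_1,\ldots,t_s)\in\mathbb{C}^s$ be a tuple that is convenient for $\exp$, and set $F:=\mathbb{Q}(\mathbf{t},\exp(\mathbf{t}))$. Put $E_0=L_0=\overline{F}$, and for every integer $n\geq 1$ put $$E_n:=\overline{E_{n-1}(\{\exp(x)\mid x\in E_{n-1}\})},\qquad L_n:=\overline{L_{n-1}(\{x\in\mathbb{C}\mid \exp(x)\in L_{n-1}\})}.$$ Let $E:=\bigcup_{n\geq 1}E_n$ and $L:=\bigcup_{n\geq 1}L_n$. Then $E$ is linearly disjoint from $L$ over $\overline{F}$.
   Context: All fields are subfields of $\mathbb{C}$, $\overline{K}$ denotes the algebraic closure of $K$ in $\mathbb{C}$, and $\exp(z)=e^z$ is the complex exponential. For a tuple $\mathbf{x}=(x_1,\ldots,x_n)$, $\exp(\mathbf{x})=(\exp(x_1),\ldots,\exp(x_n))$. $\mathrm{l.dim}_{\mathbb{Q}}(\mathbf{x})$ is the dimension of the $\mathbb{Q}$-linear span of the entries of $\mathbf{x}$ in $\mathbb{C}$. Schanuel's conjecture (SC) is the statement: for every $n$ and every $\mathbf{x}\in\mathbb{C}^n$, $\mathrm{tr.deg.}_{\mathbb{Q}}\mathbb{Q}(\mathbf{x},\exp(\mathbf{x}))\geq \mathrm{l.dim}_{\mathbb{Q}}(\mathbf{x})$. A derivation of $\mathbb{C}$ is a map $\partial:\mathbb{C}\to\mathbb{C}$ with $\partial(a+b)=\partial(a)+\partial(b)$ and $\partial(ab)=a\partial(b)+b\partial(a)$.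 It is an exponential derivation if moreover $\partial(\exp(z))=\exp(z)\partial(z)$ for all $z\in\mathbb{C}$. For $A\subseteq\mathbb{C}$, $e\mathrm{cl}(A)$ is the set of $x\in\mathbb{C}$ such that $\partial(x)=0$ for every exponential derivation $\partial$ with $A\subseteq\ker\partial$. The operator $e\mathrm{cl}$ is a pregeometry, with associated dimension $\dim^e$: for $A,B\subseteq\mathbb{C}$ and an integer $n\geq 0$, $\dim^e(A|B)\geq n$ if and only if there exist $a_1,\ldots,a_n\in e\mathrm{cl}(A)$ and exponential derivations $\partial_1,\ldots,\partial_n$ with $B\subseteq\ker\partial_i$ for all $i$, such that $\partial_i(a_i)=1$ and $\partial_i(a_k)=0$ for $i\neq k$. Write $\dim^e(A)=\dim^e(A|\emptyset)$; for a tuple, use the set of its entries. A tuple $\mathbf{t}$ of complex numbers is convenient for $\exp$ if $\mathrm{tr.deg.}_{\mathbb{Q}}\mathbb{Q}(\mathbf{t},\exp(\mathbf{t}))=\mathrm{l.dim}_{\mathbb{Q}}(\mathbf{t})+\dim^e(\mathbf{t})$. For fields $K\subseteq M\cap N$, $M$ is linearly disjoint from $N$ over $K$ if every finite tuple of elements of $N$ that is $K$-linearly independent is also $M$-linearly independent. *)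

theory Defs
  imports
    Complex_Main
    "HOL-Library.Extended_Nat"
    "HOL-Library.Poly_Mapping"
    "HOL-Computational_Algebra.Polynomial"
begin

subsection \<open>Subfields of the complex numbers\<close>

definition is_subfield :: "complex set \<Rightarrow> bool" where
  "is_subfield K \<longleftrightarrow>
     0 \<in> K \<and> 1 \<in> K \<and>
     (\<forall>x\<in>K. \<forall>y\<in>K. x + y \<in> K \<and> x * y \<in> K) \<and>
     (\<forall>x\<in>K. - x \<in> K \<and> inverse x \<in> K)"

text \<open>The field \<open>K(X)\<close>.\<close>

definition adjoin :: "complex set \<Rightarrow> complex set \<Rightarrow> complex set" where
  "adjoin K X = is_subfield hull (K \<union> X)"

definition alg_closure :: "complex set \<Rightarrow> complex set" where
  "alg_closure K = {x. \<exists>p. p \<noteq> 0 \<and> (\<forall>i. coeff p i \<in> K) \<and> poly p x = 0}"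

lemma is_subfield_Inter:
  assumes "\<And>K. K \<in> \<K> \<Longrightarrow> is_subfield K"
  shows "is_subfield (\<Inter>\<K>)"
  using assms unfolding is_subfield_def by simp

lemma is_subfield_adjoin: "is_subfield (adjoin K X)"
  unfolding adjoin_def by (rule hull_in) (simp add: is_subfield_Inter)

lemma subset_adjoin: "K \<union> X \<subseteq> adjoin K X"
  unfolding adjoin_def by (rule hull_subset)

lemma adjoin_least: "is_subfield M \<Longrightarrow> K \<union> X \<subseteq> M \<Longrightarrow> adjoin K X \<subseteq> M"
  unfolding adjoin_def by (rule hull_minimal)


subsection \<open>Linear dimension and transcendence degree\<close>

global_interpretation rat_complex: vector_space "\<lambda>(q::rat) (z::complex). of_rat q * z"
  by unfold_locales (simp_all add: ring_distribs of_rat_add of_rat_mult mult.assoc)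

definition ldim_rat :: "complex set \<Rightarrow> nat" where
  "ldim_rat X = rat_complex.dim X"

text \<open>
  A polynomial is a finitely supported function from monomials to coefficients, and a monomial
  is a finitely supported function from indeterminates to exponents.  The complex numbers
  themselves serve as names of the indeterminates, and evaluation substitutes
  each number for the indeterminate it names.
\<close>

definition eval_mpoly :: "((complex \<Rightarrow>\<^sub>0 nat) \<Rightarrow>\<^sub>0 complex) \<Rightarrow> complex" where
  "eval_mpoly p =
     (\<Sum>m\<in>Poly_Mapping.keys p.
        Poly_Mapping.lookup p m * (\<Prod>x\<in>Poly_Mapping.keys m. x ^ Poly_Mapping.lookup m x))"

definition alg_indep :: "complex set \<Rightarrow> complex set \<Rightarrow> bool" where
  "alg_indep K S \<longleftrightarrow>
     (\<forall>p. (\<forall>m. Poly_Mapping.lookup p m \<in> K) \<longrightarrow>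
          (\<forall>m\<in>Poly_Mapping.keys p. Poly_Mapping.keys m \<subseteq> S) \<longrightarrow>
          eval_mpoly p = 0 \<longrightarrow> p = 0)"

text \<open>The value is \<open>\<infinity>\<close> for every infinite transcendence degree.\<close>

definition trdeg :: "complex set \<Rightarrow> complex set \<Rightarrow> enat" where
  "trdeg K M = (SUP S\<in>{S. S \<subseteq> M \<and> finite S \<and> alg_indep K S}. enat (card S))"


subsection \<open>Schanuel's conjecture\<close>

text \<open>
  Tuples of complex numbers, of arbitrary length, are lists.  This is the
  field \<open>\<rat>(x, exp(x))\<close>.
\<close>

definition exp_field :: "complex list \<Rightarrow> complex set" where
  "exp_field xs = adjoin \<rat> (set xs \<union> exp ` set xs)"

definition schanuel_conjecture :: bool where
  "schanuel_conjecture \<longleftrightarrow>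
     (\<forall>xs. trdeg \<rat> (exp_field xs) \<ge> enat (ldim_rat (set xs)))"


subsection \<open>Exponential derivations and exponential dimension\<close>

definition derivation :: "(complex \<Rightarrow> complex) \<Rightarrow> bool" where
  "derivation D \<longleftrightarrow> (\<forall>a b. D (a + b) = D a + D b) \<and> (\<forall>a b. D (a * b) = a * D b + b * D a)"

definition exp_derivation :: "(complex \<Rightarrow> complex) \<Rightarrow> bool" where
  "exp_derivation D \<longleftrightarrow> derivation D \<and> (\<forall>z. D (exp z) = exp z * D z)"

definition ecl :: "complex set \<Rightarrow> complex set" where
  "ecl A = {x. \<forall>D. exp_derivation D \<longrightarrow> (\<forall>a\<in>A. D a = 0) \<longrightarrow> D x = 0}"

definition edim_at_least :: "complex set \<Rightarrow> complex set \<Rightarrow> nat \<Rightarrow> bool" where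
  "edim_at_least A B n \<longleftrightarrow>
     (\<exists>(a :: nat \<Rightarrow> complex) (D :: nat \<Rightarrow> complex \<Rightarrow> complex).
        (\<forall>i<n. a i \<in> ecl A) \<and>
        (\<forall>i<n. exp_derivation (D i) \<and> (\<forall>b\<in>B. D i b = 0)) \<and>
        (\<forall>i<n. D i (a i) = 1) \<and>
        (\<forall>i<n. \<forall>k<n. i \<noteq> k \<longrightarrow> D i (a k) = 0))"

definition edim :: "complex set \<Rightarrow> complex set \<Rightarrow> enat" where
  "edim A B = (SUP n\<in>{n. edim_at_least A B n}. enat n)"

lemma edim_at_least_mono: "edim_at_least A B n \<Longrightarrow> m \<le> n \<Longrightarrow> edim_at_least A B m"
proof -
  assume "edim_at_least A B n" and le: "m \<le> n"
  then obtain a :: "nat \<Rightarrow> complex" and D :: "nat \<Rightarrow> complex \<Rightarrow> complex" where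
    *: "\<forall>i<n. a i \<in> ecl A" "\<forall>i<n. exp_derivation (D i) \<and> (\<forall>b\<in>B. D i b = 0)"
       "\<forall>i<n. D i (a i) = 1" "\<forall>i<n. \<forall>k<n. i \<noteq> k \<longrightarrow> D i (a k) = 0"
    unfolding edim_at_least_def by blast
  have less: "\<And>i. i < m \<Longrightarrow> i < n"
    using le by simp
  show "edim_at_least A B m"
    unfolding edim_at_least_def
    by (rule exI[of _ a], rule exI[of _ D]) (simp add: * less)
qed

lemma edim_ge_iff: "edim A B \<ge> enat n \<longleftrightarrow> edim_at_least A B n"
proof
  assume ge: "edim A B \<ge> enat n"
  show "edim_at_least A B n"
  proof (cases n)
    case 0
    then show ?thesis by (simp add: edim_at_least_def)
  next
    case (Suc k)
    have "enat k < edim A B"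
      using ge Suc by (simp add: Suc_ile_eq)
    then obtain m where "edim_at_least A B m" "k < m"
      unfolding edim_def less_SUP_iff by auto
    then show ?thesis
      using Suc edim_at_least_mono[of A B m n] by simp
  qed
next
  assume "edim_at_least A B n"
  then show "edim A B \<ge> enat n"
    unfolding edim_def by (intro SUP_upper) simp
qed

definition convenient :: "complex list \<Rightarrow> bool" where
  "convenient t \<longleftrightarrow> trdeg \<rat> (exp_field t) = enat (ldim_rat (set t)) + edim (set t) {}"


subsection \<open>Linear disjointness\<close>

definition lin_indep :: "complex set \<Rightarrow> complex list \<Rightarrow> bool" where
  "lin_indep K vs \<longleftrightarrow>
     (\<forall>c. (\<forall>i<length vs. c i \<in> K) \<longrightarrow> (\<Sum>i<length vs. c i * vs ! i) = 0 \<longrightarrow>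
          (\<forall>i<length vs. c i = 0))"

text \<open>\<open>M\<close> is linearly disjoint from \<open>N\<close> over \<open>K\<close>, for subfields with \<open>K \<subseteq> M \<inter> N\<close>.\<close>

definition linearly_disjoint :: "complex set \<Rightarrow> complex set \<Rightarrow> complex set \<Rightarrow> bool" where
  "linearly_disjoint M N K \<longleftrightarrow>
     (\<forall>vs. set vs \<subseteq> N \<longrightarrow> lin_indep K vs \<longrightarrow> lin_indep M vs)"


subsection \<open>Towers of exponentials and logarithms\<close>

primrec exp_tower :: "complex set \<Rightarrow> nat \<Rightarrow> complex set" where
  "exp_tower F 0 = alg_closure F"
| "exp_tower F (Suc n) = alg_closure (adjoin (exp_tower F n) (exp ` exp_tower F n))"

primrec log_tower :: "complex set \<Rightarrow> nat \<Rightarrow> complex set" where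
  "log_tower F 0 = alg_closure F"
| "log_tower F (Suc n) = alg_closure (adjoin (log_tower F n) {x. exp x \<in> log_tower F n})"

end

theory Submission
  imports Defs "Jordan_Normal_Form.Determinant"
begin

text \<open>
  For a subfield \<open>K\<close> of \<open>\<complex>\<close>, an element is algebraic over \<open>K\<close> iff every derivation of \<open>\<complex>\<close>
  vanishing on \<open>K\<close> vanishes at it, so transcendence degrees can be computed with total
  derivations of \<open>\<complex>\<close>.

  Let \<open>\<E>\<close> be a set of exponential derivations with common kernel \<open>C\<close>.  A relation
  \<open>\<Sum>\<^sub>a f\<^sub>a (D a - D(exp a)/exp a) = 0\<close>, valid for all derivations \<open>D\<close> over \<open>C\<close>, remains valid after
  applying some \<open>E \<in> \<E>\<close> to its coefficients, because the forms are closed and vanish at \<open>E\<close>.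
  A minimal such relation therefore has coefficients in \<open>C\<close>, and yields \<open>\<gamma>\<^sub>r \<in> C\<close> linearly independent
  over \<open>\<rat>\<close> with \<open>\<Sum>\<^sub>r \<gamma>\<^sub>r D(Y\<^sub>r)/Y\<^sub>r = D x\<close>.  If \<open>s = Y\<^sub>1\<close> is transcendental, then after
  enlarging \<open>C\<close> everything is algebraic over \<open>C(s)\<close>; taking the trace to \<open>C(s)\<close> and residues at
  \<open>s = 0\<close> gives an integer relation between the \<open>\<gamma>\<^sub>r\<close>, a contradiction.  This is Ax's theorem; with
  Schanuel's conjecture on \<open>C\<close> it shows that adding numbers to a convenient tuple \<open>t\<close> increases
  the transcendence degree at least as much as the linear dimension.

  In a double induction over the levels of the towers, finitely many elements of \<open>E\<close> and \<open>L\<close> are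
  algebraic over \<open>F(exp A)\<close> and \<open>F(B)\<close> with \<open>A\<close> and \<open>exp B\<close> in the previous levels.  By induction
  \<open>A\<close> and \<open>B\<close> are independent modulo \<open>t\<close>, so \<open>exp A\<close> and \<open>B\<close> are algebraically independent over \<open>F\<close>,
  and the derivations dual to \<open>exp A\<close> reduce a linear relation over \<open>E\<close> to one over \<open>alg_closure F\<close>.
\<close>

section \<open>Derivations of the complex numbers and their extension from subfields\<close>

subsection \<open>Subfields\<close>

text \<open>Convenience makes the difference of transcendence degree and linear dimension as small
  as it can be for a finite set containing \<open>t\<close>: the exponential derivations that
  witness the exponential dimension of \<open>t\<close> serve every larger set too. The independence
  statements behind the towers are obtained by contradicting this minimum, when too few numbers
  would generate a set of too large linear dimension.

  Differential forms do not occur as elements of a module. A form is a function of a total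
  derivation \<open>D\<close>, and if numbers are algebraic over a finite set \<open>S\<close>,
  their forms are combinations of the \<open>D s\<close> with \<open>s \<in> S\<close>; counting
  independent functions then bounds the size of \<open>S\<close> from below. This is why derivations
  are extended to all of \<complex>. Finite extensions are handled by multiplication matrices, so
  that no conjugate embedding has to be made compatible with \<open>D\<close>.\<close>

lemma subfieldD:
  assumes "is_subfield K"
  shows "0 \<in> K" "1 \<in> K" "\<And>x y. x \<in> K \<Longrightarrow> y \<in> K \<Longrightarrow> x + y \<in> K"
    "\<And>x y. x \<in> K \<Longrightarrow> y \<in> K \<Longrightarrow> x * y \<in> K" "\<And>x. x \<in> K \<Longrightarrow> - x \<in> K"
    "\<And>x. x \<in> K \<Longrightarrow> inverse x \<in> K" "\<And>x y. x \<in> K \<Longrightarrow> y \<in> K \<Longrightarrow> x - y \<in> K"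
    "\<And>x y. x \<in> K \<Longrightarrow> y \<in> K \<Longrightarrow> x / y \<in> K"
proof -
  show *: "0 \<in> K" "1 \<in> K" "\<And>x y. x \<in> K \<Longrightarrow> y \<in> K \<Longrightarrow> x + y \<in> K"
    "\<And>x y. x \<in> K \<Longrightarrow> y \<in> K \<Longrightarrow> x * y \<in> K" "\<And>x. x \<in> K \<Longrightarrow> - x \<in> K"
    "\<And>x. x \<in> K \<Longrightarrow> inverse x \<in> K"
    using assms by (auto simp: is_subfield_def)
  show "x - y \<in> K" if "x \<in> K" "y \<in> K" for x y
    using *(3)[OF that(1) *(5)[OF that(2)]] by simp
  show "x / y \<in> K" if "x \<in> K" "y \<in> K" for x y
    using *(4)[OF that(1) *(6)[OF that(2)]] by (simp add: divide_inverse)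
qed

lemma subfield_sum:
  assumes "is_subfield K" "\<And>i. i \<in> I \<Longrightarrow> f i \<in> K"
  shows "sum f I \<in> K"
  using assms(2) by (induction I rule: infinite_finite_induct) (auto intro: subfieldD[OF assms(1)])

lemma subfield_prod:
  assumes "is_subfield K" "\<And>i. i \<in> I \<Longrightarrow> f i \<in> K"
  shows "prod f I \<in> K"
  using assms(2) by (induction I rule: infinite_finite_induct) (auto intro: subfieldD[OF assms(1)])

lemma subfield_power: "is_subfield K \<Longrightarrow> x \<in> K \<Longrightarrow> x ^ n \<in> K"
  by (induction n) (auto intro: subfieldD)

lemma subfield_of_nat: "is_subfield K \<Longrightarrow> of_nat n \<in> K"
  by (induction n) (auto intro: subfieldD)

lemma subfield_of_int: "is_subfield K \<Longrightarrow> of_int n \<in> K"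
  by (cases n rule: int_cases2) (auto intro: subfieldD subfield_of_nat)

lemma subfield_of_rat: "is_subfield K \<Longrightarrow> of_rat q \<in> K"
  by (cases q) (auto simp: of_rat_rat intro!: subfieldD(8) subfield_of_int)

lemma is_subfield_Rats: "is_subfield \<rat>"
  by (auto simp: is_subfield_def)


subsection \<open>Derivations\<close>

lemma
  assumes "derivation D"
  shows derivation_add: "D (a + b) = D a + D b"
    and derivation_mult: "D (a * b) = a * D b + b * D a"
  using assms by (auto simp: derivation_def)

lemma
  assumes D: "derivation D"
  shows derivation_0: "D 0 = 0"
    and derivation_1: "D 1 = 0"
    and derivation_minus: "D (- a) = - D a"
    and derivation_diff: "D (a - b) = D a - D b"
proof -
  show 0: "D 0 = 0" using derivation_add[OF D, of 0 0] by simp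
  show "D 1 = 0" using derivation_mult[OF D, of 1 1] by simp
  show m: "D (- a) = - D a" for a using derivation_add[OF D, of a "- a"] 0
    by (simp add: add_eq_0_iff)
  show "D (a - b) = D a - D b" using derivation_add[OF D, of a "- b"] m by simp
qed

lemma derivation_inverse:
  assumes D: "derivation D"
  shows "D (inverse a) = - D a / a\<^sup>2"
proof (cases "a = 0")
  case True
  then show ?thesis by (simp add: derivation_0[OF D])
next
  case False
  have "0 = a * D (inverse a) + inverse a * D a"
    using derivation_mult[OF D, of a "inverse a"] False by (simp add: derivation_1[OF D])
  then show ?thesis using False
    by (simp add: field_simps power2_eq_square) (metis add_eq_0_iff mult_minus_right)
qed

lemma derivation_divide:
  assumes D: "derivation D" and "b \<noteq> 0"
  shows "D (a / b) = (D a * b - a * D b) / b\<^sup>2"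
  using assms(2) by (simp add: divide_inverse derivation_mult[OF D] derivation_inverse[OF D])
    (simp add: field_simps power2_eq_square)

lemma derivation_sum: "derivation D \<Longrightarrow> D (sum f I) = (\<Sum>i\<in>I. D (f i))"
  by (induction I rule: infinite_finite_induct) (simp_all add: derivation_0 derivation_add)

lemma derivation_of_nat: "derivation D \<Longrightarrow> D (of_nat n) = 0"
  by (induction n) (simp_all add: derivation_0 derivation_add derivation_1)

lemma derivation_of_int: "derivation D \<Longrightarrow> D (of_int n) = 0"
  by (cases n rule: int_cases2) (simp_all add: derivation_minus derivation_of_nat)

lemma derivation_of_rat: "derivation D \<Longrightarrow> D (of_rat q) = 0"
  by (cases q) (simp add: of_rat_rat derivation_divide derivation_of_int)

lemma derivation_Rats: "derivation D \<Longrightarrow> q \<in> \<rat> \<Longrightarrow> D q = 0"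
  by (elim Rats_cases) (simp add: derivation_of_rat)

lemma derivation_lincomb:
  "(\<And>i. i \<in> I \<Longrightarrow> derivation (D i)) \<Longrightarrow> derivation (\<lambda>x. \<Sum>i\<in>I. c i * D i x)"
  by (auto simp: derivation_def sum.distrib[symmetric] sum_distrib_left algebra_simps intro!: sum.cong)

lemma derivation_diff_fun: "derivation D \<Longrightarrow> derivation D' \<Longrightarrow> derivation (\<lambda>x. D x - D' x)"
  by (auto simp: derivation_def algebra_simps)

lemma derivation_scale: "derivation D \<Longrightarrow> derivation (\<lambda>x. c * D x)"
  by (auto simp: derivation_def algebra_simps)

lemma derivation_commutator:
  "derivation D \<Longrightarrow> derivation E \<Longrightarrow> derivation (\<lambda>x. D (E x) - E (D x))"
  by (auto simp: derivation_def algebra_simps)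

lemma is_subfield_derivation_kernel: "derivation D \<Longrightarrow> is_subfield {x. D x = 0}"
  by (auto simp: is_subfield_def derivation_0 derivation_1 derivation_add derivation_mult
      derivation_minus derivation_inverse)


subsection \<open>Polynomials over a subfield\<close>

definition polys_over :: "complex set \<Rightarrow> complex poly set" where
  "polys_over K = {p. \<forall>i. coeff p i \<in> K}"

lemma alg_closure_iff:
  "x \<in> alg_closure K \<longleftrightarrow> (\<exists>p\<in>polys_over K. p \<noteq> 0 \<and> poly p x = 0)"
  by (auto simp: alg_closure_def polys_over_def)

lemma
  assumes K: "is_subfield K"
  shows polys_over_add: "p \<in> polys_over K \<Longrightarrow> q \<in> polys_over K \<Longrightarrow> p + q \<in> polys_over K"
    and polys_over_diff: "p \<in> polys_over K \<Longrightarrow> q \<in> polys_over K \<Longrightarrow> p - q \<in> polys_over K"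
    and polys_over_minus: "p \<in> polys_over K \<Longrightarrow> - p \<in> polys_over K"
    and polys_over_mult: "p \<in> polys_over K \<Longrightarrow> q \<in> polys_over K \<Longrightarrow> p * q \<in> polys_over K"
    and polys_over_smult: "c \<in> K \<Longrightarrow> p \<in> polys_over K \<Longrightarrow> Polynomial.smult c p \<in> polys_over K"
    and polys_over_monom: "c \<in> K \<Longrightarrow> monom c n \<in> polys_over K"
    and polys_over_const: "c \<in> K \<Longrightarrow> [:c:] \<in> polys_over K"
    and polys_over_0: "0 \<in> polys_over K"
    and polys_over_1: "1 \<in> polys_over K"
    and polys_over_pCons: "c \<in> K \<Longrightarrow> p \<in> polys_over K \<Longrightarrow> pCons c p \<in> polys_over K"
    and polys_over_pderiv: "p \<in> polys_over K \<Longrightarrow> pderiv p \<in> polys_over K"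
  by (auto simp: polys_over_def coeff_mult coeff_pderiv coeff_pCons coeff_1 coeff_monom split: nat.split
      intro!: subfieldD[OF K] subfield_sum[OF K] subfield_of_nat[OF K]
      simp del: of_nat_Suc)

lemma derivation_power:
  "derivation D \<Longrightarrow> D (x ^ n) = of_nat n * x ^ (n - 1) * D x"
proof (induction n)
  case (Suc n)
  then show ?case by (cases n) (simp_all add: derivation_mult algebra_simps)
qed (simp add: derivation_1)

lemma derivation_poly:
  assumes D: "derivation D"
  shows "D (poly p x) = poly (map_poly D p) x + poly (pderiv p) x * D x"
proof (induction p)
  case (pCons a p)
  then show ?case
    by (cases "a = 0 \<and> p = 0") (auto simp: derivation_0[OF D] derivation_add[OF D]
        derivation_mult[OF D] map_poly_pCons pderiv_pCons algebra_simps)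
qed (simp add: derivation_0[OF D])

lemma derivation_poly_const:
  assumes D: "derivation D" and "p \<in> polys_over {x. D x = 0}"
  shows "D (poly p x) = poly (pderiv p) x * D x"
proof -
  have "map_poly D p = 0"
    using assms by (intro poly_eqI) (auto simp: coeff_map_poly derivation_0 polys_over_def)
  then show ?thesis by (simp add: derivation_poly[OF D])
qed

lemma min_poly_exists:
  assumes "x \<in> alg_closure K"
  obtains p where "p \<in> polys_over K" "p \<noteq> 0" "poly p x = 0"
    "\<And>q. q \<in> polys_over K \<Longrightarrow> poly q x = 0 \<Longrightarrow> degree q < degree p \<Longrightarrow> q = 0"
proof -
  let ?P = "\<lambda>p. p \<in> polys_over K \<and> p \<noteq> 0 \<and> poly p x = 0"
  obtain p where "?P p" using assms by (auto simp: alg_closure_iff)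
  then obtain m where "?P m" "\<And>q. ?P q \<Longrightarrow> degree m \<le> degree q"
    using ex_has_least_nat[of ?P p degree] by blast
  then show ?thesis by (intro that[of m]) (blast, blast, blast, use leD in blast)
qed

text \<open>Characteristic zero: the derivative has smaller degree, so if it vanished at
  \<open>x\<close>, minimality would make it the zero polynomial, and a polynomial with zero
  derivative is constant.\<close>

lemma min_poly_pderiv:
  assumes K: "is_subfield K" and p: "p \<in> polys_over K" "p \<noteq> 0" "poly p x = 0"
    "\<And>q. q \<in> polys_over K \<Longrightarrow> poly q x = 0 \<Longrightarrow> degree q < degree p \<Longrightarrow> q = 0"
  shows "poly (pderiv p) x \<noteq> 0"
proof
  assume 0: "poly (pderiv p) x = 0"
  have "degree p \<noteq> 0"
  proof
    assume "degree p = 0"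
    then obtain c where "p = [:c:]" by (auto elim: degree_eq_zeroE)
    then show False using p by auto
  qed
  then have "pderiv p = 0"
    using p(4)[OF polys_over_pderiv[OF K p(1)] 0] by (simp add: degree_pderiv)
  then show False using \<open>degree p \<noteq> 0\<close> by (simp add: pderiv_eq_0_iff)
qed

lemma derivation_alg_closure:
  assumes D: "derivation D" "\<And>x. x \<in> K \<Longrightarrow> D x = 0" and K: "is_subfield K"
    and x: "x \<in> alg_closure K"
  shows "D x = 0"
proof -
  obtain p where p: "p \<in> polys_over K" "p \<noteq> 0" "poly p x = 0"
    "\<And>q. q \<in> polys_over K \<Longrightarrow> poly q x = 0 \<Longrightarrow> degree q < degree p \<Longrightarrow> q = 0"
    using min_poly_exists[OF x] by metis
  have "0 = poly (pderiv p) x * D x"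
    using derivation_poly_const[OF D(1), of p x] p D by (auto simp: polys_over_def derivation_0)
  then show ?thesis using min_poly_pderiv[OF K p] by simp
qed


subsection \<open>Extension of derivations\<close>

definition partial_derivation :: "complex set \<Rightarrow> (complex \<Rightarrow> complex) \<Rightarrow> bool" where
  "partial_derivation K d \<longleftrightarrow> is_subfield K \<and>
     (\<forall>x\<in>K. \<forall>y\<in>K. d (x + y) = d x + d y \<and> d (x * y) = x * d y + y * d x)"

text \<open>The graph of a derivation on a subfield, as a subfield-like set of dual numbers;
  unlike the derivations themselves, graphs are closed under unions of chains.\<close>

definition der_graph :: "(complex \<times> complex) set \<Rightarrow> bool" where
  "der_graph G \<longleftrightarrow> (1, 0) \<in> G \<and>
     (\<forall>a b c d. (a, b) \<in> G \<longrightarrow> (c, d) \<in> G \<longrightarrow> (a + c, b + d) \<in> G \<and> (a * c, a * d + c * b) \<in> G) \<and>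
     (\<forall>a b. (a, b) \<in> G \<longrightarrow> (- a, - b) \<in> G \<and> (inverse a, - b / a\<^sup>2) \<in> G) \<and>
     (\<forall>b. (0, b) \<in> G \<longrightarrow> b = 0)"

text \<open>The last clause of \<open>der_graph\<close> is single-valuedness over \<open>0\<close>
  only; subtracting two points over the same number spreads it to every point.\<close>

lemma der_graphE:
  assumes G: "der_graph G"
  obtains K d where "partial_derivation K d" "G = {(x, d x) | x. x \<in> K}"
proof -
  have sv: "b = c" if "(a, b) \<in> G" "(a, c) \<in> G" for a b c
  proof -
    have "(- a, - c) \<in> G" using G that(2) unfolding der_graph_def by blast
    then have "(a + - a, b + - c) \<in> G" using G that(1) unfolding der_graph_def by blast
    then have "(0, b - c) \<in> G" by simp
    then have "b - c = 0" using G unfolding der_graph_def by blast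
    then show ?thesis by simp
  qed
  define K where "K = fst ` G"
  define d where "d x = (THE y. (x, y) \<in> G)" for x
  have d: "(x, d x) \<in> G" if "x \<in> K" for x
  proof -
    from that obtain y where y: "(x, y) \<in> G" unfolding K_def by auto
    have "d x = y" unfolding d_def by (rule the_equality) (use y sv in blast)+
    then show ?thesis using y by simp
  qed
  have dI: "d x = y" if "(x, y) \<in> G" for x y
    unfolding d_def by (rule the_equality) (use that sv in blast)+
  have KI: "x \<in> K" if "(x, y) \<in> G" for x y using that unfolding K_def by force
  have eq: "G = {(x, d x) | x. x \<in> K}"
    using d dI KI by auto
  have 1: "(1, 0) \<in> G" using G unfolding der_graph_def by blast
  have m1: "(- 1, - 0) \<in> G" using G 1 unfolding der_graph_def by blast
  have "(1 + - 1, 0 + - 0) \<in> G" using G 1 m1 unfolding der_graph_def by blast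
  then have 0: "(0, 0) \<in> G" by simp
  have ops: "(x + y, d x + d y) \<in> G" "(x * y, x * d y + y * d x) \<in> G" if "x \<in> K" "y \<in> K" for x y
    using G d[OF that(1)] d[OF that(2)] unfolding der_graph_def by blast+
  have ops': "(- x, - d x) \<in> G" "(inverse x, - d x / x\<^sup>2) \<in> G" if "x \<in> K" for x
    using G d[OF that(1)] unfolding der_graph_def by blast+
  have "is_subfield K" unfolding is_subfield_def
    using KI[OF 0] KI[OF 1] KI[OF ops(1)] KI[OF ops(2)] KI[OF ops'(1)] KI[OF ops'(2)] by auto
  then have "partial_derivation K d"
    unfolding partial_derivation_def using dI[OF ops(1)] dI[OF ops(2)] by auto
  then show ?thesis using eq that by blast
qed

lemma
  assumes d: "partial_derivation K d"
  shows partial_derivation_subfield: "is_subfield K"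
    and partial_derivation_add: "x \<in> K \<Longrightarrow> y \<in> K \<Longrightarrow> d (x + y) = d x + d y"
    and partial_derivation_mult: "x \<in> K \<Longrightarrow> y \<in> K \<Longrightarrow> d (x * y) = x * d y + y * d x"
    and partial_derivation_0: "d 0 = 0"
    and partial_derivation_1: "d 1 = 0"
    and partial_derivation_minus: "x \<in> K \<Longrightarrow> d (- x) = - d x"
proof -
  show K: "is_subfield K" and a: "\<And>x y. x \<in> K \<Longrightarrow> y \<in> K \<Longrightarrow> d (x + y) = d x + d y"
    and m: "\<And>x y. x \<in> K \<Longrightarrow> y \<in> K \<Longrightarrow> d (x * y) = x * d y + y * d x"
    using d unfolding partial_derivation_def by auto
  show 0: "d 0 = 0" using a[OF subfieldD(1)[OF K] subfieldD(1)[OF K]] by simp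
  show "d 1 = 0" using m[OF subfieldD(2)[OF K] subfieldD(2)[OF K]] by simp
  show "x \<in> K \<Longrightarrow> d (- x) = - d x" using a[of x "- x"] subfieldD(5)[OF K, of x] 0
    by (simp add: add_eq_0_iff)
qed

lemma partial_derivation_sum:
  assumes d: "partial_derivation K d" and "\<And>i. i \<in> I \<Longrightarrow> f i \<in> K"
  shows "d (sum f I) = (\<Sum>i\<in>I. d (f i))"
  using assms(2)
  by (induction I rule: infinite_finite_induct)
    (auto simp: partial_derivation_0[OF d] partial_derivation_add[OF d]
      subfield_sum[OF partial_derivation_subfield[OF d]])

lemma map_poly_partial_derivation:
  assumes d: "partial_derivation K d" and p: "p \<in> polys_over K" and q: "q \<in> polys_over K"
  shows "map_poly d (p + q) = map_poly d p + map_poly d q"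
    and "map_poly d (p * q) = p * map_poly d q + map_poly d p * q"
    and "map_poly d (- p) = - map_poly d p"
proof -
  note K = partial_derivation_subfield[OF d] and d0 = partial_derivation_0[OF d]
  note [simp] = coeff_map_poly[of d, OF d0]
  show "map_poly d (p + q) = map_poly d p + map_poly d q"
    using p q by (intro poly_eqI) (simp add: polys_over_def partial_derivation_add[OF d])
  show "map_poly d (- p) = - map_poly d p"
    using p q by (intro poly_eqI) (simp add: polys_over_def partial_derivation_minus[OF d])
  show "map_poly d (p * q) = p * map_poly d q + map_poly d p * q"
    using p q by (intro poly_eqI)
     (auto simp: polys_over_def coeff_mult partial_derivation_sum[OF d] subfieldD(4)[OF K]
        partial_derivation_mult[OF d] sum.distrib[symmetric] intro!: sum.cong)
qed

text \<open>The assumption is what makes the value \<open>b\<close> at \<open>a\<close> consistent: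
  the derivative computed for \<open>p(a)\<close> must be \<open>0\<close> whenever
  \<open>p(a)\<close> is. All fractions in \<open>a\<close> are put into the graph with the value
  given by the quotient rule, without reducing them; independence of the representation then amounts
  to the clause of \<open>der_graph\<close> about points over \<open>0\<close>.\<close>

lemma der_graph_adjoin:
  assumes d: "partial_derivation K d"
    and ab: "\<And>p. p \<in> polys_over K \<Longrightarrow> poly p a = 0 \<Longrightarrow>
      poly (map_poly d p) a + poly (pderiv p) a * b = 0"
  shows "\<exists>G. der_graph G \<and> {(x, d x) | x. x \<in> K} \<subseteq> G \<and> (a, b) \<in> G"
proof -
  note K = partial_derivation_subfield[OF d] and d0 = partial_derivation_0[OF d]
  \<comment> \<open>The derivative that \<open>p(a)\<close> must get: \<open>d\<close> acts on the
    coefficients, and the argument has derivative \<open>b\<close>.\<close>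
  define \<Delta> where "\<Delta> p = poly (map_poly d p) a + poly (pderiv p) a * b" for p
  have \<Delta>add: "\<Delta> (p + q) = \<Delta> p + \<Delta> q" and \<Delta>mult: "\<Delta> (p * q) = poly p a * \<Delta> q + poly q a * \<Delta> p"
    and \<Delta>minus: "\<Delta> (- p) = - \<Delta> p"
    if "p \<in> polys_over K" "q \<in> polys_over K" for p q
    using map_poly_partial_derivation[OF d that]
    by (simp_all add: \<Delta>_def pderiv_add pderiv_mult pderiv_minus algebra_simps)
  define G where "G = {(poly p a / poly q a, (\<Delta> p * poly q a - poly p a * \<Delta> q) / (poly q a)\<^sup>2) | p q.
    p \<in> polys_over K \<and> q \<in> polys_over K \<and> poly q a \<noteq> 0}"
  have GI: "(u, v) \<in> G" if "p \<in> polys_over K" "q \<in> polys_over K" "poly q a \<noteq> 0" "u = poly p a / poly q a"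
    "v = (\<Delta> p * poly q a - poly p a * \<Delta> q) / (poly q a)\<^sup>2" for u v p q
    using that unfolding G_def by blast
  have GE: "\<exists>p q. p \<in> polys_over K \<and> q \<in> polys_over K \<and> poly q a \<noteq> 0 \<and> u = poly p a / poly q a \<and>
    v = (\<Delta> p * poly q a - poly p a * \<Delta> q) / (poly q a)\<^sup>2" if "(u, v) \<in> G" for u v
    using that unfolding G_def by blast
  have \<Delta>1: "\<Delta> 1 = 0" by (simp add: \<Delta>_def one_pCons map_poly_pCons partial_derivation_1[OF d] d0)
  have "der_graph G" unfolding der_graph_def
  proof (intro conjI allI impI)
    show "(1, 0) \<in> G" by (rule GI[of 1 1]) (simp_all add: polys_over_1[OF K])
  next
    fix u v u' v' assume "(u, v) \<in> G" "(u', v') \<in> G"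
    then obtain p q p' q' where *: "p \<in> polys_over K" "q \<in> polys_over K" "poly q a \<noteq> 0" "u = poly p a / poly q a"
      "v = (\<Delta> p * poly q a - poly p a * \<Delta> q) / (poly q a)\<^sup>2"
      "p' \<in> polys_over K" "q' \<in> polys_over K" "poly q' a \<noteq> 0" "u' = poly p' a / poly q' a"
      "v' = (\<Delta> p' * poly q' a - poly p' a * \<Delta> q') / (poly q' a)\<^sup>2"
      using GE by meson
    note o = polys_over_mult[OF K] polys_over_add[OF K]
    show "(u + u', v + v') \<in> G"
      by (rule GI[of "p * q' + p' * q" "q * q'"])
        (use *(1-3,6-8) in \<open>simp_all add: *(4,5,9,10) o \<Delta>add \<Delta>mult field_simps power2_eq_square\<close>)
    show "(u * u', u * v' + u' * v) \<in> G"
      by (rule GI[of "p * p'" "q * q'"])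
        (use *(1-3,6-8) in \<open>simp_all add: *(4,5,9,10) o \<Delta>add \<Delta>mult field_simps power2_eq_square\<close>)
  next
    fix u v assume "(u, v) \<in> G"
    then obtain p q where *: "p \<in> polys_over K" "q \<in> polys_over K" "poly q a \<noteq> 0" "u = poly p a / poly q a"
      "v = (\<Delta> p * poly q a - poly p a * \<Delta> q) / (poly q a)\<^sup>2" using GE by meson
    show "(- u, - v) \<in> G"
      by (rule GI[of "- p" q]) (use * in \<open>simp_all add: polys_over_minus[OF K] \<Delta>minus field_simps\<close>)
    show "(inverse u, - v / u\<^sup>2) \<in> G"
    proof (cases "poly p a = 0")
      case True
      have "u = 0" using True * by simp
      show ?thesis
        by (rule GI[of 0 1]) (use \<open>u = 0\<close> in \<open>simp_all add: polys_over_0[OF K] polys_over_1[OF K] \<Delta>_def\<close>)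
    next
      case False
      show ?thesis
        by (rule GI[of q p]) (use *(1-3) False in \<open>simp_all add: *(4,5) field_simps power2_eq_square\<close>)
    qed
  next
    fix v assume "(0, v) \<in> G"
    then obtain p q where *: "p \<in> polys_over K" "q \<in> polys_over K" "poly q a \<noteq> 0" "0 = poly p a / poly q a"
      "v = (\<Delta> p * poly q a - poly p a * \<Delta> q) / (poly q a)\<^sup>2" using GE by meson
    then have "poly p a = 0" by simp
    then have "\<Delta> p = 0" using ab[OF *(1)] by (simp add: \<Delta>_def)
    then show "v = 0" using * \<open>poly p a = 0\<close> by simp
  qed
  moreover have "(x, d x) \<in> G" if "x \<in> K" for x
    by (rule GI[of "[:x:]" 1])
      (use that in \<open>simp_all add: polys_over_1[OF K] polys_over_const[OF K] \<Delta>1, simp add: \<Delta>_def map_poly_pCons d0\<close>)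
  moreover have "(a, b) \<in> G"
    by (rule GI[of "[:0, 1:]" 1])
      (simp_all add: polys_over_1[OF K] polys_over_pCons[OF K] polys_over_0[OF K] subfieldD[OF K] \<Delta>1,
        simp add: \<Delta>_def map_poly_pCons d0 partial_derivation_1[OF d] pderiv_pCons)
  ultimately show ?thesis by blast
qed

lemma der_graph_extend:
  assumes d: "partial_derivation K d"
  shows "\<exists>G. der_graph G \<and> {(x, d x) | x. x \<in> K} \<subseteq> G \<and> (\<exists>b. (a, b) \<in> G)"
proof (cases "a \<in> alg_closure K")
  case False
  then have "\<And>p. p \<in> polys_over K \<Longrightarrow> poly p a = 0 \<Longrightarrow> p = 0"
    by (auto simp: alg_closure_iff)
  then have "poly (map_poly d p) a + poly (pderiv p) a * 0 = 0"
    if "p \<in> polys_over K" "poly p a = 0" for p using that by fastforce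
  from der_graph_adjoin[OF d this] show ?thesis by blast
next
  case True
  note K = partial_derivation_subfield[OF d] and d0 = partial_derivation_0[OF d]
  obtain P where P: "P \<in> polys_over K" "P \<noteq> 0" "poly P a = 0"
    "\<And>q. q \<in> polys_over K \<Longrightarrow> poly q a = 0 \<Longrightarrow> degree q < degree P \<Longrightarrow> q = 0"
    using min_poly_exists[OF True] by metis
  have P': "poly (pderiv P) a \<noteq> 0" by (rule min_poly_pderiv[OF K P])
  \<comment> \<open>The only value compatible with differentiating \<open>P(a) = 0\<close>.\<close>
  define b where "b = - poly (map_poly d P) a / poly (pderiv P) a"
  have Pb: "poly (map_poly d P) a + poly (pderiv P) a * b = 0"
    using P' by (simp add: b_def)
  have "poly (map_poly d p) a + poly (pderiv p) a * b = 0" if "p \<in> polys_over K" "poly p a = 0" for p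
    using that
  proof (induction "degree p" arbitrary: p rule: less_induct)
    case less
    show ?case
    proof (cases "p = 0")
      case False
      then have deg: "degree P \<le> degree p" using P(4) less.prems by force
      \<comment> \<open>One step of division by the minimal polynomial. The multiple
        \<open>m * P\<close> satisfies the condition by the product rule, since \<open>P\<close>
        vanishes at \<open>a\<close> and satisfies it itself.\<close>
      define c where "c = lead_coeff p / lead_coeff P"
      define m where "m = monom c (degree p - degree P)"
      define r where "r = p - m * P"
      have c0: "c \<noteq> 0" using False P(2) by (simp add: c_def)
      have "c \<in> K" using less.prems(1) P(1) by (auto simp: c_def polys_over_def intro: subfieldD[OF K])
      then have m: "m \<in> polys_over K" by (simp add: m_def polys_over_monom[OF K])
      have r: "r \<in> polys_over K" unfolding r_def
        by (intro polys_over_diff[OF K] polys_over_mult[OF K] less.prems P m)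
      have ra: "poly r a = 0" using less.prems P by (simp add: r_def)
      have degm: "degree (m * P) = degree p"
        using c0 P(2) deg unfolding m_def by (subst degree_mult_eq) (auto simp: degree_monom_eq)
      have "lead_coeff (m * P) = lead_coeff p"
        using P(2) lead_coeff_monom[of c "degree p - degree P"]
        unfolding lead_coeff_mult m_def[symmetric] by (simp add: c_def)
      then have "coeff r (degree p) = 0"
        by (metis coeff_diff degm diff_self r_def)
      moreover have "degree r \<le> degree p"
        unfolding r_def by (rule degree_diff_le) (use degm in simp_all)
      ultimately have "r = 0 \<or> degree r < degree p"
        by (metis leading_coeff_0_iff le_neq_implies_less)
      then have *: "poly (map_poly d r) a + poly (pderiv r) a * b = 0"
        using less.hyps[OF _ r ra] by auto
      have p: "p = r + m * P" by (simp add: r_def)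
      have "poly m a * (poly (map_poly d P) a + poly (pderiv P) a * b) = 0"
        using Pb by simp
      with * show ?thesis
        by (simp add: p map_poly_partial_derivation[OF d] r m P polys_over_mult[OF K] pderiv_add pderiv_mult
            algebra_simps)
    qed simp
  qed
  from der_graph_adjoin[OF d this] show ?thesis by blast
qed

text \<open>Zorn's lemma gives a maximal graph above \<open>G\<close>; its domain is everything,
  because \<open>der_graph_extend\<close> could otherwise enlarge it.\<close>

lemma der_graph_total:
  assumes G: "der_graph G"
  obtains D where "derivation D" "\<And>a b. (a, b) \<in> G \<Longrightarrow> D a = b"
proof -
  let ?\<A> = "{H. der_graph H \<and> G \<subseteq> H}"
  have "\<exists>M\<in>?\<A>. \<forall>X\<in>?\<A>. M \<subseteq> X \<longrightarrow> X = M"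
  proof (rule subset_Zorn_nonempty)
    show "?\<A> \<noteq> {}" using G by blast
    fix \<C> assume ne: "\<C> \<noteq> {}" and ch: "subset.chain ?\<A> \<C>"
    have two: "\<exists>H\<in>\<C>. x \<in> H \<and> y \<in> H" if "x \<in> \<Union>\<C>" "y \<in> \<Union>\<C>" for x y
      using that ch unfolding subset_chain_def by blast
    have gr: "der_graph H" if "H \<in> \<C>" for H using ch that unfolding subset_chain_def by blast
    have "der_graph (\<Union>\<C>)" unfolding der_graph_def
    proof (intro conjI allI impI)
      show "(1, 0) \<in> \<Union>\<C>" using ne gr unfolding der_graph_def by blast
    next
      fix a b c d assume "(a, b) \<in> \<Union>\<C>" "(c, d) \<in> \<Union>\<C>"
      then obtain H where H: "H \<in> \<C>" "(a, b) \<in> H" "(c, d) \<in> H" using two by blast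
      then have "(a + c, b + d) \<in> H" "(a * c, a * d + c * b) \<in> H"
        using gr[OF H(1)] unfolding der_graph_def by blast+
      then show "(a + c, b + d) \<in> \<Union>\<C>" "(a * c, a * d + c * b) \<in> \<Union>\<C>" using H(1) by blast+
    next
      fix a b assume "(a, b) \<in> \<Union>\<C>"
      then obtain H where H: "H \<in> \<C>" "(a, b) \<in> H" by blast
      then have "(- a, - b) \<in> H" "(inverse a, - b / a\<^sup>2) \<in> H"
        using gr[OF H(1)] unfolding der_graph_def by blast+
      then show "(- a, - b) \<in> \<Union>\<C>" "(inverse a, - b / a\<^sup>2) \<in> \<Union>\<C>" using H(1) by blast+
    next
      fix b assume "(0, b) \<in> \<Union>\<C>"
      then obtain H where H: "H \<in> \<C>" "(0, b) \<in> H" by blast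
      then show "b = 0" using gr[OF H(1)] unfolding der_graph_def by blast
    qed
    moreover have "G \<subseteq> \<Union>\<C>" using ne ch unfolding subset_chain_def by blast
    ultimately show "\<Union>\<C> \<in> ?\<A>" by blast
  qed
  then obtain M where MA: "M \<in> ?\<A>" and maxA: "\<forall>X\<in>?\<A>. M \<subseteq> X \<longrightarrow> X = M"
    by (elim bexE)
  have M: "der_graph M" "G \<subseteq> M" using MA by simp_all
  have max: "X = M" if "der_graph X" "M \<subseteq> X" for X
    using maxA[rule_format, of X] that M(2) by auto
  obtain K d where Kd: "partial_derivation K d" "M = {(x, d x) | x. x \<in> K}"
    using der_graphE[OF M(1)] by blast
  have "x \<in> K" for x
  proof -
    obtain H b where H: "der_graph H" "M \<subseteq> H" "(x, b) \<in> H"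
      using der_graph_extend[OF Kd(1), of x] Kd(2) by auto
    then show ?thesis using max[OF H(1,2)] Kd(2) by auto
  qed
  then have "derivation d"
    using Kd(1) unfolding partial_derivation_def derivation_def by blast
  moreover have "d a = b" if "(a, b) \<in> G" for a b using that M(2) Kd(2) by auto
  ultimately show ?thesis using that by blast
qed

text \<open>Only the zero polynomial over \<open>K\<close> vanishes at a transcendental
  \<open>a\<close>, so the zero derivation of \<open>K\<close> extends with any prescribed value at
  \<open>a\<close>.\<close>

lemma derivation_exists:
  assumes K: "is_subfield K" and a: "a \<notin> alg_closure K"
  obtains D where "derivation D" "\<And>x. x \<in> K \<Longrightarrow> D x = 0" "D a = 1"
proof -
  have d: "partial_derivation K (\<lambda>_. 0)" using K by (simp add: partial_derivation_def)
  have "\<And>p. p \<in> polys_over K \<Longrightarrow> poly p a = 0 \<Longrightarrow> p = 0"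
    using a by (auto simp: alg_closure_iff)
  then have "poly (map_poly (\<lambda>_. 0) p) a + poly (pderiv p) a * 1 = 0"
    if "p \<in> polys_over K" "poly p a = 0" for p using that by fastforce
  from der_graph_adjoin[OF d this] obtain G where
    G: "der_graph G" "{(x, 0) | x. x \<in> K} \<subseteq> G" "(a, 1) \<in> G" by auto
  obtain D where "derivation D" "\<And>a b. (a, b) \<in> G \<Longrightarrow> D a = b"
    using der_graph_total[OF G(1)] by metis
  then show ?thesis using G that[of D] by blast
qed


section \<open>Algebraic dependence as a pregeometry cut out by derivations\<close>

subsection \<open>The closure operator defined by derivations\<close>

text \<open>This is the algebraic closure in \<complex> of the field generated by \<open>A\<close>,
  see \<open>alg_closure_adjoin_Rats\<close>. In this form monotonicity, idempotence and exchange
  become statements about the vector space of derivations.\<close>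

definition der_cl :: "complex set \<Rightarrow> complex set" where
  "der_cl A = {x. \<forall>D. derivation D \<longrightarrow> (\<forall>a\<in>A. D a = 0) \<longrightarrow> D x = 0}"

lemma der_clI: "(\<And>D. derivation D \<Longrightarrow> (\<And>a. a \<in> A \<Longrightarrow> D a = 0) \<Longrightarrow> D x = 0) \<Longrightarrow> x \<in> der_cl A"
  by (auto simp: der_cl_def)

lemma der_clD: "x \<in> der_cl A \<Longrightarrow> derivation D \<Longrightarrow> (\<And>a. a \<in> A \<Longrightarrow> D a = 0) \<Longrightarrow> D x = 0"
  by (auto simp: der_cl_def)

lemma not_der_clE:
  assumes "x \<notin> der_cl A"
  obtains D where "derivation D" "\<And>a. a \<in> A \<Longrightarrow> D a = 0" "D x = 1"
proof -
  obtain D where D: "derivation D" "\<forall>a\<in>A. D a = 0" "D x \<noteq> 0"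
    using assms by (auto simp: der_cl_def)
  show ?thesis
    by (rule that[of "\<lambda>y. inverse (D x) * D y"]) (use D derivation_scale[OF D(1)] in auto)
qed

lemma der_cl_superset: "A \<subseteq> der_cl A"
  by (auto simp: der_cl_def)

lemma der_cl_mono: "A \<subseteq> B \<Longrightarrow> der_cl A \<subseteq> der_cl B"
  by (auto simp: der_cl_def)

lemma der_cl_least: "A \<subseteq> der_cl B \<Longrightarrow> der_cl A \<subseteq> der_cl B"
  unfolding der_cl_def by blast

lemma der_cl_idem: "der_cl (der_cl A) = der_cl A"
  by (simp add: der_cl_least der_cl_superset subset_antisym)

lemma is_subfield_der_cl: "is_subfield (der_cl A)"
proof -
  have "der_cl A = \<Inter>{{x. D x = 0} | D. derivation D \<and> (\<forall>a\<in>A. D a = 0)}"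
    by (auto simp: der_cl_def)
  then show ?thesis by (auto intro!: is_subfield_Inter is_subfield_derivation_kernel)
qed

lemma der_cl_adjoin: "der_cl (adjoin K X) = der_cl (K \<union> X)"
  using subset_adjoin[of K X] adjoin_least[OF is_subfield_der_cl der_cl_superset, of K X]
  by (intro subset_antisym der_cl_mono der_cl_least)

lemma alg_closure_eq_der_cl:
  assumes "is_subfield K"
  shows "alg_closure K = der_cl K"
proof (intro subset_antisym subsetI)
  fix x assume "x \<in> alg_closure K"
  then show "x \<in> der_cl K" by (intro der_clI) (rule derivation_alg_closure[OF _ _ assms])
next
  fix x assume "x \<in> der_cl K"
  then show "x \<in> alg_closure K"
    using derivation_exists[OF assms, of x] by (metis der_clD zero_neq_one)
qed

lemma alg_closure_adjoin: "alg_closure (adjoin K X) = der_cl (K \<union> X)"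
  by (simp add: alg_closure_eq_der_cl is_subfield_adjoin der_cl_adjoin)

lemma der_cl_Rats_Un: "der_cl (\<rat> \<union> X) = der_cl X"
  by (auto simp: der_cl_def derivation_Rats)

lemma alg_closure_adjoin_Rats: "alg_closure (adjoin \<rat> X) = der_cl X"
  by (simp add: alg_closure_adjoin der_cl_Rats_Un)

lemma der_cl_of_rat: "of_rat q \<in> der_cl A"
  by (rule subfield_of_rat[OF is_subfield_der_cl])

text \<open>Finiteness is invisible in the definition by derivations and is recovered from
  polynomials: the union \<open>U\<close> of the closures of the finite subsets of \<open>A\<close>
  is a field containing \<open>A\<close>, so \<open>x\<close> is a root of a polynomial over
  \<open>U\<close>, whose finitely many coefficients already lie in one of these closures.\<close>

lemma der_cl_finite_char:
  assumes "x \<in> der_cl A"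
  obtains A0 where "finite A0" "A0 \<subseteq> A" "x \<in> der_cl A0"
proof -
  define U where "U = (\<Union>A0\<in>{A0. finite A0 \<and> A0 \<subseteq> A}. der_cl A0)"
  have UI: "x \<in> U" if "x \<in> der_cl A0" "finite A0" "A0 \<subseteq> A" for x A0
    using that unfolding U_def by blast
  have fin: "\<exists>A0. finite A0 \<and> A0 \<subseteq> A \<and> S \<subseteq> der_cl A0" if "finite S" "S \<subseteq> U" for S
    using that
  proof (induction S)
    case (insert s S)
    then obtain A0 where A0: "finite A0" "A0 \<subseteq> A" "S \<subseteq> der_cl A0" by auto
    obtain A1 where A1: "finite A1" "A1 \<subseteq> A" "s \<in> der_cl A1" using insert.prems unfolding U_def by auto
    note * = A0 A1
    then have "insert s S \<subseteq> der_cl (A0 \<union> A1)"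
      using der_cl_mono[of A0 "A0 \<union> A1"] der_cl_mono[of A1 "A0 \<union> A1"] by blast
    then show ?case using * by (intro exI[of _ "A0 \<union> A1"]) auto
  qed auto
  note fld = subfieldD[OF is_subfield_der_cl]
  have U: "is_subfield U" unfolding is_subfield_def
  proof (intro conjI ballI)
    show "0 \<in> U" "1 \<in> U" by (rule UI[of _ "{}"], simp_all add: fld)+
  next
    fix x y assume "x \<in> U" "y \<in> U"
    then obtain A0 where "finite A0" "A0 \<subseteq> A" "{x, y} \<subseteq> der_cl A0" using fin[of "{x, y}"] by auto
    then show "x + y \<in> U" "x * y \<in> U" by (auto intro!: UI[of _ A0] fld)
  next
    fix x assume "x \<in> U"
    then obtain A0 where "finite A0" "A0 \<subseteq> A" "{x} \<subseteq> der_cl A0" using fin[of "{x}"] by auto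
    then show "- x \<in> U" "inverse x \<in> U" by (auto intro!: UI[of _ A0] fld)
  qed
  have AU: "A \<subseteq> U"
  proof
    fix a assume "a \<in> A"
    then show "a \<in> U" using der_cl_superset[of "{a}"] by (intro UI[of _ "{a}"]) auto
  qed
  have "x \<in> alg_closure U"
    using assms der_cl_mono[OF AU] by (auto simp: alg_closure_eq_der_cl[OF U])
  then obtain p where p: "p \<in> polys_over U" "p \<noteq> 0" "poly p x = 0" by (auto simp: alg_closure_iff)
  have "range (coeff p) = coeff p ` {..degree p} \<union> coeff p ` {degree p<..}"
    by (auto simp: image_Un[symmetric])
  moreover have "coeff p ` {degree p<..} \<subseteq> {0}" by (auto simp: coeff_eq_0)
  ultimately have "finite (range (coeff p))" by (auto intro: finite_subset)
  moreover have "range (coeff p) \<subseteq> U" using p(1) by (auto simp: polys_over_def)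
  ultimately have "\<exists>A0. finite A0 \<and> A0 \<subseteq> A \<and> range (coeff p) \<subseteq> der_cl A0" by (rule fin)
  then obtain A0 where A0: "finite A0" "A0 \<subseteq> A" "range (coeff p) \<subseteq> der_cl A0" by (elim exE conjE)
  then have "p \<in> polys_over (der_cl A0)" by (auto simp: polys_over_def)
  then have "x \<in> alg_closure (der_cl A0)" using p by (auto simp: alg_closure_iff)
  then have "x \<in> der_cl A0" by (simp add: alg_closure_eq_der_cl is_subfield_der_cl der_cl_idem)
  then show ?thesis using A0 that by blast
qed

lemma der_cl_finite_char_set:
  assumes "finite S" "S \<subseteq> der_cl A"
  obtains A0 where "finite A0" "A0 \<subseteq> A" "S \<subseteq> der_cl A0"
proof -
  have "\<exists>A0. finite A0 \<and> A0 \<subseteq> A \<and> S \<subseteq> der_cl A0" using assms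
  proof (induction S)
    case (insert s S)
    then obtain A0 where *: "finite A0" "A0 \<subseteq> A" "S \<subseteq> der_cl A0" by auto
    obtain A1 where **: "finite A1" "A1 \<subseteq> A" "s \<in> der_cl A1"
      using der_cl_finite_char[of s A] insert.prems by blast
    have "insert s S \<subseteq> der_cl (A0 \<union> A1)"
      using * ** der_cl_mono[of A0 "A0 \<union> A1"] der_cl_mono[of A1 "A0 \<union> A1"] by blast
    then show ?case using * ** by (intro exI[of _ "A0 \<union> A1"]) auto
  qed auto
  then show ?thesis using that by blast
qed

text \<open>If \<open>\<delta>\<close> vanishes on \<open>A\<close>, so does the commutator of \<open>\<delta>\<close> and \<open>D\<close>.\<close>

lemma derivation_preserves_der_cl:
  assumes D: "derivation D" and A: "\<And>a. a \<in> A \<Longrightarrow> D a \<in> der_cl A" and x: "x \<in> der_cl A"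
  shows "D x \<in> der_cl A"
proof (rule der_clI)
  fix \<delta> assume \<delta>: "derivation \<delta>" "\<And>a. a \<in> A \<Longrightarrow> \<delta> a = 0"
  have "\<delta> (D x) - D (\<delta> x) = 0"
    by (rule der_clD[OF x derivation_commutator[OF \<delta>(1) D]])
      (simp add: \<delta> der_clD[OF A] derivation_0[OF D])
  then show "\<delta> (D x) = 0" using der_clD[OF x \<delta>] by (simp add: derivation_0[OF D])
qed

text \<open>If \<open>D\<close> vanishes on \<open>A\<close> and at \<open>x\<close> but not at
  \<open>y\<close>, a multiple of it can be subtracted from any derivation over \<open>A\<close> so
  as to kill \<open>y\<close> without changing the value at \<open>x\<close>; the first assumption
  then forces that value to be \<open>0\<close>.\<close>

lemma der_cl_exchange:
  assumes "x \<in> der_cl (insert y A)" "x \<notin> der_cl A"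
  shows "y \<in> der_cl (insert x A)"
proof (rule der_clI, rule ccontr)
  fix D assume D: "derivation D" "\<And>a. a \<in> insert x A \<Longrightarrow> D a = 0" and ne: "D y \<noteq> 0"
  obtain D' where D': "derivation D'" "\<And>a. a \<in> A \<Longrightarrow> D' a = 0" "D' x = 1"
    using not_der_clE[OF assms(2)] by metis
  have "D' x - D' y / D y * D x = 0"
    by (rule der_clD[OF assms(1) derivation_diff_fun[OF D'(1) derivation_scale[OF D(1)]]])
      (use D D' ne in auto)
  then show False using D D' by simp
qed

text \<open>The coefficients play the role of partial derivatives of \<open>x\<close> with respect
  to the elements of \<open>S\<close>. This is the bridge from algebraic dependence to linear
  algebra: the forms of numbers algebraic over \<open>S\<close> live in a space spanned by
  \<open>card S\<close> functions.\<close>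

lemma der_cl_lincomb:
  assumes "finite S" "x \<in> der_cl (A \<union> S)"
  shows "\<exists>c. \<forall>D. derivation D \<longrightarrow> (\<forall>a\<in>A. D a = 0) \<longrightarrow> D x = (\<Sum>s\<in>S. c s * D s)"
  using assms
proof (induction S arbitrary: A)
  case empty
  then show ?case by (auto simp: der_cl_def)
next
  case (insert y S)
  have "x \<in> der_cl (insert y A \<union> S)" using insert.prems by simp
  from insert.IH[OF this] obtain c where
    c: "\<And>D. derivation D \<Longrightarrow> (\<forall>a\<in>insert y A. D a = 0) \<Longrightarrow> D x = (\<Sum>s\<in>S. c s * D s)" by blast
  show ?case
  proof (cases "y \<in> der_cl A")
    case True
    have "D x = (\<Sum>s\<in>insert y S. c s * D s)" if "derivation D" "\<forall>a\<in>A. D a = 0" for D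
      using c[OF that(1)] that der_clD[OF True that(1)] insert.hyps by auto
    then show ?thesis by blast
  next
    case False
    obtain D0 where D0: "derivation D0" "\<And>a. a \<in> A \<Longrightarrow> D0 a = 0" "D0 y = 1"
      using not_der_clE[OF False] by metis
    \<comment> \<open>The derivation \<open>D - D y * D0\<close> kills \<open>y\<close>, so the
      coefficients for \<open>S\<close> found by induction apply to it; what is left over is
      collected into the coefficient of \<open>y\<close>.\<close>
    define c' where "c' = c(y := D0 x - (\<Sum>s\<in>S. c s * D0 s))"
    have "D x = (\<Sum>s\<in>insert y S. c' s * D s)" if D: "derivation D" "\<forall>a\<in>A. D a = 0" for D
    proof -
      have "D x - D y * D0 x = (\<Sum>s\<in>S. c s * (D s - D y * D0 s))"
        by (rule c[OF derivation_diff_fun[OF D(1) derivation_scale[OF D0(1)]]]) (use D D0 in auto)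
      also have "\<dots> = (\<Sum>s\<in>S. c s * D s) - D y * (\<Sum>s\<in>S. c s * D0 s)"
        by (simp add: sum_subtractf sum_distrib_left algebra_simps)
      moreover have "(\<Sum>s\<in>S. c' s * D s) = (\<Sum>s\<in>S. c s * D s)"
        using insert.hyps by (intro sum.cong) (auto simp: c'_def)
      ultimately show ?thesis using insert.hyps by (simp add: c'_def algebra_simps)
    qed
    then show ?thesis by blast
  qed
qed

lemma der_cl_basis_exists:
  assumes "finite X"
  obtains S where "S \<subseteq> X" "X \<subseteq> der_cl S" "\<And>s. s \<in> S \<Longrightarrow> s \<notin> der_cl (S - {s})"
proof -
  let ?P = "\<lambda>S. S \<subseteq> X \<and> X \<subseteq> der_cl S"
  have "?P X" by (simp add: der_cl_superset)
  then obtain S where S: "?P S" "\<And>S'. ?P S' \<Longrightarrow> card S \<le> card S'"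
    using ex_has_least_nat[of ?P X card] by blast
  have "s \<notin> der_cl (S - {s})" if "s \<in> S" for s
  proof
    assume "s \<in> der_cl (S - {s})"
    then have "S \<subseteq> der_cl (S - {s})" using der_cl_superset[of "S - {s}"] by blast
    then have "?P (S - {s})" using S(1) der_cl_least by blast
    then have "card S \<le> card (S - {s})" by (rule S(2))
    moreover have "finite S" using S(1) assms finite_subset by blast
    ultimately show False using that by (meson card_Diff1_less leD)
  qed
  then show ?thesis using S(1) that by blast
qed

lemma nontrivial_solution:
  fixes m :: "'a \<Rightarrow> 'b \<Rightarrow> 'c :: field"
  assumes "finite S" "finite I" "card S < card I"
  shows "\<exists>c. (\<exists>i\<in>I. c i \<noteq> 0) \<and> (\<forall>s\<in>S. (\<Sum>i\<in>I. c i * m i s) = 0)"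
  using assms
proof (induction S arbitrary: I m)
  case empty
  then obtain i where "i \<in> I" by force
  then show ?case by (intro exI[of _ "\<lambda>_. 1"]) auto
next
  case (insert s S)
  show ?case
  proof (cases "\<exists>i0\<in>I. m i0 s \<noteq> 0")
    case False
    then show ?thesis using insert.IH[of I m] insert.prems insert.hyps by auto
  next
    case True
    then obtain i0 where i0: "i0 \<in> I" "m i0 s \<noteq> 0" by blast
    define J where "J = I - {i0}"
    \<comment> \<open>Gaussian elimination with pivot \<open>m i0 s\<close>: the equation for
      \<open>s\<close> becomes trivial, and one unknown disappears with it.\<close>
    define m' where "m' i t = m i t - m i s / m i0 s * m i0 t" for i t
    have J: "finite J" "card S < card J" "i0 \<notin> J" "I = insert i0 J"
      using insert i0 by (auto simp: J_def)
    from insert.IH[OF J(1,2), of m'] obtain c where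
      c: "\<exists>i\<in>J. c i \<noteq> 0" "\<And>t. t \<in> S \<Longrightarrow> (\<Sum>i\<in>J. c i * m' i t) = 0" by blast
    define c' where "c' = c(i0 := - (\<Sum>i\<in>J. c i * m i s / m i0 s))"
    have c': "(\<Sum>i\<in>I. c' i * m i t) = (\<Sum>i\<in>J. c i * m' i t)" for t
    proof -
      have "(\<Sum>i\<in>J. c' i * m i t) = (\<Sum>i\<in>J. c i * m i t)"
        using J(3) by (intro sum.cong) (auto simp: c'_def)
      then show ?thesis using J
        by (simp add: c'_def m'_def sum_distrib_right sum_distrib_left sum_subtractf algebra_simps)
    qed
    have "(\<Sum>i\<in>I. c' i * m i t) = 0" if "t \<in> insert s S" for t
      using that c(2) i0(2) unfolding c' by (auto simp: m'_def)
    moreover have "\<exists>i\<in>I. c' i \<noteq> 0" using c(1) J by (auto simp: c'_def)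
    ultimately show ?thesis by blast
  qed
qed

text \<open>Differentiating a relation in which some coefficient is \<open>1\<close> gives one of smaller support.\<close>

lemma minimal_relation:
  fixes Rel :: "('a \<Rightarrow> complex) \<Rightarrow> bool"
  assumes I: "finite I" and c: "Rel c" "i \<in> I" "c i \<noteq> 0"
    and scale: "\<And>c i. Rel c \<Longrightarrow> i \<in> I \<Longrightarrow> c i \<noteq> 0 \<Longrightarrow> Rel (\<lambda>j. c j / c i)"
  obtains c i where "Rel c" "i \<in> I" "c i = 1"
    "\<And>c'. Rel c' \<Longrightarrow> (\<And>j. j \<in> I \<Longrightarrow> c j = 0 \<Longrightarrow> c' j = 0) \<Longrightarrow> c' i = 0 \<Longrightarrow> (\<And>j. j \<in> I \<Longrightarrow> c' j = 0)"
proof -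
  let ?supp = "\<lambda>c. {j\<in>I. c j \<noteq> 0}"
  let ?P = "\<lambda>c. Rel c \<and> ?supp c \<noteq> {}"
  have "?P c" using c by blast
  then obtain c0 where c0: "?P c0" "\<And>c'. ?P c' \<Longrightarrow> card (?supp c0) \<le> card (?supp c')"
    using ex_has_least_nat[of ?P c "\<lambda>c. card (?supp c)"] by blast
  then obtain i where i: "i \<in> I" "c0 i \<noteq> 0" by blast
  define c1 where "c1 = (\<lambda>j. c0 j / c0 i)"
  have "c' j = 0" if c': "Rel c'" "\<And>j. j \<in> I \<Longrightarrow> c1 j = 0 \<Longrightarrow> c' j = 0" "c' i = 0" and "j \<in> I" for c' j
  proof (rule ccontr)
    assume "c' j \<noteq> 0"
    then have "card (?supp c0) \<le> card (?supp c')" using c0(2)[of c'] c'(1) \<open>j \<in> I\<close> by blast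
    moreover have "?supp c' \<subset> ?supp c0" using c' i by (auto simp: c1_def)
    ultimately show False using psubset_card_mono[of "?supp c0" "?supp c'"] I by auto
  qed
  moreover have "Rel c1" using scale[of c0 i] c0(1) i by (simp add: c1_def)
  moreover have "c1 i = 1" using i by (simp add: c1_def)
  ultimately show ?thesis using that[of c1 i] i(1) by metis
qed


subsection \<open>Algebraic independence\<close>

abbreviation eval_mono :: "(complex \<Rightarrow>\<^sub>0 nat) \<Rightarrow> complex" where
  "eval_mono m \<equiv> (\<Prod>x\<in>Poly_Mapping.keys m. x ^ Poly_Mapping.lookup m x)"

definition mpolys_over :: "complex set \<Rightarrow> complex set \<Rightarrow> ((complex \<Rightarrow>\<^sub>0 nat) \<Rightarrow>\<^sub>0 complex) set" where
  "mpolys_over K S = {p. (\<forall>m. Poly_Mapping.lookup p m \<in> K) \<and>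
     (\<forall>m\<in>Poly_Mapping.keys p. Poly_Mapping.keys m \<subseteq> S)}"

lemma alg_indep_iff: "alg_indep K S \<longleftrightarrow> (\<forall>p\<in>mpolys_over K S. eval_mpoly p = 0 \<longrightarrow> p = 0)"
  by (auto simp: alg_indep_def mpolys_over_def)

lemma eval_mono_superset:
  assumes "finite A" "Poly_Mapping.keys m \<subseteq> A"
  shows "eval_mono m = (\<Prod>x\<in>A. x ^ Poly_Mapping.lookup m x)"
  by (rule prod.mono_neutral_left) (use assms in \<open>auto simp: in_keys_iff\<close>)

lemma eval_mpoly_superset:
  assumes "finite A" "Poly_Mapping.keys p \<subseteq> A"
  shows "eval_mpoly p = (\<Sum>m\<in>A. Poly_Mapping.lookup p m * eval_mono m)"
  unfolding eval_mpoly_def by (rule sum.mono_neutral_left) (use assms in \<open>auto simp: in_keys_iff\<close>)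

lemma eval_mono_add: "eval_mono (m + n) = eval_mono m * eval_mono n"
proof -
  let ?A = "Poly_Mapping.keys m \<union> Poly_Mapping.keys n"
  have "Poly_Mapping.keys (m + n) \<subseteq> ?A" by (rule Poly_Mapping.keys_add)
  then show ?thesis
    using eval_mono_superset[of ?A "m + n"] eval_mono_superset[of ?A m] eval_mono_superset[of ?A n]
    by (simp add: lookup_add power_add prod.distrib)
qed

lemma eval_mpoly_add: "eval_mpoly (p + q) = eval_mpoly p + eval_mpoly q"
proof -
  let ?A = "Poly_Mapping.keys p \<union> Poly_Mapping.keys q"
  have "Poly_Mapping.keys (p + q) \<subseteq> ?A" by (rule Poly_Mapping.keys_add)
  then show ?thesis
    using eval_mpoly_superset[of ?A "p + q"] eval_mpoly_superset[of ?A p] eval_mpoly_superset[of ?A q]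
    by (simp add: lookup_add ring_distribs sum.distrib)
qed

lemma eval_mpoly_0: "eval_mpoly 0 = 0"
  by (simp add: eval_mpoly_def)

lemma eval_mpoly_single: "eval_mpoly (Poly_Mapping.single m c) = c * eval_mono m"
  by (cases "c = 0") (simp_all add: eval_mpoly_def)

lemma eval_mpoly_sum: "eval_mpoly (sum f I) = (\<Sum>i\<in>I. eval_mpoly (f i))"
  by (induction I rule: infinite_finite_induct) (simp_all add: eval_mpoly_0 eval_mpoly_add)

lemma eval_mpoly_uminus: "eval_mpoly (- p) = - eval_mpoly p"
  using eval_mpoly_add[of p "- p"] by (simp add: eval_mpoly_0 add_eq_0_iff)

lemma mpoly_eq_sum_single:
  "p = (\<Sum>m\<in>Poly_Mapping.keys p. Poly_Mapping.single m (Poly_Mapping.lookup p m))"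
  by (rule poly_mapping_eqI) (simp add: lookup_sum lookup_single when_def in_keys_iff)

lemma eval_mpoly_mult: "eval_mpoly (p * q) = eval_mpoly p * eval_mpoly q"
proof -
  have "p * q = (\<Sum>m\<in>Poly_Mapping.keys p. \<Sum>n\<in>Poly_Mapping.keys q.
      Poly_Mapping.single (m + n) (Poly_Mapping.lookup p m * Poly_Mapping.lookup q n))"
    by (subst mpoly_eq_sum_single[of p], subst mpoly_eq_sum_single[of q])
      (simp add: sum_product mult_single)
  also have "eval_mpoly \<dots> = eval_mpoly p * eval_mpoly q"
    by (simp add: eval_mpoly_sum eval_mpoly_single eval_mono_add eval_mpoly_def[of p] eval_mpoly_def[of q]
        sum_product mult_ac)
  finally show ?thesis .
qed

lemma
  assumes K: "is_subfield K"
  shows mpolys_over_add: "p \<in> mpolys_over K S \<Longrightarrow> q \<in> mpolys_over K S \<Longrightarrow> p + q \<in> mpolys_over K S"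
    and mpolys_over_single: "c \<in> K \<Longrightarrow> Poly_Mapping.keys m \<subseteq> S \<Longrightarrow>
      Poly_Mapping.single m c \<in> mpolys_over K S"
    and mpolys_over_0: "0 \<in> mpolys_over K S"
    and mpolys_over_uminus: "p \<in> mpolys_over K S \<Longrightarrow> - p \<in> mpolys_over K S"
proof -
  note * = subfieldD[OF K]
  show "p \<in> mpolys_over K S \<Longrightarrow> q \<in> mpolys_over K S \<Longrightarrow> p + q \<in> mpolys_over K S"
    using subsetD[OF Poly_Mapping.keys_add[of p q]] unfolding mpolys_over_def
    by (auto simp: lookup_add intro!: *) blast
  show "c \<in> K \<Longrightarrow> Poly_Mapping.keys m \<subseteq> S \<Longrightarrow> Poly_Mapping.single m c \<in> mpolys_over K S"
    by (auto simp: mpolys_over_def lookup_single when_def intro: * split: if_splits)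
  show "0 \<in> mpolys_over K S" by (simp add: mpolys_over_def *)
  show "p \<in> mpolys_over K S \<Longrightarrow> - p \<in> mpolys_over K S"
    by (auto simp: mpolys_over_def in_keys_iff intro: *)
qed

lemma mpolys_over_sum:
  "is_subfield K \<Longrightarrow> (\<And>i. i \<in> I \<Longrightarrow> f i \<in> mpolys_over K S) \<Longrightarrow> sum f I \<in> mpolys_over K S"
  by (induction I rule: infinite_finite_induct) (auto intro: mpolys_over_0 mpolys_over_add)

lemma mpolys_over_mult:
  assumes K: "is_subfield K" and p: "p \<in> mpolys_over K S" and q: "q \<in> mpolys_over K S"
  shows "p * q \<in> mpolys_over K S"
proof -
  have *: "p * q = (\<Sum>m\<in>Poly_Mapping.keys p. \<Sum>n\<in>Poly_Mapping.keys q.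
      Poly_Mapping.single (m + n) (Poly_Mapping.lookup p m * Poly_Mapping.lookup q n))"
    by (subst mpoly_eq_sum_single[of p], subst mpoly_eq_sum_single[of q])
      (simp add: sum_product mult_single)
  have "Poly_Mapping.keys (m + n) \<subseteq> S" if "m \<in> Poly_Mapping.keys p" "n \<in> Poly_Mapping.keys q" for m n
    using that p q Poly_Mapping.keys_add[of m n] by (fastforce simp: mpolys_over_def)
  then show ?thesis unfolding *
    using p q by (intro mpolys_over_sum mpolys_over_single K subfieldD(4)[OF K])
      (auto simp: mpolys_over_def)
qed

definition mpoly_ring :: "complex set \<Rightarrow> complex set \<Rightarrow> complex set" where
  "mpoly_ring K S = eval_mpoly ` mpolys_over K S"

lemma
  assumes K: "is_subfield K"
  shows mpoly_ring_add: "x \<in> mpoly_ring K S \<Longrightarrow> y \<in> mpoly_ring K S \<Longrightarrow> x + y \<in> mpoly_ring K S"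
    and mpoly_ring_mult: "x \<in> mpoly_ring K S \<Longrightarrow> y \<in> mpoly_ring K S \<Longrightarrow> x * y \<in> mpoly_ring K S"
    and mpoly_ring_uminus: "x \<in> mpoly_ring K S \<Longrightarrow> - x \<in> mpoly_ring K S"
    and mpoly_ring_base: "c \<in> K \<Longrightarrow> c \<in> mpoly_ring K S"
    and mpoly_ring_var: "s \<in> S \<Longrightarrow> s \<in> mpoly_ring K S"
proof -
  show "x \<in> mpoly_ring K S \<Longrightarrow> y \<in> mpoly_ring K S \<Longrightarrow> x + y \<in> mpoly_ring K S"
    unfolding mpoly_ring_def by (auto simp: eval_mpoly_add[symmetric] intro!: imageI mpolys_over_add[OF K])
  show "x \<in> mpoly_ring K S \<Longrightarrow> y \<in> mpoly_ring K S \<Longrightarrow> x * y \<in> mpoly_ring K S"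
    unfolding mpoly_ring_def by (auto simp: eval_mpoly_mult[symmetric] intro!: imageI mpolys_over_mult[OF K])
  show "x \<in> mpoly_ring K S \<Longrightarrow> - x \<in> mpoly_ring K S"
    unfolding mpoly_ring_def by (auto simp: eval_mpoly_uminus[symmetric] intro!: imageI mpolys_over_uminus[OF K])
  show "c \<in> mpoly_ring K S" if "c \<in> K"
    unfolding mpoly_ring_def
    by (rule image_eqI[of _ _ "Poly_Mapping.single 0 c"])
      (use that in \<open>auto simp: eval_mpoly_single intro: mpolys_over_single[OF K]\<close>)
  show "s \<in> mpoly_ring K S" if "s \<in> S"
    unfolding mpoly_ring_def
    by (rule image_eqI[of _ _ "Poly_Mapping.single (Poly_Mapping.single s 1) 1"])
      (use that in \<open>auto simp: eval_mpoly_single intro: mpolys_over_single[OF K] subfieldD[OF K]\<close>)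
qed

lemma mpoly_ring_prod:
  "is_subfield K \<Longrightarrow> (\<And>i. i \<in> I \<Longrightarrow> f i \<in> mpoly_ring K S) \<Longrightarrow> prod f I \<in> mpoly_ring K S"
  by (induction I rule: infinite_finite_induct) (auto intro: mpoly_ring_mult mpoly_ring_base subfieldD)

lemma is_subfield_fractions:
  fixes R :: "complex set"
  assumes R: "1 \<in> R" "\<And>x y. x \<in> R \<Longrightarrow> y \<in> R \<Longrightarrow> x + y \<in> R" "\<And>x y. x \<in> R \<Longrightarrow> y \<in> R \<Longrightarrow> x * y \<in> R"
    "\<And>x. x \<in> R \<Longrightarrow> - x \<in> R"
  shows "is_subfield {a / b | a b. a \<in> R \<and> b \<in> R \<and> b \<noteq> 0}" (is "is_subfield ?F")
proof -
  have FI: "x \<in> ?F" if "x = a / b" "a \<in> R" "b \<in> R" "b \<noteq> 0" for x a b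
    using that by blast
  have 0: "0 \<in> R" using R(2)[OF R(1) R(4)[OF R(1)]] by simp
  show ?thesis unfolding is_subfield_def
  proof (intro conjI ballI)
    show "0 \<in> ?F" by (rule FI[of _ 0 1]) (use 0 R(1) in auto)
    show "1 \<in> ?F" by (rule FI[of _ 1 1]) (use R(1) in auto)
  next
    fix x y assume "x \<in> ?F" "y \<in> ?F"
    then obtain a b c d where *: "a \<in> R" "b \<in> R" "b \<noteq> 0" "c \<in> R"
      "d \<in> R" "d \<noteq> 0" and xy: "x = a / b" "y = c / d" by blast
    show "x + y \<in> ?F"
      by (rule FI[of _ "a * d + c * b" "b * d"]) (use * in \<open>auto simp: xy field_simps intro!: R\<close>)
    show "x * y \<in> ?F"
      by (rule FI[of _ "a * c" "b * d"]) (use * in \<open>auto simp: xy intro!: R\<close>)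
  next
    fix x assume "x \<in> ?F"
    then obtain a b where *: "a \<in> R" "b \<in> R" "b \<noteq> 0" and x: "x = a / b" by blast
    show "- x \<in> ?F" by (rule FI[of _ "- a" b]) (use * in \<open>auto simp: x intro!: R\<close>)
    show "inverse x \<in> ?F"
    proof (cases "a = 0")
      case True
      show ?thesis by (rule FI[of _ 0 1]) (use True x 0 R(1) in auto)
    next
      case False
      show ?thesis by (rule FI[of _ b a]) (use * False x in auto)
    qed
  qed
qed

lemma adjoin_subset_fractions:
  assumes K: "is_subfield K"
  shows "adjoin K S \<subseteq> {a / b | a b. a \<in> mpoly_ring K S \<and> b \<in> mpoly_ring K S \<and> b \<noteq> 0}" (is "_ \<subseteq> ?F")
proof (rule adjoin_least)
  have 1: "1 \<in> mpoly_ring K S"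
    by (auto intro: mpoly_ring_base[OF K] subfieldD[OF K])
  show "is_subfield ?F"
    by (rule is_subfield_fractions[OF 1 mpoly_ring_add[OF K] mpoly_ring_mult[OF K] mpoly_ring_uminus[OF K]])
  show "K \<union> S \<subseteq> ?F"
  proof
    fix x assume "x \<in> K \<union> S"
    then have "x \<in> mpoly_ring K S" by (auto intro: mpoly_ring_base[OF K] mpoly_ring_var[OF K])
    moreover have "x = x / 1" by simp
    ultimately show "x \<in> ?F" using 1 one_neq_zero by blast
  qed
qed

text \<open>Algebraicity gives a one-variable polynomial over \<open>K(S - {s})\<close>. Multiplying
  it by the common denominator \<open>B\<close> and replacing its variable by the indeterminate
  named \<open>s\<close> gives \<open>P\<close>, a relation over \<open>K\<close> among the elements
  of \<open>S\<close>. It is nonzero because a monomial coming from the leading coefficient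
  survives.\<close>

lemma alg_indep_not_der_cl:
  assumes K: "is_subfield K" and ind: "alg_indep K S" and s: "s \<in> S"
  shows "s \<notin> der_cl (K \<union> (S - {s}))"
proof
  define S' where "S' = S - {s}"
  define R where "R = mpoly_ring K S'"
  assume "s \<in> der_cl (K \<union> (S - {s}))"
  then have "s \<in> alg_closure (adjoin K S')" by (simp add: alg_closure_adjoin S'_def)
  then obtain p where p: "p \<in> polys_over (adjoin K S')" "p \<noteq> 0" "poly p s = 0" by (auto simp: alg_closure_iff)
  have "\<exists>a b. coeff p i = a / b \<and> a \<in> R \<and> b \<in> R \<and> b \<noteq> 0" for i
    using p(1) adjoin_subset_fractions[OF K, of S'] unfolding polys_over_def R_def by blast
  then obtain a b where ab: "\<And>i. coeff p i = a i / b i" "\<And>i. a i \<in> R" "\<And>i. b i \<in> R" "\<And>i. b i \<noteq> (0::complex)"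
    by metis
  define N where "N = degree p"
  define B where "B = (\<Prod>i\<le>N. b i)"
  have B0: "B \<noteq> 0" using ab(4) by (simp add: B_def)
  have "B * coeff p i \<in> R" if "i \<le> N" for i
  proof -
    have "B * coeff p i = a i * (\<Prod>j\<in>{..N} - {i}. b j)"
      using that ab(4)[of i] by (simp add: B_def ab(1) prod.remove[of "{..N}" i])
    then show ?thesis using ab unfolding R_def by (auto intro!: mpoly_ring_mult[OF K] mpoly_ring_prod[OF K])
  qed
  then have "\<forall>i. \<exists>q. i \<le> N \<longrightarrow> q \<in> mpolys_over K S' \<and> eval_mpoly q = B * coeff p i"
    unfolding R_def mpoly_ring_def by (metis imageE)
  then obtain q where q: "\<And>i. i \<le> N \<Longrightarrow> q i \<in> mpolys_over K S'" "\<And>i. i \<le> N \<Longrightarrow> eval_mpoly (q i) = B * coeff p i"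
    by metis
  define P where "P = (\<Sum>i\<le>N. \<Sum>m\<in>Poly_Mapping.keys (q i).
     Poly_Mapping.single (m + Poly_Mapping.single s i) (Poly_Mapping.lookup (q i) m))"
  have "eval_mpoly P = (\<Sum>i\<le>N. eval_mpoly (q i) * s ^ i)"
  proof -
    have "eval_mono (Poly_Mapping.single s i) = s ^ i" for i by (cases "i = 0") auto
    then show ?thesis
      unfolding P_def eval_mpoly_sum eval_mpoly_single eval_mono_add eval_mpoly_def[of "q _"]
      by (simp add: sum_distrib_right sum_distrib_left mult_ac)
  qed
  also have "\<dots> = B * poly p s"
    unfolding poly_altdef N_def[symmetric] by (simp add: sum_distrib_left q(2) mult_ac)
  finally have "eval_mpoly P = 0" using p(3) by simp
  moreover have "P \<in> mpolys_over K S"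
    unfolding P_def
  proof (intro mpolys_over_sum[OF K] mpolys_over_single[OF K])
    fix i m assume i: "i \<in> {..N}" and m: "m \<in> Poly_Mapping.keys (q i)"
    show "Poly_Mapping.lookup (q i) m \<in> K" using q(1)[of i] i by (auto simp: mpolys_over_def)
    have "Poly_Mapping.keys m \<subseteq> S" using q(1)[of i] i m by (auto simp: mpolys_over_def S'_def)
    moreover have "Poly_Mapping.keys (Poly_Mapping.single s i) \<subseteq> S" using s by (cases "i = 0") auto
    ultimately show "Poly_Mapping.keys (m + Poly_Mapping.single s i) \<subseteq> S"
      using Poly_Mapping.keys_add[of m "Poly_Mapping.single s i"] by blast
  qed
  ultimately have P0: "P = 0" using ind by (auto simp: alg_indep_iff)
  have "eval_mpoly (q N) \<noteq> 0" using q(2)[of N] B0 p(2) by (simp add: N_def)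
  then have "q N \<noteq> 0" by (auto simp: eval_mpoly_0)
  then obtain m0 where m0: "Poly_Mapping.lookup (q N) m0 \<noteq> 0" by (metis poly_mapping_eqI lookup_zero)
  have ms: "Poly_Mapping.lookup m s = 0" if "i \<le> N" "m \<in> Poly_Mapping.keys (q i)" for i m
    using q(1)[OF that(1)] that(2) not_in_keys_iff_lookup_eq_zero[of s m] unfolding mpolys_over_def S'_def by blast
  have m0k: "m0 \<in> Poly_Mapping.keys (q N)" using m0 by (simp add: in_keys_iff)
  \<comment> \<open>The monomials of \<open>q i\<close> do not contain \<open>s\<close>, so the
    exponent of \<open>s\<close> determines \<open>i\<close>, and no other term meets the chosen
    monomial.\<close>
  have eq: "m + Poly_Mapping.single s i = m0 + Poly_Mapping.single s N \<longleftrightarrow> i = N \<and> m = m0"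
    if "i \<le> N" "m \<in> Poly_Mapping.keys (q i)" for i m
  proof
    assume e: "m + Poly_Mapping.single s i = m0 + Poly_Mapping.single s N"
    then have "Poly_Mapping.lookup (m + Poly_Mapping.single s i) s = Poly_Mapping.lookup (m0 + Poly_Mapping.single s N) s"
      by simp
    then have "i = N" using ms[OF that] ms[OF _ m0k] by (simp add: lookup_add)
    then show "i = N \<and> m = m0" using e by simp
  qed simp
  have "Poly_Mapping.lookup P (m0 + Poly_Mapping.single s N) =
    (\<Sum>i\<le>N. \<Sum>m\<in>Poly_Mapping.keys (q i). if i = N \<and> m = m0 then Poly_Mapping.lookup (q i) m else 0)"
    unfolding P_def lookup_sum lookup_single when_def using eq by (intro sum.cong refl) auto
  also have "\<dots> = (\<Sum>i\<le>N. if i = N then Poly_Mapping.lookup (q N) m0 else 0)"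
  proof (rule sum.cong[OF refl])
    fix i assume "i \<in> {..N}"
    show "(\<Sum>m\<in>Poly_Mapping.keys (q i). if i = N \<and> m = m0 then Poly_Mapping.lookup (q i) m else 0) =
      (if i = N then Poly_Mapping.lookup (q N) m0 else 0)"
      using m0k by (cases "i = N") (simp_all add: sum.delta)
  qed
  also have "\<dots> = Poly_Mapping.lookup (q N) m0" by simp
  finally show False using P0 m0 by simp
qed

text \<open>Sorting a relation by powers of the new element \<open>s\<close> gives a polynomial
  \<open>Q\<close> in one variable with coefficients algebraic over \<open>K(S)\<close>. As
  \<open>s\<close> is transcendental over that field, every coefficient vanishes, and each is a
  relation among the elements of \<open>S\<close> alone.\<close>

lemma alg_indepI:
  assumes K: "is_subfield K" and "finite S" "\<And>s. s \<in> S \<Longrightarrow> s \<notin> der_cl (K \<union> (S - {s}))"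
  shows "alg_indep K S"
  using assms(2,3)
proof (induction S)
  case empty
  show ?case unfolding alg_indep_iff
  proof (intro ballI impI)
    fix p assume p: "p \<in> mpolys_over K {}" and "eval_mpoly p = 0"
    have "Poly_Mapping.keys p \<subseteq> {0}" using p by (auto simp: mpolys_over_def)
    then have "Poly_Mapping.lookup p 0 = 0"
      using eval_mpoly_superset[of "{0}" p] \<open>eval_mpoly p = 0\<close> by simp
    then show "p = 0" using \<open>Poly_Mapping.keys p \<subseteq> {0}\<close>
      by (metis in_keys_iff insertE lookup_zero poly_mapping_eqI subsetD empty_iff)
  qed
next
  case (insert s S)
  have "t \<notin> der_cl (K \<union> (S - {t}))" if "t \<in> S" for t
    using insert.prems[of t] that der_cl_mono[of "K \<union> (S - {t})" "K \<union> (insert s S - {t})"] by blast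
  then have IH: "alg_indep K S" by (rule insert.IH)
  have s: "s \<notin> der_cl (K \<union> S)" using insert.prems[of s] insert.hyps by simp
  show ?case unfolding alg_indep_iff
  proof (intro ballI impI)
    fix p assume p: "p \<in> mpolys_over K (insert s S)" and ep: "eval_mpoly p = 0"
    \<comment> \<open>The monomial \<open>m\<close> with its power of \<open>s\<close> removed; the
      exponent removed is \<open>k m\<close> below.\<close>
    define r where "r m = m - Poly_Mapping.single s (Poly_Mapping.lookup m s)" for m :: "complex \<Rightarrow>\<^sub>0 nat"
    have mr: "m = r m + Poly_Mapping.single s (Poly_Mapping.lookup m s)" for m
      by (rule poly_mapping_eqI) (simp add: r_def lookup_add lookup_minus lookup_single when_def)
    have rk: "Poly_Mapping.keys (r m) \<subseteq> S" if "m \<in> Poly_Mapping.keys p" for m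
    proof
      fix x assume "x \<in> Poly_Mapping.keys (r m)"
      then have "x \<noteq> s \<and> x \<in> Poly_Mapping.keys m"
        by (auto simp: r_def in_keys_iff lookup_minus lookup_single when_def split: if_splits)
      then show "x \<in> S" using p that unfolding mpolys_over_def by blast
    qed
    define k where "k m = Poly_Mapping.lookup m s" for m :: "complex \<Rightarrow>\<^sub>0 nat"
    define q where "q i = (\<Sum>m\<in>{m\<in>Poly_Mapping.keys p. k m = i}.
      Poly_Mapping.single (r m) (Poly_Mapping.lookup p m))" for i
    have q: "q i \<in> mpolys_over K S" for i
      unfolding q_def using p rk by (intro mpolys_over_sum[OF K] mpolys_over_single[OF K]) (auto simp: mpolys_over_def)
    have evr: "eval_mono m = eval_mono (r m) * s ^ k m" for m
    proof -
      have "eval_mono (Poly_Mapping.single s i) = s ^ i" for i by (cases "i = 0") auto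
      then show ?thesis using arg_cong[OF mr, of eval_mono m] by (simp only: eval_mono_add k_def)
    qed
    define Q where "Q = (\<Sum>i\<in>k ` Poly_Mapping.keys p. monom (eval_mpoly (q i)) i)"
    have "poly Q s = (\<Sum>i\<in>k ` Poly_Mapping.keys p. \<Sum>m\<in>{m\<in>Poly_Mapping.keys p. k m = i}.
        Poly_Mapping.lookup p m * eval_mono (r m) * s ^ k m)"
      by (simp add: Q_def poly_sum poly_monom q_def eval_mpoly_sum eval_mpoly_single sum_distrib_right)
    also have "\<dots> = (\<Sum>m\<in>Poly_Mapping.keys p. Poly_Mapping.lookup p m * eval_mono (r m) * s ^ k m)"
      by (rule sum.image_gen[symmetric]) simp
    also have "\<dots> = eval_mpoly p" unfolding eval_mpoly_def by (simp add: evr[symmetric] mult.assoc)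
    finally have Qs: "poly Q s = 0" using ep by simp
    have "eval_mpoly (q i) \<in> der_cl (K \<union> S)" for i
    proof -
      have "Poly_Mapping.lookup (q i) m \<in> der_cl (K \<union> S)" for m
        using q[of i] der_cl_superset[of "K \<union> S"] by (auto simp: mpolys_over_def)
      moreover have "x \<in> der_cl (K \<union> S)" if "m \<in> Poly_Mapping.keys (q i)" "x \<in> Poly_Mapping.keys m" for m x
        using q[of i] der_cl_superset[of "K \<union> S"] that unfolding mpolys_over_def by blast
      ultimately show ?thesis unfolding eval_mpoly_def
        by (intro subfield_sum subfieldD(4) subfield_prod subfield_power is_subfield_der_cl)
    qed
    then have "Q \<in> polys_over (der_cl (K \<union> S))"
      by (auto simp: Q_def polys_over_def coeff_sum intro!: subfield_sum[OF is_subfield_der_cl]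
          subfieldD[OF is_subfield_der_cl])
    moreover have "s \<notin> alg_closure (der_cl (K \<union> S))"
      using s by (simp add: alg_closure_eq_der_cl is_subfield_der_cl der_cl_idem)
    ultimately have Q0: "Q = 0" using Qs by (auto simp: alg_closure_iff)
    have q0: "q i = 0" if "i \<in> k ` Poly_Mapping.keys p" for i
    proof -
      have "coeff Q i = eval_mpoly (q i)" using that by (simp add: Q_def coeff_sum)
      then show ?thesis using Q0 IH q[of i] by (simp add: alg_indep_iff)
    qed
    have "Poly_Mapping.lookup p m = 0" if m: "m \<in> Poly_Mapping.keys p" for m
    proof -
      have inj: "m' = m" if "k m' = k m" "r m' = r m" for m'
        using mr[of m'] mr[of m] that by (simp add: k_def)
      have "Poly_Mapping.lookup (q (k m)) (r m) =
        (\<Sum>m'\<in>{m'\<in>Poly_Mapping.keys p. k m' = k m}. if m' = m then Poly_Mapping.lookup p m' else 0)"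
        unfolding q_def lookup_sum lookup_single when_def using inj by (intro sum.cong refl) auto
      also have "\<dots> = Poly_Mapping.lookup p m" using m by simp
      finally show ?thesis using q0[of "k m"] m by simp
    qed
    then show "p = 0" by (metis in_keys_iff lookup_zero poly_mapping_eqI)
  qed
qed

lemma card_le_trdeg:
  assumes "finite S" "S \<subseteq> M" "\<And>s. s \<in> S \<Longrightarrow> s \<notin> der_cl (S - {s})"
  shows "enat (card S) \<le> trdeg \<rat> M"
  unfolding trdeg_def using assms
  by (intro SUP_upper) (auto intro!: alg_indepI is_subfield_Rats simp: der_cl_Rats_Un)

text \<open>The degree is a supremum in \<open>enat\<close>. Writing \<open>n\<close> as a successor
  makes the bound strict, and a strict bound is exceeded by a member of the family.\<close>

lemma trdeg_ge_independent:
  assumes "enat n \<le> trdeg \<rat> M"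
  obtains S where "finite S" "S \<subseteq> M" "n \<le> card S" "\<And>s. s \<in> S \<Longrightarrow> s \<notin> der_cl (S - {s})"
proof -
  have "\<exists>S. S \<subseteq> M \<and> finite S \<and> alg_indep \<rat> S \<and> n \<le> card S"
  proof (cases n)
    case 0
    have "alg_indep \<rat> {}" by (rule alg_indepI) (auto simp: is_subfield_Rats)
    then show ?thesis using 0 by (intro exI[of _ "{}"]) auto
  next
    case (Suc k)
    then have "enat k < trdeg \<rat> M" using assms by (simp add: Suc_ile_eq)
    then show ?thesis using Suc unfolding trdeg_def less_SUP_iff by auto
  qed
  then obtain S where S: "S \<subseteq> M" "finite S" "alg_indep \<rat> S" "n \<le> card S" by blast
  have "s \<notin> der_cl (S - {s})" if "s \<in> S" for s
    using alg_indep_not_der_cl[OF is_subfield_Rats S(3) that] by (simp add: der_cl_Rats_Un)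
  then show ?thesis using S that by blast
qed


section \<open>Traces and norms in finite extensions, and descent of logarithmic relations\<close>

subsection \<open>Traces and norms of logarithmic derivatives\<close>

lemma derivation_prod:
  assumes D: "derivation D" and "finite I"
  shows "D (prod f I) = (\<Sum>i\<in>I. D (f i) * prod f (I - {i}))"
  using assms(2)
proof (induction I)
  case (insert i I)
  have "prod f (insert i I - {j}) = f i * prod f (I - {j})" if "j \<in> I" for j
  proof -
    have "insert i I - {j} = insert i (I - {j})" using insert.hyps that by auto
    then show ?thesis using insert.hyps by simp
  qed
  then have "(\<Sum>j\<in>I. D (f j) * prod f (insert i I - {j})) = f i * (\<Sum>j\<in>I. D (f j) * prod f (I - {j}))"
    by (simp add: sum_distrib_left mult_ac)
  then show ?case using insert by (simp add: derivation_mult[OF D] mult_ac)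
qed (simp add: derivation_1[OF D])

text \<open>Jacobi's formula. \<open>R i\<close> is \<open>A\<close> with row \<open>i\<close>
  differentiated: its expansion along that row produces the cofactors of \<open>A\<close>, while its
  Leibniz expansion is the part of \<open>D (det A)\<close> in which the factor from row
  \<open>i\<close> is differentiated.\<close>

lemma derivation_det:
  assumes D: "derivation D" and A: "A \<in> carrier_mat n n"
  shows "D (det A) = (\<Sum>i<n. \<Sum>j<n. D (A $$ (i, j)) * cofactor A i j)"
proof -
  define R where "R i = mat n n (\<lambda>(i', j). if i' = i then D (A $$ (i, j)) else A $$ (i', j))" for i
  have R: "R i \<in> carrier_mat n n" for i by (simp add: R_def)
  have "det (R i) = (\<Sum>j<n. D (A $$ (i, j)) * cofactor A i j)" if "i < n" for i
  proof -
    have "mat_delete (R i) i j = mat_delete A i j" if "j < n" for j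
      using A \<open>i < n\<close> that by (intro eq_matI) (auto simp: mat_delete_def R_def)
    then show ?thesis using \<open>i < n\<close>
      by (subst laplace_expansion_row[OF R \<open>i < n\<close>]) (simp add: cofactor_def R_def)
  qed
  moreover have "det (R i) = (\<Sum>p\<in>{p. p permutes {0..<n}}.
      signof p * (D (A $$ (i, p i)) * (\<Prod>i'\<in>{0..<n} - {i}. A $$ (i', p i'))))" if "i < n" for i
  proof -
    have "(\<Prod>i' = 0..<n. R i $$ (i', p i')) = D (A $$ (i, p i)) * (\<Prod>i'\<in>{0..<n} - {i}. A $$ (i', p i'))"
      if p: "p permutes {0..<n}" for p
    proof -
      have pn: "p i' < n" if "i' < n" for i' using p that by (metis atLeast0LessThan lessThan_iff permutes_in_image)
      have "(\<Prod>i' = 0..<n. R i $$ (i', p i')) = R i $$ (i, p i) * (\<Prod>i'\<in>{0..<n} - {i}. R i $$ (i', p i'))"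
        using \<open>i < n\<close> by (intro prod.remove) auto
      also have "(\<Prod>i'\<in>{0..<n} - {i}. R i $$ (i', p i')) = (\<Prod>i'\<in>{0..<n} - {i}. A $$ (i', p i'))"
        using pn by (intro prod.cong) (auto simp: R_def)
      finally show ?thesis using pn \<open>i < n\<close> by (simp add: R_def)
    qed
    then show ?thesis by (simp add: det_def'[OF R])
  qed
  moreover have "D (det A) = (\<Sum>p\<in>{p. p permutes {0..<n}}. \<Sum>i<n.
      signof p * (D (A $$ (i, p i)) * (\<Prod>i'\<in>{0..<n} - {i}. A $$ (i', p i'))))"
    by (simp add: det_def'[OF A] derivation_sum[OF D] derivation_mult[OF D] derivation_of_int[OF D]
        derivation_prod[OF D] sum_distrib_left atLeast0LessThan)
  ultimately show ?thesis by (simp add: sum.swap[of _ "{..<n}" "{p. p permutes {0..<n}}"])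
qed

definition mat_trace :: "complex mat \<Rightarrow> complex" where
  "mat_trace A = (\<Sum>i<dim_row A. A $$ (i, i))"

lemma mat_trace_mult:
  assumes "A \<in> carrier_mat n n" "B \<in> carrier_mat n n"
  shows "mat_trace (A * B) = (\<Sum>i<n. \<Sum>j<n. A $$ (i, j) * B $$ (j, i))"
  using assms by (auto simp: mat_trace_def scalar_prod_def atLeast0LessThan intro!: sum.cong)

lemma mat_trace_comm:
  assumes "A \<in> carrier_mat n n" "B \<in> carrier_mat n n"
  shows "mat_trace (A * B) = mat_trace (B * A)"
  unfolding mat_trace_mult[OF assms] mat_trace_mult[OF assms(2,1)]
  by (subst sum.swap) (simp add: mult.commute)

lemma mat_trace_add:
  assumes "A \<in> carrier_mat n n" "B \<in> carrier_mat n n"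
  shows "mat_trace (A + B) = mat_trace A + mat_trace B"
  using assms by (simp add: mat_trace_def sum.distrib)

lemma mat_trace_minus:
  assumes "A \<in> carrier_mat n n" "B \<in> carrier_mat n n"
  shows "mat_trace (A - B) = mat_trace A - mat_trace B"
  using assms by (simp add: mat_trace_def sum_subtractf)

text \<open>Jacobi's formula, with the adjugate replaced by \<open>det A\<close> times the inverse
  \<open>W\<close>. Read for the matrix of multiplication by a field element, it links the trace of
  a logarithmic derivative to the norm.\<close>

lemma mat_trace_dlog:
  assumes D: "derivation D" and A: "A \<in> carrier_mat n n" and W: "W \<in> carrier_mat n n"
    and WA: "W * A = 1\<^sub>m n"
  shows "mat_trace (map_mat D A * W) = D (det A) / det A" and "det A \<noteq> 0"
proof -
  have "det W * det A = 1" using det_mult[OF W A] by (simp add: WA)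
  then show nz: "det A \<noteq> 0" by auto
  note adj = adj_mat[OF A]
  have "adj_mat A = (W * A) * adj_mat A" using adj(1) by (simp add: WA)
  also have "\<dots> = W * (A * adj_mat A)" by (rule assoc_mult_mat[OF W A adj(1)])
  also have "\<dots> = det A \<cdot>\<^sub>m W" using W by (simp add: adj(2) mult_smult_distrib[OF W one_carrier_mat])
  finally have "adj_mat A = det A \<cdot>\<^sub>m W" .
  then have "cofactor A i j = det A * W $$ (j, i)" if "i < n" "j < n" for i j
    using that A W by (metis adj_mat_def carrier_matD(1) carrier_matD(2) index_mat(1) index_smult_mat(1) split_conv)
  then have "D (det A) = det A * mat_trace (map_mat D A * W)"
    unfolding derivation_det[OF D A] using A
    by (simp add: mat_trace_mult[OF _ W, of "map_mat D A"] sum_distrib_left mult_ac)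
  then show "mat_trace (map_mat D A * W) = D (det A) / det A" using nz by simp
qed


subsection \<open>Finite extensions\<close>

text \<open>The field of scalars is a varying subset of \<complex>, so vectors are built up one term
  at a time; coordinates are recovered in \<open>lin_span_explicit\<close> when \<open>E\<close> is
  finite.\<close>

inductive_set lin_span :: "complex set \<Rightarrow> complex set \<Rightarrow> complex set" for K E where
  zero: "0 \<in> lin_span K E"
| step: "c \<in> K \<Longrightarrow> x \<in> E \<Longrightarrow> v \<in> lin_span K E \<Longrightarrow> c * x + v \<in> lin_span K E"

lemma lin_span_add: "u \<in> lin_span K E \<Longrightarrow> v \<in> lin_span K E \<Longrightarrow> u + v \<in> lin_span K E"
  by (induction u rule: lin_span.induct) (auto simp: add.assoc intro: lin_span.step)

lemma lin_span_base: "c \<in> K \<Longrightarrow> x \<in> E \<Longrightarrow> c * x \<in> lin_span K E"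
  using lin_span.step[OF _ _ lin_span.zero] by fastforce

lemma lin_span_scale:
  assumes K: "is_subfield K" and c: "c \<in> K" and v: "v \<in> lin_span K E"
  shows "c * v \<in> lin_span K E"
  using v
proof (induction v rule: lin_span.induct)
  case (step d x v)
  have "(c * d) * x + c * v \<in> lin_span K E"
    using step by (intro lin_span.step subfieldD(4)[OF K] c)
  then show ?case by (simp add: algebra_simps)
qed (simp add: lin_span.zero)

lemma lin_span_sum: "(\<And>i. i \<in> I \<Longrightarrow> f i \<in> lin_span K E) \<Longrightarrow> sum f I \<in> lin_span K E"
  by (induction I rule: infinite_finite_induct) (auto intro: lin_span.zero lin_span_add)

lemma lin_span_mult_in:
  assumes K: "is_subfield K" and "v \<in> lin_span K E" "\<And>x. x \<in> E \<Longrightarrow> x * w \<in> lin_span K F"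
  shows "v * w \<in> lin_span K F"
  using assms(2)
proof (induction v rule: lin_span.induct)
  case (step c x v)
  have "c * (x * w) + v * w \<in> lin_span K F"
    by (rule lin_span_add[OF lin_span_scale[OF K step(1) assms(3)[OF step(2)]] step(4)])
  then show ?case by (simp add: algebra_simps)
qed (simp add: lin_span.zero)

lemma lin_span_subset:
  assumes K: "is_subfield K" and "\<And>x. x \<in> E \<Longrightarrow> x \<in> lin_span K F"
  shows "lin_span K E \<subseteq> lin_span K F"
  using lin_span_mult_in[OF K, of _ E 1 F] assms(2) by auto

lemma lin_span_explicit:
  assumes K: "is_subfield K" and "finite E" "v \<in> lin_span K E"
  obtains c where "\<And>x. c x \<in> K" "v = (\<Sum>x\<in>E. c x * x)"
proof -
  have "\<exists>c. (\<forall>x. c x \<in> K) \<and> v = (\<Sum>x\<in>E. c x * x)" using assms(3)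
  proof (induction v rule: lin_span.induct)
    case zero
    then show ?case by (intro exI[of _ "\<lambda>_. 0"]) (simp add: subfieldD[OF K])
  next
    case (step c x v)
    then obtain d where d: "\<forall>x. d x \<in> K" "v = (\<Sum>x\<in>E. d x * x)" by blast
    have "c * x = (\<Sum>y\<in>E. (if y = x then c else 0) * y)"
      using \<open>finite E\<close> step by (simp add: if_distrib[of "\<lambda>a. a * _"] cong: if_cong)
    then have "c * x + v = (\<Sum>y\<in>E. ((if y = x then c else 0) + d y) * y)"
      by (simp add: d(2) sum.distrib distrib_right)
    moreover have "\<forall>y. (if y = x then c else 0) + d y \<in> K"
      using d(1) step by (auto intro!: subfieldD[OF K])
    ultimately show ?case by (intro exI[of _ "\<lambda>y. (if y = x then c else 0) + d y"]) blast
  qed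
  then show ?thesis using that by blast
qed

text \<open>If \<open>a\<close> is a root of a polynomial of degree \<open>d\<close>, the old
  generators are multiplied by the powers of \<open>a\<close> below \<open>d\<close>, and higher
  powers are rewritten by the equation made monic. The polynomial need not be minimal, since the
  generators may be dependent at this stage.\<close>

lemma finite_extension_span:
  assumes K: "is_subfield K" and "finite A" "A \<subseteq> alg_closure K"
  shows "\<exists>E. finite E \<and> E \<subseteq> alg_closure K \<and> 1 \<in> lin_span K E \<and> A \<subseteq> lin_span K E \<and>
    (\<forall>x\<in>E. \<forall>y\<in>E. x * y \<in> lin_span K E)"
  using assms(2,3)
proof (induction A)
  case empty
  have "1 \<in> alg_closure K"
    by (simp add: alg_closure_eq_der_cl[OF K] subfieldD[OF is_subfield_der_cl])
  moreover have "1 \<in> lin_span K {1}" using lin_span_base[of 1 K 1] subfieldD[OF K] by auto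
  ultimately show ?case by (intro exI[of _ "{1}"]) auto
next
  case (insert a A)
  then obtain E where E: "finite E" "E \<subseteq> alg_closure K" "1 \<in> lin_span K E" "A \<subseteq> lin_span K E"
    "\<And>x y. x \<in> E \<Longrightarrow> y \<in> E \<Longrightarrow> x * y \<in> lin_span K E" by auto
  obtain p where p: "p \<in> polys_over K" "p \<noteq> 0" "poly p a = 0"
    using insert.prems by (auto simp: alg_closure_iff)
  define d where "d = degree p"
  have d: "d > 0"
  proof (rule ccontr)
    assume "\<not> d > 0"
    then obtain c where "p = [:c:]" using degree_eq_zeroE[of p] unfolding d_def by blast
    then show False using p by auto
  qed
  define E' where "E' = (\<lambda>(x, j). x * a ^ j) ` (E \<times> {..<d})"
  define c where "c j = - (coeff p j / lead_coeff p)" for j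
  have cK: "c j \<in> K" for j using p(1) by (auto simp: c_def polys_over_def intro!: subfieldD[OF K])
  have ad: "a ^ d = (\<Sum>j<d. c j * a ^ j)"
  proof -
    have "(\<Sum>j<d. coeff p j * a ^ j) + lead_coeff p * a ^ d = 0"
      using p(3) by (simp add: poly_altdef d_def lessThan_Suc_atMost[symmetric])
    moreover have "lead_coeff p \<noteq> 0" using p(2) by simp
    ultimately show ?thesis unfolding c_def
      by (simp add: field_simps sum_negf sum_divide_distrib[symmetric] add_eq_0_iff)
  qed
  have xa: "x * a ^ n \<in> lin_span K E'" if "x \<in> E" for x n
  proof (induction n rule: less_induct)
    case (less n)
    show ?case
    proof (cases "n < d")
      case True
      then have "x * a ^ n \<in> E'" using that by (auto simp: E'_def)
      then show ?thesis using lin_span_base[OF subfieldD(2)[OF K]] by fastforce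
    next
      case False
      then have "a ^ n = a ^ (n - d) * a ^ d" by (simp add: power_add[symmetric])
      then have "x * a ^ n = (\<Sum>j<d. c j * (x * a ^ (n - d + j)))"
        by (simp add: ad sum_distrib_left power_add mult_ac)
      also have "\<dots> \<in> lin_span K E'"
        using False by (intro lin_span_sum lin_span_scale[OF K cK] less) auto
      finally show ?thesis .
    qed
  qed
  have va: "v * a ^ n \<in> lin_span K E'" if "v \<in> lin_span K E" for v n
    by (rule lin_span_mult_in[OF K that xa])
  have "u * v \<in> lin_span K E'" if uv: "u \<in> E'" "v \<in> E'" for u v
  proof -
    obtain x i where x: "x \<in> E" "u = x * a ^ i" using uv(1) by (auto simp: E'_def)
    obtain y j where y: "y \<in> E" "v = y * a ^ j" using uv(2) by (auto simp: E'_def)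
    have "u * v = (x * y) * a ^ (i + j)" by (simp add: x y power_add mult_ac)
    then show ?thesis using va[OF E(5)[OF x(1) y(1)]] by simp
  qed
  moreover have "finite E'" using E(1) by (simp add: E'_def)
  moreover have "E' \<subseteq> alg_closure K"
    using E(2) insert.prems unfolding E'_def alg_closure_eq_der_cl[OF K]
    by (auto intro!: subfieldD[OF is_subfield_der_cl] subfield_power[OF is_subfield_der_cl])
  moreover have "1 \<in> lin_span K E'" using va[OF E(3), of 0] by simp
  moreover have "insert a A \<subseteq> lin_span K E'"
    using va[OF E(3), of 1] va[of _ 0] E(4) by auto
  ultimately show ?case by (intro exI[of _ E']) blast
qed

text \<open>Among the generating subsets of a finite generating set, one of least size is
  independent. The span itself does not change, so it stays closed under products.\<close>

lemma finite_extension_basis: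
  assumes K: "is_subfield K" and "finite A" "A \<subseteq> alg_closure K"
  obtains E where "finite E" "E \<subseteq> alg_closure K" "1 \<in> lin_span K E" "A \<subseteq> lin_span K E"
    "\<And>u v. u \<in> lin_span K E \<Longrightarrow> v \<in> lin_span K E \<Longrightarrow> u * v \<in> lin_span K E"
    "\<And>c. (\<And>x. x \<in> E \<Longrightarrow> c x \<in> K) \<Longrightarrow> (\<Sum>x\<in>E. c x * x) = 0 \<Longrightarrow> (\<And>x. x \<in> E \<Longrightarrow> c x = 0)"
proof -
  obtain E0 where E0: "finite E0" "E0 \<subseteq> alg_closure K" "1 \<in> lin_span K E0" "A \<subseteq> lin_span K E0"
    "\<And>x y. x \<in> E0 \<Longrightarrow> y \<in> E0 \<Longrightarrow> x * y \<in> lin_span K E0"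
    using finite_extension_span[OF assms] by auto
  have mult: "u * v \<in> lin_span K E0" if "u \<in> lin_span K E0" "v \<in> lin_span K E0" for u v
  proof (rule lin_span_mult_in[OF K that(1)])
    fix x assume x: "x \<in> E0"
    have "v * x \<in> lin_span K E0"
      by (rule lin_span_mult_in[OF K that(2)]) (rule E0(5)[OF _ x])
    then show "x * v \<in> lin_span K E0" by (simp add: mult.commute)
  qed
  let ?P = "\<lambda>E. E \<subseteq> E0 \<and> lin_span K E = lin_span K E0"
  have "?P E0" by simp
  then obtain E where E: "?P E" "\<And>E'. ?P E' \<Longrightarrow> card E \<le> card E'"
    using ex_has_least_nat[of ?P E0 card] by blast
  have finE: "finite E" using E(1) E0(1) finite_subset by blast
  have "c x0 = 0" if c: "\<And>x. x \<in> E \<Longrightarrow> c x \<in> K" "(\<Sum>x\<in>E. c x * x) = 0" and x0: "x0 \<in> E" for c x0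
  proof (rule ccontr)
    assume nz: "c x0 \<noteq> 0"
    define E' where "E' = E - {x0}"
    have base: "x \<in> lin_span K E'" if "x \<in> E'" for x
      using lin_span_base[OF subfieldD(2)[OF K] that] by simp
    have "c x0 * x0 + (\<Sum>x\<in>E'. c x * x) = 0"
      using c(2) sum.remove[OF finE x0, of "\<lambda>x. c x * x"] by (simp add: E'_def)
    then have "x0 = (\<Sum>x\<in>E'. (- c x / c x0) * x)"
      using nz by (simp add: field_simps sum_negf sum_divide_distrib[symmetric] add_eq_0_iff)
    also have "\<dots> \<in> lin_span K E'"
      using c(1) x0 by (intro lin_span_sum lin_span_base) (auto simp: E'_def intro!: subfieldD[OF K])
    finally have "lin_span K E \<subseteq> lin_span K E'"
      using base by (intro lin_span_subset[OF K]) (auto simp: E'_def)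
    moreover have "lin_span K E' \<subseteq> lin_span K E"
      using lin_span_base[OF subfieldD(2)[OF K], of _ E]
      by (intro lin_span_subset[OF K]) (fastforce simp: E'_def)
    ultimately have "?P E'" using E(1) by (auto simp: E'_def)
    then have "card E \<le> card E'" by (rule E(2))
    then show False using card_Diff1_less[OF finE x0] unfolding E'_def by linarith
  qed
  moreover have "E \<subseteq> alg_closure K" using E(1) E0(2) by blast
  ultimately show ?thesis using E(1) E0(3,4) mult finE that[of E] by metis
qed

text \<open>Both facts are read off a minimal polynomial of the element. Its constant term is
  nonzero, which writes the inverse as a polynomial in the element; differentiating the equation
  writes \<open>D v\<close> as a quotient whose denominator is nonzero by separability. Together
  they make the span a differential field.\<close>

lemma
  assumes K: "is_subfield K" and fin: "E \<subseteq> alg_closure K"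
    and one: "1 \<in> lin_span K E"
    and mult: "\<And>u v. u \<in> lin_span K E \<Longrightarrow> v \<in> lin_span K E \<Longrightarrow> u * v \<in> lin_span K E"
    and v: "v \<in> lin_span K E"
  shows lin_span_inverse: "inverse v \<in> lin_span K E"
    and lin_span_derivation: "\<And>D. derivation D \<Longrightarrow> (\<And>c. c \<in> K \<Longrightarrow> D c \<in> K) \<Longrightarrow> D v \<in> lin_span K E"
proof -
  let ?R = "lin_span K E"
  have "u \<in> alg_closure K" if "u \<in> ?R" for u
    using that
    by (induction u rule: lin_span.induct)
      (use fin der_cl_superset[of K] in \<open>auto simp: alg_closure_eq_der_cl[OF K] intro!: subfieldD[OF is_subfield_der_cl]\<close>)
  note alg = this
  have KR: "c \<in> ?R" if "c \<in> K" for c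
    using lin_span_scale[OF K that one] by simp
  have polyR: "poly p u \<in> ?R" if "u \<in> ?R" "p \<in> polys_over K" for p u
  proof -
    have "u ^ n \<in> ?R" for n by (induction n) (auto intro: one mult that)
    then show ?thesis unfolding poly_altdef using that(2)
      by (intro lin_span_sum lin_span_scale[OF K]) (auto simp: polys_over_def)
  qed
  have inv: "inverse u \<in> ?R" if u: "u \<in> ?R" for u
  proof (cases "u = 0")
    case False
    obtain p where p: "p \<in> polys_over K" "p \<noteq> 0" "poly p u = 0"
      "\<And>q. q \<in> polys_over K \<Longrightarrow> poly q u = 0 \<Longrightarrow> degree q < degree p \<Longrightarrow> q = 0"
      using min_poly_exists[OF alg[OF u]] by metis
    obtain a q where pq: "p = pCons a q" by (cases p)
    have q: "q \<in> polys_over K" and a: "a \<in> K"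
    proof -
      have "coeff q i = coeff p (Suc i)" for i by (simp add: pq)
      then show "q \<in> polys_over K" using p(1) by (auto simp: polys_over_def)
      have "a = coeff p 0" by (simp add: pq)
      then show "a \<in> K" using p(1) by (auto simp: polys_over_def)
    qed
    have "a \<noteq> 0"
    proof
      assume "a = 0"
      then have "q \<noteq> 0" "poly q u = 0" "degree q < degree p" using p(2,3) False by (auto simp: pq)
      then show False using p(4)[OF q] by blast
    qed
    then have "inverse u = (- inverse a) * poly q u"
      using p(3) False by (simp add: pq field_simps add_eq_0_iff2)
    then show ?thesis using lin_span_scale[OF K, of "- inverse a"] polyR[OF u q] a by (auto intro: subfieldD[OF K])
  qed (simp add: lin_span.zero)
  show "inverse v \<in> ?R" by (rule inv[OF v])
  fix D assume D: "derivation D" "\<And>c. c \<in> K \<Longrightarrow> D c \<in> K"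
  obtain p where p: "p \<in> polys_over K" "p \<noteq> 0" "poly p v = 0"
    "\<And>q. q \<in> polys_over K \<Longrightarrow> poly q v = 0 \<Longrightarrow> degree q < degree p \<Longrightarrow> q = 0"
    using min_poly_exists[OF alg[OF v]] by metis
  have "poly (map_poly D p) v + poly (pderiv p) v * D v = 0"
    using derivation_poly[OF D(1), of p v] p(3) by (simp add: derivation_0[OF D(1)])
  then have "D v = (- 1) * (inverse (poly (pderiv p) v) * poly (map_poly D p) v)"
    using min_poly_pderiv[OF K p] by (simp add: field_simps add_eq_0_iff)
  moreover have "map_poly D p \<in> polys_over K"
    using p(1) D(2) by (auto simp: polys_over_def coeff_map_poly derivation_0[OF D(1)])
  moreover have "- 1 \<in> K" by (intro subfieldD[OF K])
  ultimately show "D v \<in> ?R"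
    using lin_span_scale[OF K, of "- 1"] mult inv polyR[OF v] polys_over_pderiv[OF K p(1)] by metis
qed

text \<open>The trace is applied to the relation inside a finite extension of \<open>K\<close>
  containing \<open>x\<close> and all \<open>Y r\<close>. It is \<open>K\<close>-linear, commutes
  with \<open>D\<close>, and sends \<open>D y / y\<close> to the logarithmic derivative of the norm
  of \<open>y\<close>. Thus \<open>g\<close> is the trace of \<open>x\<close> and \<open>h r\<close>
  the norm of \<open>Y r\<close>; an element of \<open>K\<close> has its \<open>N\<close>-th power
  as norm, where \<open>N\<close> is the degree of the extension.\<close>

lemma dlog_relation_descends:
  fixes Y :: "'a \<Rightarrow> complex"
  assumes K: "is_subfield K" and D: "derivation D" and DK: "\<And>c. c \<in> K \<Longrightarrow> D c \<in> K"
    and I: "finite I" and Y: "\<And>r. r \<in> I \<Longrightarrow> Y r \<in> alg_closure K" "\<And>r. r \<in> I \<Longrightarrow> Y r \<noteq> 0"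
    and x: "x \<in> alg_closure K" and \<gamma>: "\<And>r. r \<in> I \<Longrightarrow> \<gamma> r \<in> K"
    and rel: "(\<Sum>r\<in>I. \<gamma> r * (D (Y r) / Y r)) = D x"
  obtains N h g where "N > 0" "g \<in> K" "\<And>r. r \<in> I \<Longrightarrow> h r \<in> K" "\<And>r. r \<in> I \<Longrightarrow> h r \<noteq> 0"
    "\<And>r. r \<in> I \<Longrightarrow> Y r \<in> K \<Longrightarrow> h r = Y r ^ N"
    "(\<Sum>r\<in>I. \<gamma> r * (D (h r) / h r)) = D g"
proof -
  have fin: "finite (insert x (Y ` I))" and alg: "insert x (Y ` I) \<subseteq> alg_closure K"
    using I Y x by auto
  show ?thesis
  proof (rule finite_extension_basis[OF K fin alg], goal_cases)
    case (1 E)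
    note E = 1(1-4) and mult = 1(5) and indep = 1(6)
    let ?R = "lin_span K E"
    have inv: "inverse v \<in> ?R" if "v \<in> ?R" for v
      by (rule lin_span_inverse[OF K E(2,3) _ that]) (rule mult)
    have der: "D v \<in> ?R" if "v \<in> ?R" for v
      by (rule lin_span_derivation[OF K E(2,3) _ that D]) (rule mult, assumption+, rule DK)
    define N where "N = card E"
    obtain e where e: "bij_betw e {..<N} E"
      using ex_bij_betw_nat_finite[OF E(1)] by (auto simp: N_def atLeast0LessThan)
    have "E \<noteq> {}"
    proof
      assume "E = {}"
      then have "(1::complex) = 0" using lin_span_explicit[OF K E(1,3)] by auto
      then show False by simp
    qed
    then have N: "N > 0" using E(1) by (simp add: N_def card_gt_0_iff)
    have eR: "e i \<in> ?R" if "i < N" for i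
      using lin_span_base[OF subfieldD(2)[OF K], of "e i" E] bij_betwE[OF e] that by simp
    have sumE: "(\<Sum>i<N. c (e i) * e i) = (\<Sum>x\<in>E. c x * x)" for c
      by (rule sum.reindex_bij_betw[OF e])
    have uniq: "a i = b i" if "\<And>i. i < N \<Longrightarrow> a i \<in> K" "\<And>i. i < N \<Longrightarrow> b i \<in> K"
      "(\<Sum>i<N. a i * e i) = (\<Sum>i<N. b i * e i)" "i < N" for a b i
    proof -
      define c where "c x = a (inv_into {..<N} e x) - b (inv_into {..<N} e x)" for x
      have ce: "c (e i) = a i - b i" if "i < N" for i
        using that by (simp add: c_def bij_betw_inv_into_left[OF e])
      have "c x \<in> K" if "x \<in> E" for x
      proof -
        have "x \<in> e ` {..<N}" using \<open>x \<in> E\<close> bij_betw_imp_surj_on[OF e] by simp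
        then obtain i where "i < N" "x = e i" by auto
        then show ?thesis using ce that \<open>\<And>i. i < N \<Longrightarrow> a i \<in> K\<close> \<open>\<And>i. i < N \<Longrightarrow> b i \<in> K\<close>
          by (auto intro: subfieldD[OF K])
      qed
      moreover have "(\<Sum>x\<in>E. c x * x) = 0"
        using that(3) by (simp add: sumE[symmetric] ce left_diff_distrib sum_subtractf)
      ultimately have "c (e i) = 0" using indep[of c "e i"] bij_betwE[OF e] that(4) by blast
      then show ?thesis using ce that(4) by simp
    qed
    \<comment> \<open>The matrix of multiplication by \<open>v\<close> in the basis
      \<open>e\<close>; row \<open>i\<close> holds the coordinates of
      \<open>v * e i\<close>.\<close>
    define M where "M v = (SOME A. A \<in> carrier_mat N N \<and> (\<forall>i<N. \<forall>j<N. A $$ (i, j) \<in> K) \<and>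
      (\<forall>i<N. v * e i = (\<Sum>j<N. A $$ (i, j) * e j)))" for v
    have M: "M v \<in> carrier_mat N N" "\<And>i j. i < N \<Longrightarrow> j < N \<Longrightarrow> M v $$ (i, j) \<in> K"
      "\<And>i. i < N \<Longrightarrow> v * e i = (\<Sum>j<N. M v $$ (i, j) * e j)" if "v \<in> ?R" for v
    proof -
      have "\<exists>c. (\<forall>j<N. c j \<in> K) \<and> u = (\<Sum>j<N. c j * e j)" if u: "u \<in> ?R" for u
      proof -
        obtain c where "\<And>x. c x \<in> K" "u = (\<Sum>x\<in>E. c x * x)" using lin_span_explicit[OF K E(1) u] by metis
        then show ?thesis by (intro exI[of _ "\<lambda>j. c (e j)"]) (simp add: sumE)
      qed
      then have "\<forall>i. \<exists>c. i < N \<longrightarrow> (\<forall>j<N. c j \<in> K) \<and> v * e i = (\<Sum>j<N. c j * e j)"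
        using mult[OF that eR] by blast
      then obtain c where c: "\<And>i. i < N \<Longrightarrow> (\<forall>j<N. c i j \<in> K) \<and> v * e i = (\<Sum>j<N. c i j * e j)" by metis
      have "\<exists>A. A \<in> carrier_mat N N \<and> (\<forall>i<N. \<forall>j<N. A $$ (i, j) \<in> K) \<and>
        (\<forall>i<N. v * e i = (\<Sum>j<N. A $$ (i, j) * e j))"
        by (intro exI[of _ "mat N N (\<lambda>(i, j). c i j)"]) (use c in auto)
      from someI_ex[OF this] show "M v \<in> carrier_mat N N" "\<And>i j. i < N \<Longrightarrow> j < N \<Longrightarrow> M v $$ (i, j) \<in> K"
        "\<And>i. i < N \<Longrightarrow> v * e i = (\<Sum>j<N. M v $$ (i, j) * e j)" unfolding M_def by auto
    qed
    have MI: "M v = A" if v: "v \<in> ?R" and A: "A \<in> carrier_mat N N" "\<And>i j. i < N \<Longrightarrow> j < N \<Longrightarrow> A $$ (i, j) \<in> K"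
      "\<And>i. i < N \<Longrightarrow> v * e i = (\<Sum>j<N. A $$ (i, j) * e j)" for v A
    proof (rule eq_matI)
      fix i j assume ij: "i < dim_row A" "j < dim_col A"
      then have i: "i < N" and j: "j < N" using A(1) by auto
      show "M v $$ (i, j) = A $$ (i, j)"
        by (rule uniq[of "\<lambda>j. M v $$ (i, j)" "\<lambda>j. A $$ (i, j)", OF _ _ _ j])
          (use M(2)[OF v i] A(2)[OF i] M(3)[OF v i] A(3)[OF i] in auto)
    qed (use M(1)[OF v] A(1) in auto)
    have mult_index: "(A * B) $$ (i, l) = (\<Sum>j<N. A $$ (i, j) * B $$ (j, l))"
      if "A \<in> carrier_mat N N" "B \<in> carrier_mat N N" "i < N" "l < N" for A B :: "complex mat" and i l
      using that by (auto simp: scalar_prod_def atLeast0LessThan intro!: sum.cong)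
    have mult_row: "(\<Sum>l<N. (A * B) $$ (i, l) * e l) = (\<Sum>j<N. A $$ (i, j) * (\<Sum>l<N. B $$ (j, l) * e l))"
      if "A \<in> carrier_mat N N" "B \<in> carrier_mat N N" "i < N" for A B i
    proof -
      have "(\<Sum>l<N. (A * B) $$ (i, l) * e l) = (\<Sum>l<N. \<Sum>j<N. A $$ (i, j) * B $$ (j, l) * e l)"
        using that by (simp add: mult_index sum_distrib_right del: index_mult_mat)
      also have "\<dots> = (\<Sum>j<N. \<Sum>l<N. A $$ (i, j) * B $$ (j, l) * e l)" by (rule sum.swap)
      finally show ?thesis by (simp add: sum_distrib_left mult_ac)
    qed
    have Mmult: "M (v * w) = M v * M w" if v: "v \<in> ?R" and w: "w \<in> ?R" for v w
    proof (rule MI[OF mult[OF v w]])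
      show "M v * M w \<in> carrier_mat N N" using M(1)[OF v] M(1)[OF w] by simp
      show "(M v * M w) $$ (i, j) \<in> K" if "i < N" "j < N" for i j
        using that M(2)[OF v] M(2)[OF w] unfolding mult_index[OF M(1)[OF v] M(1)[OF w] that]
        by (auto intro!: subfield_sum[OF K] subfieldD(4)[OF K])
      show "v * w * e i = (\<Sum>l<N. (M v * M w) $$ (i, l) * e l)" if i: "i < N" for i
      proof -
        have "v * w * e i = w * (v * e i)" by simp
        also have "\<dots> = (\<Sum>j<N. M v $$ (i, j) * (w * e j))"
          unfolding M(3)[OF v i] by (simp add: sum_distrib_left mult_ac)
        also have "\<dots> = (\<Sum>l<N. (M v * M w) $$ (i, l) * e l)"
          by (simp add: mult_row[OF M(1)[OF v] M(1)[OF w] i] M(3)[OF w])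
        finally show ?thesis .
      qed
    qed
    have Mone: "M c = c \<cdot>\<^sub>m 1\<^sub>m N" if c: "c \<in> K" for c
    proof (rule MI)
      show "c \<in> ?R" using lin_span_scale[OF K c E(3)] by simp
      show "(c \<cdot>\<^sub>m 1\<^sub>m N) $$ (i, j) \<in> K" if "i < N" "j < N" for i j
        using that c by (simp add: subfieldD[OF K])
      show "c * e i = (\<Sum>j<N. (c \<cdot>\<^sub>m 1\<^sub>m N) $$ (i, j) * e j)" if "i < N" for i
      proof -
        have "(\<Sum>j<N. (c \<cdot>\<^sub>m 1\<^sub>m N) $$ (i, j) * e j) = (\<Sum>j<N. if j = i then c * e j else 0)"
          using that by (intro sum.cong) auto
        then show ?thesis using that by simp
      qed
    qed simp
    \<comment> \<open>Row \<open>i\<close> should hold the coordinates of \<open>D (e i)\<close>.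
      Since \<open>D (e i)\<close> is \<open>D (e i) / e i\<close> times \<open>e i\<close>, these
      are found in row \<open>i\<close> of the multiplication matrix of that quotient.\<close>
    define B where "B = mat N N (\<lambda>(i, j). M (D (e i) / e i) $$ (i, j))"
    have e0: "e i \<noteq> 0" if "i < N" for i
    proof
      assume "e i = 0"
      then have eq: "(\<Sum>j<N. 0 * e j) = (\<Sum>j<N. (if j = i then 1 else 0) * e j)"
        by (intro sum.cong) auto
      have "0 = (if i = i then 1 else (0::complex))"
        by (rule uniq[of "\<lambda>_. 0" "\<lambda>j. if j = i then 1 else 0", OF _ _ eq that])
          (auto simp: subfieldD(1,2)[OF K])
      then show False by simp
    qed
    have B: "B \<in> carrier_mat N N" by (simp add: B_def)
    have BR: "D (e i) / e i \<in> ?R" if "i < N" for i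
      using mult[OF der[OF eR[OF that]] inv[OF eR[OF that]]] by (simp add: divide_inverse)
    have Bi: "D (e i) = (\<Sum>j<N. B $$ (i, j) * e j)" "\<And>j. j < N \<Longrightarrow> B $$ (i, j) \<in> K" if "i < N" for i
      using M(3)[OF BR[OF that] that] M(2)[OF BR[OF that] that] that e0 by (auto simp: B_def)
    \<comment> \<open>The product rule for \<open>v * e i\<close>. As the basis need not be
      constant, \<open>M\<close> does not commute with \<open>D\<close>, but the defect is a
      commutator with \<open>B\<close> and disappears under the trace.\<close>
    have MD: "M (D v) = map_mat D (M v) + (M v * B - B * M v)" if v: "v \<in> ?R" for v
    proof (rule MI[OF der[OF v]])
      note Mv = M(1)[OF v]
      show "map_mat D (M v) + (M v * B - B * M v) \<in> carrier_mat N N"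
        by (intro add_carrier_mat minus_carrier_mat mult_carrier_mat[OF B Mv])
      show "(map_mat D (M v) + (M v * B - B * M v)) $$ (i, j) \<in> K" if "i < N" "j < N" for i j
      proof -
        have "(M v * B) $$ (i, j) \<in> K" "(B * M v) $$ (i, j) \<in> K"
          using that M(2)[OF v] Bi(2) unfolding mult_index[OF Mv B that] mult_index[OF B Mv that]
          by (auto intro!: subfield_sum[OF K] subfieldD(4)[OF K])
        moreover have "D (M v $$ (i, j)) \<in> K" using M(2)[OF v that] DK by blast
        ultimately show ?thesis using that Mv B by (auto intro!: subfieldD(3,7)[OF K])
      qed
      show "D v * e i = (\<Sum>j<N. (map_mat D (M v) + (M v * B - B * M v)) $$ (i, j) * e j)" if i: "i < N" for i
      proof -
        have "D (v * e i) = (\<Sum>j<N. D (M v $$ (i, j)) * e j) + (\<Sum>j<N. M v $$ (i, j) * D (e j))"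
          by (subst M(3)[OF v i]) (simp add: derivation_sum[OF D] derivation_mult[OF D] sum.distrib mult_ac add_ac)
        also have "(\<Sum>j<N. M v $$ (i, j) * D (e j)) = (\<Sum>l<N. (M v * B) $$ (i, l) * e l)"
          by (simp add: mult_row[OF Mv B i] Bi(1))
        finally have 1: "D (v * e i) = (\<Sum>j<N. D (M v $$ (i, j)) * e j) + (\<Sum>l<N. (M v * B) $$ (i, l) * e l)" .
        have "v * D (e i) = (\<Sum>j<N. B $$ (i, j) * (v * e j))"
          unfolding Bi(1)[OF i] by (simp add: sum_distrib_left mult_ac)
        also have "\<dots> = (\<Sum>l<N. (B * M v) $$ (i, l) * e l)"
          by (simp add: mult_row[OF B Mv i] M(3)[OF v])
        finally have 2: "v * D (e i) = (\<Sum>l<N. (B * M v) $$ (i, l) * e l)" .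
        have "D v * e i = D (v * e i) - v * D (e i)" by (simp add: derivation_mult[OF D] mult_ac)
        also have "\<dots> = (\<Sum>j<N. (D (M v $$ (i, j)) + ((M v * B) $$ (i, j) - (B * M v) $$ (i, j))) * e j)"
          unfolding 1 2 by (simp add: sum.distrib sum_subtractf algebra_simps)
        also have "\<dots> = (\<Sum>j<N. (map_mat D (M v) + (M v * B - B * M v)) $$ (i, j) * e j)"
          using i Mv B by (intro sum.cong) auto
        finally show ?thesis .
      qed
    qed
    define t where "t v = mat_trace (M v)" for v
    have tD: "t (D v) = D (t v)" if v: "v \<in> ?R" for v
    proof -
      note Mv = M(1)[OF v]
      have "t (D v) = mat_trace (map_mat D (M v)) + (mat_trace (M v * B) - mat_trace (B * M v))"
        unfolding t_def MD[OF v]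
        by (subst mat_trace_add[of _ N])
          (simp_all only: map_carrier_mat Mv mult_carrier_mat[OF B Mv] mult_carrier_mat[OF Mv B]
            minus_carrier_mat mat_trace_minus[of _ N])
      also have "\<dots> = D (t v)"
        using Mv by (simp only: mat_trace_comm[OF Mv B]) (simp add: t_def mat_trace_def derivation_sum[OF D])
      finally show ?thesis .
    qed
    have tadd: "t (v + w) = t v + t w" if v: "v \<in> ?R" and w: "w \<in> ?R" for v w
    proof -
      note Mv = M[OF v] and Mw = M[OF w]
      have "M (v + w) = M v + M w"
      proof (rule MI[OF lin_span_add[OF v w]])
        show "M v + M w \<in> carrier_mat N N" by (rule add_carrier_mat[OF Mw(1)])
        show "(M v + M w) $$ (i, j) \<in> K" if "i < N" "j < N" for i j
          using Mv(1) Mw(1) Mv(2)[OF that] Mw(2)[OF that] that by (simp add: subfieldD(3)[OF K])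
        show "(v + w) * e i = (\<Sum>j<N. (M v + M w) $$ (i, j) * e j)" if "i < N" for i
          using Mv(1) Mw(1) that by (simp add: distrib_right sum.distrib Mv(3)[OF that, symmetric] Mw(3)[OF that, symmetric])
      qed
      then show ?thesis using M(1)[OF v] M(1)[OF w] by (simp add: t_def mat_trace_add[of _ N])
    qed
    have tscale: "t (c * v) = c * t v" if c: "c \<in> K" and v: "v \<in> ?R" for c v
    proof -
      have "c \<in> ?R" using lin_span_scale[OF K c E(3)] by simp
      then have "M (c * v) = c \<cdot>\<^sub>m M v" using Mmult[of c v] M(1)[OF v] v
        by (simp add: Mone[OF c] mult_smult_assoc_mat[OF one_carrier_mat M(1)[OF v]])
      then show ?thesis using M(1)[OF v] by (simp add: t_def mat_trace_def sum_distrib_left)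
    qed
    have t0: "t 0 = 0" using tscale[OF subfieldD(1)[OF K] E(3)] by simp
    have tsum: "t (sum f J) = (\<Sum>r\<in>J. t (f r))" if "finite J" "\<And>r. r \<in> J \<Longrightarrow> f r \<in> ?R" for f and J :: "'a set"
      using that by (induction J) (auto simp: t0 tadd lin_span_sum)
    \<comment> \<open>After multiplication by the inverse matrix the defect becomes a conjugate of
      \<open>B\<close> minus \<open>B\<close>, which again has trace \<open>0\<close>;
      \<open>mat_trace_dlog\<close> evaluates the rest.\<close>
    have tdlog: "t (D y / y) = D (det (M y)) / det (M y)" "det (M y) \<noteq> 0" if y: "y \<in> ?R" "y \<noteq> 0" for y
    proof -
      have iy: "inverse y \<in> ?R" by (rule inv[OF y(1)])
      note My = M(1)[OF y(1)] and Mi = M(1)[OF iy]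
      have "M 1 = 1\<^sub>m N" using Mone[OF subfieldD(2)[OF K]] by (auto intro!: eq_matI)
      then have I1: "M (inverse y) * M y = 1\<^sub>m N" "M y * M (inverse y) = 1\<^sub>m N"
        using Mmult[OF iy y(1)] Mmult[OF y(1) iy] y(2) by auto
      show "det (M y) \<noteq> 0" by (rule mat_trace_dlog(2)[OF D My Mi I1(1)])
      have "M (D y / y) = M (D y) * M (inverse y)"
        using Mmult[OF der[OF y(1)] iy] by (simp add: divide_inverse)
      also have "\<dots> = map_mat D (M y) * M (inverse y) + (M y * B * M (inverse y) - B * (M y * M (inverse y)))"
      proof -
        note YB = mult_carrier_mat[OF My B] and BY = mult_carrier_mat[OF B My]
        have X: "map_mat D (M y) \<in> carrier_mat N N" using My by simp
        show ?thesis
          unfolding MD[OF y(1)] add_mult_distrib_mat[OF X minus_carrier_mat[OF BY] Mi]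
            minus_mult_distrib_mat[OF YB BY Mi] assoc_mult_mat[OF B My Mi] ..
      qed
      finally have "M (D y / y) = \<dots>" .
      moreover have "map_mat D (M y) * M (inverse y) \<in> carrier_mat N N"
        "M y * B * M (inverse y) \<in> carrier_mat N N" using My Mi B by auto
      ultimately have "t (D y / y) = mat_trace (map_mat D (M y) * M (inverse y)) +
        (mat_trace (M y * B * M (inverse y)) - mat_trace B)"
        using B right_mult_one_mat[OF B] unfolding t_def I1
        by (simp only: mat_trace_add[of _ N] mat_trace_minus[of _ N] minus_carrier_mat)
      also have "mat_trace (M y * B * M (inverse y)) = mat_trace (M (inverse y) * (M y * B))"
        using My Mi B by (intro mat_trace_comm[of _ N]) auto
      also have "M (inverse y) * (M y * B) = B"
        using My Mi B by (simp add: assoc_mult_mat[of _ N N _ N _ N, symmetric] I1)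
      finally show "t (D y / y) = D (det (M y)) / det (M y)"
        by (simp add: mat_trace_dlog(1)[OF D My Mi I1(1)])
    qed
    have detK: "det (M v) \<in> K" if v: "v \<in> ?R" for v
    proof -
      have "(\<Prod>i = 0..<N. M v $$ (i, p i)) \<in> K" if p: "p permutes {0..<N}" for p
        using M(2)[OF v] permutes_in_image[OF p] by (intro subfield_prod[OF K]) auto
      then show ?thesis unfolding det_def'[OF M(1)[OF v]]
        by (intro subfield_sum[OF K] subfieldD(4)[OF K] subfield_of_int[OF K]) auto
    qed
    have YR: "Y r \<in> ?R" if "r \<in> I" for r using E(4) that by auto
    have xR: "x \<in> ?R" using E(4) by auto
    have dR: "D (Y r) / Y r \<in> ?R" if "r \<in> I" for r
      using mult[OF der[OF YR[OF that]] inv[OF YR[OF that]]] by (simp add: divide_inverse)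
    show ?case
    proof (rule that[OF N, of "t x" "\<lambda>r. det (M (Y r))"])
      show "t x \<in> K" using M(1,2)[OF xR] by (auto simp: t_def mat_trace_def intro!: subfield_sum[OF K])
      show "det (M (Y r)) = Y r ^ N" if "Y r \<in> K" for r using that by (simp add: Mone)
      have "D (t x) = t (\<Sum>r\<in>I. \<gamma> r * (D (Y r) / Y r))" by (simp only: rel tD[OF xR])
      also have "\<dots> = (\<Sum>r\<in>I. \<gamma> r * t (D (Y r) / Y r))"
        by (subst tsum[OF I]) (simp_all only: tscale \<gamma> dR lin_span_scale[OF K] cong: sum.cong)
      also have "\<dots> = (\<Sum>r\<in>I. \<gamma> r * (D (det (M (Y r))) / det (M (Y r))))"
        using YR Y(2) by (intro sum.cong) (auto simp: tdlog)
      finally show "(\<Sum>r\<in>I. \<gamma> r * (D (det (M (Y r))) / det (M (Y r)))) = D (t x)" by simp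
    qed (use YR Y(2) detK tdlog(2) in auto)
  qed
qed


section \<open>Residues at \<open>s = 0\<close> and exact logarithmic forms\<close>

subsection \<open>Residues of rational functions\<close>

lemma
  assumes D: "derivation D" and "a \<noteq> 0" "b \<noteq> 0"
  shows dlog_mult: "D (a * b) / (a * b) = D a / a + D b / b"
    and dlog_divide: "D (a / b) / (a / b) = D a / a - D b / b"
  using assms(2,3) by (simp_all add: derivation_mult[OF D] derivation_divide[OF D] field_simps power2_eq_square)

lemma dlog_power:
  assumes D: "derivation D" and "a \<noteq> 0"
  shows "D (a ^ n) / a ^ n = of_nat n * (D a / a)"
proof (cases n)
  case (Suc m)
  then show ?thesis using assms(2) unfolding derivation_power[OF D] by (simp add: field_simps)
qed (simp add: derivation_1[OF D])

lemma poly_split_zero: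
  assumes "p \<noteq> 0" "p \<in> polys_over K"
  obtains i q where "q \<in> polys_over K" "coeff q 0 \<noteq> 0" "\<And>x. poly p x = x ^ i * poly q x"
proof -
  have "\<exists>i q. q \<in> polys_over K \<and> coeff q 0 \<noteq> 0 \<and> (\<forall>x. poly p x = x ^ i * poly q x)"
    using assms
  proof (induction p)
    case (pCons a p)
    show ?case
    proof (cases "a = 0")
      case False
      then show ?thesis using pCons.prems by (intro exI[of _ 0] exI[of _ "pCons a p"]) auto
    next
      case True
      have "coeff p i \<in> K" for i
        using pCons.prems(2) coeff_pCons_Suc[of a p i] unfolding polys_over_def by (metis mem_Collect_eq)
      then have "p \<in> polys_over K" by (simp add: polys_over_def)
      then obtain i q where "q \<in> polys_over K" "coeff q 0 \<noteq> 0" "\<forall>x. poly p x = x ^ i * poly q x"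
        using pCons True by auto
      then show ?thesis using True by (intro exI[of _ "Suc i"] exI[of _ q]) auto
    qed
  qed simp
  then show ?thesis using that by blast
qed

text \<open>\<open>D\<close> acts on \<open>C(s)\<close> as \<open>d/ds\<close>. Because
  \<open>s\<close> is transcendental over \<open>C\<close>, the elements of \<open>C(s)\<close> can
  be treated as rational functions and studied at \<open>s = 0\<close>, although \<open>s\<close> is
  one fixed complex number.\<close>

locale rational_functions =
  fixes C :: "complex set" and s :: complex and D :: "complex \<Rightarrow> complex"
  assumes C: "is_subfield C" and s: "s \<notin> alg_closure C"
    and D: "derivation D" "\<And>c. c \<in> C \<Longrightarrow> D c = 0" "D s = 1"
begin

lemma poly_s_eq_0: "p \<in> polys_over C \<Longrightarrow> poly p s = 0 \<Longrightarrow> p = 0"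
  using s by (auto simp: alg_closure_iff)

lemma s_nz: "s \<noteq> 0"
  using D(3) derivation_0[OF D(1)] by auto

lemma D_poly: "p \<in> polys_over C \<Longrightarrow> D (poly p s) = poly (pderiv p) s"
  using derivation_poly_const[OF D(1), of p s] D(2,3) by (auto simp: polys_over_def)

text \<open>The maximal ideal of the local ring of rational functions in \<open>s\<close> regular at \<open>s = 0\<close>.\<close>

definition \<mm> :: "complex set" where
  "\<mm> = {poly p s / poly q s | p q. p \<in> polys_over C \<and> q \<in> polys_over C \<and> coeff p 0 = 0 \<and> coeff q 0 \<noteq> 0}"

lemma mmI: "p \<in> polys_over C \<Longrightarrow> q \<in> polys_over C \<Longrightarrow> coeff p 0 = 0 \<Longrightarrow> coeff q 0 \<noteq> 0 \<Longrightarrow>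
    x = poly p s / poly q s \<Longrightarrow> x \<in> \<mm>"
  unfolding \<mm>_def by blast

lemma poly_s_nz: "q \<in> polys_over C \<Longrightarrow> coeff q 0 \<noteq> 0 \<Longrightarrow> poly q s \<noteq> 0"
  using poly_s_eq_0[of q] by auto

lemmas polys = polys_over_add[OF C] polys_over_diff[OF C] polys_over_mult[OF C] polys_over_const[OF C]
  polys_over_minus[OF C] polys_over_pCons[OF C] polys_over_pderiv[OF C] polys_over_smult[OF C]
  polys_over_0[OF C] polys_over_1[OF C] subfieldD(1,2)[OF C]

lemma mm_mult:
  assumes x: "x \<in> \<mm>" and p: "p \<in> polys_over C" and q: "q \<in> polys_over C" "coeff q 0 \<noteq> 0"
  shows "x * (poly p s / poly q s) \<in> \<mm>"
proof -
  obtain p' q' where "p' \<in> polys_over C" "q' \<in> polys_over C" "coeff p' 0 = 0" "coeff q' 0 \<noteq> 0"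
    "x = poly p' s / poly q' s" using x unfolding \<mm>_def by blast
  then show ?thesis using p q
    by (intro mmI[of "p' * p" "q' * q"]) (auto simp: coeff_mult_0 intro: polys)
qed

lemma mm_add:
  assumes "x \<in> \<mm>" "y \<in> \<mm>"
  shows "x + y \<in> \<mm>"
proof -
  obtain p q p' q' where *: "p \<in> polys_over C" "q \<in> polys_over C" "coeff p 0 = 0" "coeff q 0 \<noteq> 0"
    "x = poly p s / poly q s" "p' \<in> polys_over C" "q' \<in> polys_over C" "coeff p' 0 = 0" "coeff q' 0 \<noteq> 0"
    "y = poly p' s / poly q' s" using assms unfolding \<mm>_def by blast
  show ?thesis
  proof (rule mmI[of "p * q' + p' * q" "q * q'"])
    show "x + y = poly (p * q' + p' * q) s / poly (q * q') s"
      using poly_s_nz[OF *(2,4)] poly_s_nz[OF *(7,9)] by (simp add: *(5,10) field_simps)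
  qed (use * in \<open>auto simp: coeff_mult_0 intro!: polys\<close>)
qed

lemma mm_scale: "c \<in> C \<Longrightarrow> x \<in> \<mm> \<Longrightarrow> c * x \<in> \<mm>"
  using mm_mult[of x "[:c:]" 1] by (simp add: polys mult.commute)

lemma mm_uminus: "x \<in> \<mm> \<Longrightarrow> - x \<in> \<mm>"
  using mm_scale[of "- 1" x] subfieldD(5)[OF C subfieldD(2)[OF C]] by simp

lemma mm_diff: "x \<in> \<mm> \<Longrightarrow> y \<in> \<mm> \<Longrightarrow> x - y \<in> \<mm>"
  using mm_add[of x "- y"] mm_uminus[of y] by simp

lemma mm_0: "0 \<in> \<mm>"
  by (rule mmI[of 0 1]) (simp_all add: polys)

lemma mm_sum: "(\<And>i. i \<in> I \<Longrightarrow> f i \<in> \<mm>) \<Longrightarrow> sum f I \<in> \<mm>"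
  by (induction I rule: infinite_finite_induct) (auto intro: mm_0 mm_add)

text \<open>Constants embed into the residue field: transcendence of \<open>s\<close> turns
  \<open>c * q(s) = p(s)\<close> into an identity of polynomials, whose constant terms are
  compared.\<close>

lemma mm_const:
  assumes "c \<in> C" "c \<in> \<mm>"
  shows "c = 0"
proof -
  obtain p q where *: "p \<in> polys_over C" "q \<in> polys_over C" "coeff p 0 = 0" "coeff q 0 \<noteq> 0"
    "c = poly p s / poly q s" using assms unfolding \<mm>_def by blast
  then have "poly (Polynomial.smult c q - p) s = 0" using poly_s_nz[of q] by simp
  then have "Polynomial.smult c q = p" using poly_s_eq_0[of "Polynomial.smult c q - p"] * assms(1) by (simp add: polys)
  then have "c * coeff q 0 = coeff p 0" by auto
  then show ?thesis using * by simp
qed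

lemma adjoin_s_subset: "adjoin C {s} \<subseteq> {poly p s / poly q s | p q. p \<in> polys_over C \<and> q \<in> polys_over C \<and> q \<noteq> 0}"
proof (rule adjoin_least)
  let ?R = "{poly p s | p. p \<in> polys_over C}"
  have eq: "{poly p s / poly q s | p q. p \<in> polys_over C \<and> q \<in> polys_over C \<and> q \<noteq> 0} =
    {a / b | a b. a \<in> ?R \<and> b \<in> ?R \<and> b \<noteq> 0}"
    using poly_s_eq_0 by fastforce
  show "is_subfield {poly p s / poly q s | p q. p \<in> polys_over C \<and> q \<in> polys_over C \<and> q \<noteq> 0}"
    unfolding eq
  proof (rule is_subfield_fractions)
    show "1 \<in> ?R" using polys(10) by (force intro: exI[of _ 1])
    show "x + y \<in> ?R" "x * y \<in> ?R" if "x \<in> ?R" "y \<in> ?R" for x y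
    proof -
      obtain p where "x = poly p s" "p \<in> polys_over C" using \<open>x \<in> ?R\<close> by blast
      moreover obtain q where "y = poly q s" "q \<in> polys_over C" using \<open>y \<in> ?R\<close> by blast
      ultimately have "x + y = poly (p + q) s" "x * y = poly (p * q) s" "p + q \<in> polys_over C" "p * q \<in> polys_over C"
        by (auto intro: polys)
      then show "x + y \<in> ?R" "x * y \<in> ?R" by blast+
    qed
    show "- x \<in> ?R" if "x \<in> ?R" for x
    proof -
      obtain p where "x = poly p s" "p \<in> polys_over C" using \<open>x \<in> ?R\<close> by blast
      then have "- x = poly (- p) s" "- p \<in> polys_over C" by (auto intro: polys)
      then show ?thesis by blast
    qed
  qed
  show "C \<union> {s} \<subseteq> {poly p s / poly q s | p q. p \<in> polys_over C \<and> q \<in> polys_over C \<and> q \<noteq> 0}"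
  proof
    fix x assume x: "x \<in> C \<union> {s}"
    have "\<exists>p. p \<in> polys_over C \<and> x = poly p s / poly 1 s"
    proof (cases "x = s")
      case True
      then show ?thesis by (intro exI[of _ "[:0, 1:]"]) (simp add: polys)
    next
      case False
      then show ?thesis using x by (intro exI[of _ "[:x:]"]) (simp add: polys)
    qed
    then show "x \<in> {poly p s / poly q s | p q. p \<in> polys_over C \<and> q \<in> polys_over C \<and> q \<noteq> 0}"
      using polys(10) one_neq_zero by blast
  qed
qed

lemma adjoin_s_cases:
  assumes "h \<in> adjoin C {s}" "h \<noteq> 0"
  obtains i j p q where "p \<in> polys_over C" "q \<in> polys_over C" "coeff p 0 \<noteq> 0" "coeff q 0 \<noteq> 0"
    "h = (s ^ i * poly p s) / (s ^ j * poly q s)"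
proof -
  obtain p q where pq: "p \<in> polys_over C" "q \<in> polys_over C" "q \<noteq> 0" "h = poly p s / poly q s"
    using adjoin_s_subset assms(1) by blast
  then have "p \<noteq> 0" using assms(2) by auto
  obtain i p' where p': "p' \<in> polys_over C" "coeff p' 0 \<noteq> 0" "\<And>x. poly p x = x ^ i * poly p' x"
    using poly_split_zero[OF \<open>p \<noteq> 0\<close> pq(1)] by metis
  obtain j q' where q': "q' \<in> polys_over C" "coeff q' 0 \<noteq> 0" "\<And>x. poly q x = x ^ j * poly q' x"
    using poly_split_zero[OF pq(3,2)] by metis
  show ?thesis using that[OF p'(1) q'(1) p'(2) q'(2)] pq(4) p'(3) q'(3) by simp
qed

lemma dlog_unit:
  assumes "p \<in> polys_over C" "coeff p 0 \<noteq> 0"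
  shows "s * (D (poly p s) / poly p s) \<in> \<mm>"
  using assms by (intro mmI[of "pCons 0 (pderiv p)" p]) (auto simp: D_poly intro: polys)

text \<open>The residue of a logarithmic derivative is the order at \<open>s = 0\<close>, here
  \<open>i - j\<close>. Multiplication by \<open>s\<close> turns the simple pole into a value, so
  congruences modulo \<open>\<mm>\<close> take the place of Laurent expansions.\<close>

lemma dlog_residue:
  assumes "p \<in> polys_over C" "q \<in> polys_over C" "coeff p 0 \<noteq> 0" "coeff q 0 \<noteq> 0"
  shows "s * (D ((s ^ i * poly p s) / (s ^ j * poly q s)) / ((s ^ i * poly p s) / (s ^ j * poly q s))) -
    of_int (int i - int j) \<in> \<mm>"
proof -
  note nz = poly_s_nz[OF assms(1,3)] poly_s_nz[OF assms(2,4)] s_nz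
  have eq: "D ((s ^ i * poly p s) / (s ^ j * poly q s)) / ((s ^ i * poly p s) / (s ^ j * poly q s)) =
    (of_nat i * (1 / s) + D (poly p s) / poly p s) - (of_nat j * (1 / s) + D (poly q s) / poly q s)"
  proof -
    have "s ^ i * poly p s \<noteq> 0" "s ^ j * poly q s \<noteq> 0" using nz by auto
    then show ?thesis
      using nz dlog_power[OF D(1) s_nz] unfolding dlog_divide[OF D(1) \<open>s ^ i * poly p s \<noteq> 0\<close> \<open>s ^ j * poly q s \<noteq> 0\<close>]
      by (subst (1 2) dlog_mult[OF D(1)]) (simp_all add: D(3))
  qed
  have "s * (D ((s ^ i * poly p s) / (s ^ j * poly q s)) / ((s ^ i * poly p s) / (s ^ j * poly q s))) -
    of_int (int i - int j) = s * (D (poly p s) / poly p s) - s * (D (poly q s) / poly q s)"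
    unfolding eq using s_nz by (simp add: algebra_simps)
  then show ?thesis using mm_diff[OF dlog_unit dlog_unit] assms by simp
qed

lemma dlog_residue_exists:
  assumes "h \<in> adjoin C {s}" "h \<noteq> 0"
  obtains n :: int where "s * (D h / h) - of_int n \<in> \<mm>"
  using adjoin_s_cases[OF assms] dlog_residue by metis

text \<open>A derivative has no residue. If \<open>g\<close> is regular at \<open>0\<close>, then
  \<open>s * D g\<close> vanishes there. If \<open>g\<close> has a pole, the second assumption on
  \<open>c\<close> is impossible, because \<open>s * D g\<close> would have a pole as well; this is
  proved by dividing by \<open>g\<close>, without expanding it.\<close>

lemma derivative_residue:
  assumes g: "g \<in> adjoin C {s}" and c: "c \<in> C" "s * D g - c \<in> \<mm>"
  shows "c = 0"
proof (cases "g = 0")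
  case True
  then have "- c \<in> \<mm>" using c by (simp add: derivation_0[OF D(1)])
  then show ?thesis using mm_const c(1) mm_uminus[of "- c"] by simp
next
  case False
  obtain i j p q where pq: "p \<in> polys_over C" "q \<in> polys_over C" "coeff p 0 \<noteq> 0" "coeff q 0 \<noteq> 0"
    and g_eq: "g = (s ^ i * poly p s) / (s ^ j * poly q s)"
    using adjoin_s_cases[OF g False] by metis
  note nz = poly_s_nz[OF pq(1,3)] poly_s_nz[OF pq(2,4)] s_nz
  show ?thesis
  proof (cases "j \<le> i")
    case True
    define P where "P = monom 1 (i - j) * p"
    have P: "P \<in> polys_over C" unfolding P_def using pq
      by (intro polys polys_over_monom[OF C]) auto
    have "g = poly P s / poly q s"
      using True nz by (simp add: g_eq P_def poly_monom field_simps power_add[symmetric])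
    then have "s * D g = poly (pCons 0 (pderiv P * q - P * pderiv q)) s / poly (q * q) s"
      using nz by (simp add: derivation_divide[OF D(1)] D_poly P pq power2_eq_square)
    then have "s * D g \<in> \<mm>"
      using pq P by (intro mmI[of "pCons 0 (pderiv P * q - P * pderiv q)" "q * q"])
        (auto simp: coeff_mult_0 intro!: polys)
    then have "s * D g - (s * D g - c) \<in> \<mm>" by (rule mm_diff) (rule c(2))
    then show ?thesis using mm_const[OF c(1)] by simp
  next
    case False
    define n where "n = j - i"
    have n: "n > 0" using False by (simp add: n_def)
    have g_eq': "g = poly p s / (s ^ n * poly q s)"
      using False nz by (simp add: g_eq n_def field_simps power_add[symmetric])
    define m where "m = s * (D g / g) - of_int (int i - int j)"
    have m: "m \<in> \<mm>" unfolding m_def g_eq by (rule dlog_residue[OF pq])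
    have "g \<noteq> 0" using nz by (simp add: g_eq)
    have sn: "s ^ n \<in> \<mm>"
      using n by (intro mmI[of "monom 1 n" 1])
        (auto simp: poly_monom coeff_monom intro: polys polys_over_monom[OF C])
    \<comment> \<open>By assumption \<open>s * D g\<close> is regular and \<open>1 / g\<close>
      vanishes at \<open>0\<close>, so the quotient lies in \<open>\<mm>\<close>; but its residue
      class is the nonzero order \<open>i - j\<close> of \<open>g\<close>.\<close>
    have "m + of_int (int i - int j) = s * D g / g" by (simp add: m_def)
    also have "\<dots> = (c + (s * D g - c)) * s ^ n * (poly q s / poly p s)"
      using nz by (simp add: g_eq')
    also have "\<dots> = c * s ^ n * (poly q s / poly p s) + (s * D g - c) * (poly (monom 1 n * q) s / poly p s)"
    proof -
      have sq: "poly (monom 1 n * q) s / poly p s = s ^ n * (poly q s / poly p s)"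
        by (simp add: poly_monom)
      show ?thesis unfolding sq by (simp only: distrib_right mult.assoc)
    qed
    also have "\<dots> \<in> \<mm>"
      by (rule mm_add[OF mm_mult[OF mm_scale[OF c(1) sn] pq(2,1,3)] mm_mult[OF c(2) _ pq(1,3)]])
        (intro polys polys_over_monom[OF C] pq)
    finally have "m + of_int (int i - int j) \<in> \<mm>" .
    then have "m + of_int (int i - int j) - m \<in> \<mm>" using m by (rule mm_diff)
    then have "(of_int (int i - int j) :: complex) \<in> \<mm>" by simp
    then have "(of_int (int i - int j) :: complex) = 0" by (intro mm_const subfield_of_int[OF C])
    then show ?thesis using False by simp
  qed
qed

text \<open>Residues of the \<open>D (h r) / h r\<close> are integers and the right-hand side has
  none, so the relation yields an integer relation between the \<open>\<gamma> r\<close>.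
  Independence makes every residue \<open>0\<close>, whereas the residue at \<open>r0\<close> is
  \<open>N\<close>.\<close>

lemma dlog_relation_residue:
  fixes h :: "'a \<Rightarrow> complex"
  assumes I: "finite I" and h: "\<And>r. r \<in> I \<Longrightarrow> h r \<in> adjoin C {s}" "\<And>r. r \<in> I \<Longrightarrow> h r \<noteq> 0"
    and g: "g \<in> adjoin C {s}" and \<gamma>: "\<And>r. r \<in> I \<Longrightarrow> \<gamma> r \<in> C"
    and rel: "(\<Sum>r\<in>I. \<gamma> r * (D (h r) / h r)) = D g"
    and indep: "\<And>n :: 'a \<Rightarrow> int. (\<Sum>r\<in>I. \<gamma> r * of_int (n r)) = 0 \<Longrightarrow> (\<And>r. r \<in> I \<Longrightarrow> n r = 0)"
    and r0: "r0 \<in> I" "h r0 = s ^ N"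
  shows "N = 0"
proof -
  have "\<forall>r. \<exists>n :: int. r \<in> I \<longrightarrow> s * (D (h r) / h r) - of_int n \<in> \<mm>"
    using dlog_residue_exists[OF h] by metis
  then obtain n :: "'a \<Rightarrow> int" where n: "\<And>r. r \<in> I \<Longrightarrow> s * (D (h r) / h r) - of_int (n r) \<in> \<mm>" by metis
  have "s * D g - (\<Sum>r\<in>I. \<gamma> r * of_int (n r)) = (\<Sum>r\<in>I. \<gamma> r * (s * (D (h r) / h r) - of_int (n r)))"
    unfolding rel[symmetric] by (simp add: sum_distrib_left sum_subtractf algebra_simps)
  also have "\<dots> \<in> \<mm>" using n \<gamma> by (intro mm_sum mm_scale) auto
  finally have "(\<Sum>r\<in>I. \<gamma> r * of_int (n r)) = 0"
    using \<gamma> by (intro derivative_residue[OF g] subfield_sum[OF C] subfieldD(4)[OF C] subfield_of_int[OF C]) auto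
  then have "n r0 = 0" using indep r0(1) by blast
  moreover have "s * (D (h r0) / h r0) = of_nat N"
    unfolding r0(2) dlog_power[OF D(1) s_nz] using s_nz by (simp add: D(3))
  ultimately have "(of_nat N :: complex) \<in> \<mm>" using n[OF r0(1)] by simp
  then have "(of_nat N :: complex) = 0" by (intro mm_const subfield_of_nat[OF C])
  then show ?thesis by simp
qed

end


subsection \<open>Exact logarithmic forms\<close>

lemma exact_dlog_imp_constant:
  fixes Y :: "'a \<Rightarrow> complex"
  assumes I: "finite I" and Y: "\<And>r. r \<in> I \<Longrightarrow> Y r \<noteq> 0"
    and \<gamma>: "\<And>r. r \<in> I \<Longrightarrow> \<gamma> r \<in> C"
    and indep: "\<And>n :: 'a \<Rightarrow> int. (\<Sum>r\<in>I. \<gamma> r * of_int (n r)) = 0 \<Longrightarrow> (\<And>r. r \<in> I \<Longrightarrow> n r = 0)"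
    and rel: "\<And>D. derivation D \<Longrightarrow> (\<And>c. c \<in> C \<Longrightarrow> D c = 0) \<Longrightarrow> (\<Sum>r\<in>I. \<gamma> r * (D (Y r) / Y r)) = D x"
    and r0: "r0 \<in> I"
  shows "Y r0 \<in> der_cl C"
proof (rule ccontr)
  define s where "s = Y r0"
  assume "Y r0 \<notin> der_cl C"
  then have s: "s \<notin> der_cl C" by (simp add: s_def)
  define W where "W = insert x (Y ` I)"
  have W: "finite W" using I by (simp add: W_def)
  \<comment> \<open>A largest \<open>T\<close> whose adjunction keeps \<open>s\<close>
    transcendental. Its closure \<open>C1\<close> still has \<open>s\<close> outside, and all of
    \<open>W\<close> becomes algebraic over the function field \<open>C1(s)\<close> in one
    variable.\<close>
  let ?P = "\<lambda>T. T \<subseteq> W \<and> s \<notin> der_cl (C \<union> T)"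
  have "?P {}" using s by simp
  moreover have "card T < Suc (card W)" if "?P T" for T using W that by (simp add: card_mono less_Suc_eq_le)
  ultimately obtain T where T: "?P T" "\<And>T'. ?P T' \<Longrightarrow> card T' \<le> card T"
    using ex_has_greatest_nat[of ?P "{}" card "Suc (card W)"] by blast
  define C1 where "C1 = der_cl (C \<union> T)"
  have C1: "is_subfield C1" unfolding C1_def by (rule is_subfield_der_cl)
  have C1cl: "alg_closure C1 = C1" by (simp add: C1_def alg_closure_eq_der_cl is_subfield_der_cl der_cl_idem)
  have sC1: "s \<notin> C1" using T(1) by (simp add: C1_def)
  define K where "K = adjoin C1 {s}"
  have K: "is_subfield K" unfolding K_def by (rule is_subfield_adjoin)
  have algK: "alg_closure K = der_cl (insert s (C \<union> T))"
  proof -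
    have "alg_closure K = der_cl (C1 \<union> {s})" by (simp add: K_def alg_closure_adjoin)
    also have "\<dots> = der_cl (insert s (C \<union> T))"
      using der_cl_superset[of "C \<union> T"] der_cl_superset[of "insert s (C \<union> T)"]
        der_cl_mono[of "C \<union> T" "insert s (C \<union> T)"]
      by (intro subset_antisym der_cl_mono der_cl_least) (auto simp: C1_def)
    finally show ?thesis .
  qed
  have alg: "w \<in> alg_closure K" if w: "w \<in> W" for w
  proof (cases "w \<in> T")
    case True
    then show ?thesis using der_cl_superset[of "insert s (C \<union> T)"] by (auto simp: algK)
  next
    case False
    \<comment> \<open>By maximality \<open>s\<close> becomes algebraic once \<open>w\<close> is
      added, and exchange makes \<open>w\<close> algebraic over \<open>T\<close> and
      \<open>s\<close>.\<close>
    have "\<not> ?P (insert w T)"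
      using T(2)[of "insert w T"] False finite_subset[OF _ W, of T] T(1) by auto
    then have "s \<in> der_cl (insert w (C \<union> T))" using T(1) w by simp
    then show ?thesis using der_cl_exchange[of s w "C \<union> T"] T(1) by (simp add: algK)
  qed
  obtain D where D: "derivation D" "\<And>a. a \<in> C \<union> T \<Longrightarrow> D a = 0" "D s = 1"
    using not_der_clE[of s "C \<union> T"] T(1) by metis
  have DC1: "D c = 0" if "c \<in> C1" for c
    using that unfolding C1_def by (rule der_clD[OF _ D(1)]) (rule D(2))
  \<comment> \<open>\<open>D\<close> vanishes on \<open>T\<close> as well as on \<open>C\<close>, so
    it is among the derivations for which the relation is assumed.\<close>
  have relD: "(\<Sum>r\<in>I. \<gamma> r * (D (Y r) / Y r)) = D x" using rel[OF D(1)] D(2) by blast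
  interpret rational_functions C1 s D
    by unfold_locales (use C1 C1cl sC1 D DC1 in auto)
  have DK: "D c \<in> K" if "c \<in> K" for c
  proof -
    have sub: "C1 \<union> {s} \<subseteq> K" unfolding K_def by (rule subset_adjoin)
    have "is_subfield {c \<in> K. D c \<in> K}"
      using subfieldD[OF K] subfield_power[OF K]
      by (auto simp: is_subfield_def derivation_0[OF D(1)] derivation_1[OF D(1)] derivation_add[OF D(1)]
          derivation_mult[OF D(1)] derivation_minus[OF D(1)] derivation_inverse[OF D(1)])
    then have "K \<subseteq> {c \<in> K. D c \<in> K}"
      unfolding K_def by (rule adjoin_least)
        (use sub DC1 D(3) subfieldD(1,2)[OF K] in \<open>auto simp: K_def\<close>)
    then show ?thesis using that by blast
  qed
  have sub: "C1 \<subseteq> K" "s \<in> K" using subset_adjoin[of C1 "{s}"] by (auto simp: K_def)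
  have \<gamma>1: "\<gamma> r \<in> C1" if "r \<in> I" for r using \<gamma>[OF that] der_cl_superset[of "C \<union> T"] by (auto simp: C1_def)
  have YK: "Y r \<in> alg_closure K" if "r \<in> I" for r using alg that by (simp add: W_def)
  have xK: "x \<in> alg_closure K" using alg by (simp add: W_def)
  have \<gamma>K: "\<gamma> r \<in> K" if "r \<in> I" for r using \<gamma>1[OF that] sub by blast
  show False
  proof (rule dlog_relation_descends[OF K D(1) DK I YK Y xK \<gamma>K relD], goal_cases)
    case (5 N h g)
    note * = 5
    have "N = 0"
    proof (rule dlog_relation_residue[of I h g \<gamma> r0 N])
      show "h r0 = s ^ N" using *(5)[OF r0] sub by (simp add: s_def)
      show "n r = 0" if "(\<Sum>r\<in>I. \<gamma> r * of_int (n r)) = 0" "r \<in> I" for n :: "'a \<Rightarrow> int" and r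
        by (rule indep[OF that])
    qed (use I * \<gamma>1 r0 in \<open>auto simp: K_def\<close>)
    then show False using *(1) by simp
  qed assumption+
qed


section \<open>Ax's theorem and lower bounds of Schanuel type\<close>

subsection \<open>Logarithmic derivatives of exponentials\<close>

lemma additive_of_rat_mult:
  fixes f :: "complex \<Rightarrow> complex"
  assumes add: "\<And>x y. f (x + y) = f x + f y"
  shows "f (of_rat q * x) = of_rat q * f x"
proof -
  have 0: "f 0 = 0" using add[of 0 0] by simp
  have minus: "f (- x) = - f x" for x using add[of x "- x"] 0 by (simp add: add_eq_0_iff)
  have nat: "f (of_nat n * x) = of_nat n * f x" for n x
    by (induction n) (simp_all add: 0 add distrib_right)
  have int: "f (of_int n * x) = of_int n * f x" for n x
    by (cases n rule: int_cases2) (simp_all add: nat minus)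
  obtain a b where q: "q = Rat.Fract a b" "b > 0" by (cases q)
  have "of_int b * f (of_rat q * x) = f (of_int b * (of_rat q * x))" by (simp only: int)
  also have "of_int b * (of_rat q * x) = of_int a * x" using q by (simp add: of_rat_rat)
  finally have "of_int b * f (of_rat q * x) = of_int a * f x" by (simp only: int)
  then show ?thesis using q by (simp add: of_rat_rat field_simps)
qed

text \<open>Additive in \<open>a\<close>, so rational multiples of exponents are handled by
  linearity, without extracting roots of \<open>exp a\<close>.\<close>

definition dlog_exp :: "(complex \<Rightarrow> complex) \<Rightarrow> complex \<Rightarrow> complex" where
  "dlog_exp D a = D (exp a) / exp a"

lemma dlog_exp_add: "derivation D \<Longrightarrow> dlog_exp D (a + b) = dlog_exp D a + dlog_exp D b"
  by (simp add: dlog_exp_def exp_add derivation_mult field_simps)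

lemma additive_span_eq_0:
  fixes f :: "complex \<Rightarrow> complex"
  assumes add: "\<And>x y. f (x + y) = f x + f y" and "\<And>x. x \<in> X \<Longrightarrow> f x = 0" "v \<in> rat_complex.span X"
  shows "f v = 0"
  using assms(3)
proof (induction v rule: rat_complex.span_induct_alt)
  case base
  then show ?case using add[of 0 0] by simp
next
  case (step q x y)
  then show ?case using assms(2) by (simp add: add additive_of_rat_mult[OF add])
qed

lemma additive_rat_lincomb:
  fixes f :: "complex \<Rightarrow> complex"
  assumes add: "\<And>x y. f (x + y) = f x + f y"
  shows "f (\<Sum>i\<in>I. of_rat (q i) * x i) = (\<Sum>i\<in>I. of_rat (q i) * f (x i))"
proof (induction I rule: infinite_finite_induct)
  case (insert i I)
  then show ?case by (simp add: add additive_of_rat_mult[OF add])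
qed (use add[of 0 0] in simp_all)

lemma span_der_cl:
  assumes "X \<subseteq> der_cl A" "v \<in> rat_complex.span X"
  shows "v \<in> der_cl A"
proof (rule der_clI)
  fix D assume D: "derivation D" "\<And>a. a \<in> A \<Longrightarrow> D a = 0"
  show "D v = 0"
    by (rule additive_span_eq_0[of D, OF derivation_add[OF D(1)] _ assms(2)])
      (rule der_clD[OF subsetD[OF assms(1)] D])
qed

lemma exp_span_der_cl:
  assumes "exp ` X \<subseteq> der_cl A" "v \<in> rat_complex.span X"
  shows "exp v \<in> der_cl A"
proof (rule der_clI)
  fix D assume D: "derivation D" "\<And>a. a \<in> A \<Longrightarrow> D a = 0"
  have "D (exp x) = 0" if "x \<in> X" for x
    by (rule der_clD[OF subsetD[OF assms(1) imageI[OF that]] D])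
  then have "dlog_exp D v = 0"
    by (intro additive_span_eq_0[of "dlog_exp D", OF dlog_exp_add[OF D(1)] _ assms(2)]) (simp add: dlog_exp_def)
  then show "D (exp v) = 0" by (simp add: dlog_exp_def)
qed

lemma exp_derivation_derivation: "exp_derivation E \<Longrightarrow> derivation E"
  by (simp add: exp_derivation_def)

lemma exp_derivation_exp: "exp_derivation E \<Longrightarrow> E (exp a) = exp a * E a"
  by (simp add: exp_derivation_def)

lemma exp_derivation_lincomb:
  assumes "\<And>i. i \<in> I \<Longrightarrow> exp_derivation (E i)"
  shows "exp_derivation (\<lambda>x. \<Sum>i\<in>I. c i * E i x)"
  using assms unfolding exp_derivation_def
  by (auto intro!: derivation_lincomb sum.cong simp: sum_distrib_left)

lemma exp_derivation_scale: "exp_derivation E \<Longrightarrow> exp_derivation (\<lambda>x. c * E x)"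
  using derivation_scale by (auto simp: exp_derivation_def)


subsection \<open>The Ax relation for exponential derivations\<close>

text \<open>\<open>D \<mapsto> ax_form D a\<close> is the differential form \<open>dx - dy/y\<close> at the point \<open>(x, y) = (a, exp a)\<close>.\<close>

definition ax_form :: "(complex \<Rightarrow> complex) \<Rightarrow> complex \<Rightarrow> complex" where
  "ax_form D a = D a - dlog_exp D a"

lemma ax_form_add: "derivation D \<Longrightarrow> ax_form D (a + b) = ax_form D a + ax_form D b"
  by (simp add: ax_form_def dlog_exp_add derivation_add)

lemma ax_form_exp_derivation: "exp_derivation E \<Longrightarrow> ax_form E a = 0"
  by (simp add: ax_form_def dlog_exp_def exp_derivation_exp)

text \<open>The form \<open>D \<mapsto> ax_form D a\<close> is closed.\<close>

lemma derivation_ax_form: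
  assumes E: "derivation E" and D: "derivation D"
  shows "E (ax_form D a) = D (ax_form E a) + ax_form (\<lambda>x. E (D x) - D (E x)) a"
  by (simp add: ax_form_def dlog_exp_def derivation_diff[OF E] derivation_diff[OF D]
      derivation_divide[OF E] derivation_divide[OF D] diff_divide_distrib power2_eq_square)

text \<open>Ax's theorem is stated as linear independence of forms over \<complex>, not as a bound
  on a transcendence degree, so that these forms can be counted together with others in
  \<open>exp_predimension\<close>. The assumption on \<open>span z\<close> says that
  \<open>z\<close> is independent over the rationals modulo the constants.\<close>

theorem ax_form_independent:
  assumes EE: "\<And>E. E \<in> \<E> \<Longrightarrow> exp_derivation E" and C: "C = {x. \<forall>E\<in>\<E>. E x = 0}"
    and z: "finite z" "rat_complex.independent z" "\<And>v. v \<in> rat_complex.span z \<Longrightarrow> v \<in> C \<Longrightarrow> v = 0"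
    and rel: "\<And>D. derivation D \<Longrightarrow> (\<And>c. c \<in> C \<Longrightarrow> D c = 0) \<Longrightarrow> (\<Sum>a\<in>z. f a * ax_form D a) = 0"
    and a: "a \<in> z"
  shows "f a = 0"
proof (rule ccontr)
  assume nz: "f a \<noteq> 0"
  define Rel where "Rel c \<longleftrightarrow> (\<forall>D. derivation D \<longrightarrow> (\<forall>c\<in>C. D c = 0) \<longrightarrow> (\<Sum>a\<in>z. c a * ax_form D a) = 0)" for c
  have RelD: "(\<Sum>a\<in>z. c a * ax_form D a) = 0" if "Rel c" "derivation D" "\<And>x. x \<in> C \<Longrightarrow> D x = 0" for c D
    using that by (auto simp: Rel_def)
  have "Rel f" using rel by (auto simp: Rel_def)
  have scale: "Rel (\<lambda>j. c j / c i)" if "Rel c" for c i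
    unfolding Rel_def
  proof (intro allI impI)
    fix D assume "derivation D" "\<forall>c\<in>C. D c = 0"
    then have "(\<Sum>a\<in>z. c a * ax_form D a) = 0" using RelD[OF that] by blast
    then show "(\<Sum>a\<in>z. c a / c i * ax_form D a) = 0"
      by (simp add: sum_divide_distrib[symmetric])
  qed
  show False
  proof (rule minimal_relation[of z Rel f a, OF z(1) \<open>Rel f\<close> a nz scale], assumption, goal_cases)
    case (1 c i)
    note c = 1(1-3)
    have min: "c' j = 0" if "Rel c'" "\<And>j. j \<in> z \<Longrightarrow> c j = 0 \<Longrightarrow> c' j = 0" "c' i = 0" "j \<in> z" for c' j
      by (rule 1(4)[OF that])
    have cC: "c j \<in> C" if "j \<in> z" for j
      unfolding C
    proof (intro CollectI ballI)
      fix E assume "E \<in> \<E>"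
      then have E': "exp_derivation E" by (rule EE)
      then have E: "derivation E" by (rule exp_derivation_derivation)
      have "Rel (\<lambda>j. E (c j))" unfolding Rel_def
      proof (intro allI impI)
        fix D assume D: "derivation D" "\<forall>c\<in>C. D c = 0"
        have "0 = E (\<Sum>a\<in>z. c a * ax_form D a)"
          using RelD[OF c(1) D(1)] D(2) by (simp add: derivation_0[OF E])
        also have "\<dots> = (\<Sum>a\<in>z. c a * E (ax_form D a)) + (\<Sum>a\<in>z. E (c a) * ax_form D a)"
          by (simp add: derivation_sum[OF E] derivation_mult[OF E] sum.distrib mult_ac)
        also have "(\<Sum>a\<in>z. c a * E (ax_form D a)) = (\<Sum>a\<in>z. c a * ax_form (\<lambda>x. E (D x) - D (E x)) a)"
          by (simp add: derivation_ax_form[OF E D(1)] ax_form_exp_derivation[OF E'] derivation_0[OF D(1)])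
        \<comment> \<open>\<open>E\<close> and \<open>D\<close> both vanish on \<open>C\<close>,
          hence so does their commutator, and the original relation applies to it.\<close>
        also have "\<dots> = 0"
          by (rule RelD[OF c(1) derivation_commutator[OF E D(1)]])
            (use D \<open>E \<in> \<E>\<close> in \<open>auto simp: C derivation_0[OF E] derivation_0[OF D(1)]\<close>)
        finally show "(\<Sum>a\<in>z. E (c a) * ax_form D a) = 0" by simp
      qed
      then show "E (c j) = 0"
        by (rule min) (simp_all add: derivation_0[OF E] derivation_1[OF E] that c(3))
    qed
    \<comment> \<open>The coefficients \<open>c a\<close> may be dependent over the rationals, while
      the residue argument needs independent ones. They are expanded in a rational basis
      \<open>\<Gamma>\<close> of their span, and the rational coordinates are moved into the
      arguments, giving the points \<open>w \<gamma>\<close>.\<close>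
    obtain \<Gamma> where \<Gamma>: "\<Gamma> \<subseteq> c ` z" "rat_complex.independent \<Gamma>" "c ` z \<subseteq> rat_complex.span \<Gamma>"
      using rat_complex.maximal_independent_subset[of "c ` z"] by blast
    have fin: "finite \<Gamma>" using \<Gamma>(1) z(1) finite_subset by blast
    define q where "q a = rat_complex.representation \<Gamma> (c a)" for a
    have cq: "(\<Sum>\<gamma>\<in>\<Gamma>. of_rat (q a \<gamma>) * \<gamma>) = c a" if "a \<in> z" for a
      unfolding q_def using \<Gamma>(3) that
      by (intro rat_complex.sum_representation_eq[OF \<Gamma>(2) _ fin]) auto
    define w where "w \<gamma> = (\<Sum>a\<in>z. of_rat (q a \<gamma>) * a)" for \<gamma>
    have exp_w: "exp (w \<gamma>) \<in> der_cl C" if "\<gamma> \<in> \<Gamma>" for \<gamma>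
    proof (rule exact_dlog_imp_constant[of \<Gamma> "\<lambda>\<gamma>. exp (w \<gamma>)" "\<lambda>\<gamma>. \<gamma>" C "\<Sum>\<gamma>\<in>\<Gamma>. \<gamma> * w \<gamma>"])
      show "\<gamma> \<in> C" if "\<gamma> \<in> \<Gamma>" for \<gamma> using \<Gamma>(1) that cC by auto
      show "n \<gamma> = 0" if "(\<Sum>\<gamma>\<in>\<Gamma>. \<gamma> * of_int (n \<gamma>)) = 0" "\<gamma> \<in> \<Gamma>" for n :: "complex \<Rightarrow> int" and \<gamma>
      proof -
        have "(\<Sum>\<gamma>\<in>\<Gamma>. of_rat (of_int (n \<gamma>)) * \<gamma>) = 0" using that(1) by (simp add: mult.commute)
        then have "(of_int (n \<gamma>) :: rat) = 0"
          using rat_complex.independentD[OF \<Gamma>(2) fin subset_refl _ that(2), of "\<lambda>\<gamma>. of_int (n \<gamma>)"] by blast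
        then show ?thesis by simp
      qed
      fix D assume D: "derivation D" "\<And>c. c \<in> C \<Longrightarrow> D c = 0"
      have "(\<Sum>\<gamma>\<in>\<Gamma>. \<gamma> * ax_form D (w \<gamma>)) = (\<Sum>\<gamma>\<in>\<Gamma>. \<Sum>a\<in>z. \<gamma> * (of_rat (q a \<gamma>) * ax_form D a))"
        unfolding w_def by (simp add: additive_rat_lincomb[of "ax_form D", OF ax_form_add[OF D(1)]] sum_distrib_left)
      also have "\<dots> = (\<Sum>a\<in>z. \<Sum>\<gamma>\<in>\<Gamma>. of_rat (q a \<gamma>) * \<gamma> * ax_form D a)"
        by (subst sum.swap) (simp add: mult_ac)
      also have "\<dots> = (\<Sum>a\<in>z. c a * ax_form D a)"
        by (simp add: sum_distrib_right[symmetric] cq)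
      also have "\<dots> = 0" by (rule RelD[OF c(1) D])
      finally have "(\<Sum>\<gamma>\<in>\<Gamma>. \<gamma> * dlog_exp D (w \<gamma>)) = (\<Sum>\<gamma>\<in>\<Gamma>. \<gamma> * D (w \<gamma>))"
        by (simp add: ax_form_def right_diff_distrib sum_subtractf)
      also have "\<dots> = D (\<Sum>\<gamma>\<in>\<Gamma>. \<gamma> * w \<gamma>)"
        using \<Gamma>(1) cC D(2) unfolding derivation_sum[OF D(1)]
        by (intro sum.cong) (auto simp: derivation_mult[OF D(1)])
      finally show "(\<Sum>\<gamma>\<in>\<Gamma>. \<gamma> * (D (exp (w \<gamma>)) / exp (w \<gamma>))) = D (\<Sum>\<gamma>\<in>\<Gamma>. \<gamma> * w \<gamma>)"
        by (simp only: dlog_exp_def)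
    qed (use fin that in auto)
    have w0: "w \<gamma> = 0" if "\<gamma> \<in> \<Gamma>" for \<gamma>
    proof (rule z(3))
      show "w \<gamma> \<in> rat_complex.span z" unfolding w_def
        by (intro rat_complex.span_sum rat_complex.span_scale rat_complex.span_base)
      \<comment> \<open>For an exponential derivation, \<open>exp (w \<gamma>)\<close> being
        constant is the same as \<open>w \<gamma>\<close> being constant, because \<open>exp\<close>
        has no zero.\<close>
      show "w \<gamma> \<in> C" unfolding C
      proof (intro CollectI ballI)
        fix E assume "E \<in> \<E>"
        then have E: "exp_derivation E" by (rule EE)
        have "E (exp (w \<gamma>)) = 0"
          by (rule der_clD[OF exp_w[OF that] exp_derivation_derivation[OF E]]) (use \<open>E \<in> \<E>\<close> C in auto)
        then show "E (w \<gamma>) = 0" by (simp add: exp_derivation_exp[OF E])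
      qed
    qed
    \<comment> \<open>\<open>w \<gamma> = 0\<close> is a rational relation on the independent set
      \<open>z\<close>, so all coordinates vanish; this contradicts \<open>c i = 1\<close>.\<close>
    have "q i \<gamma> = 0" if "\<gamma> \<in> \<Gamma>" for \<gamma>
      using rat_complex.independentD[OF z(2,1) subset_refl _ c(2), of "\<lambda>a. q a \<gamma>"] w0[OF that] by (simp add: w_def)
    then have "c i = 0" using cq[OF c(2)] by simp
    then show False using c(3) by simp
  qed
qed


subsection \<open>The predimension inequality\<close>

text \<open>Three families of forms are shown to be independent: \<open>D s\<close> for an
  algebraically independent set \<open>S1\<close> of constants, \<open>ax_form D a\<close> for a
  basis \<open>z\<close> of the span of \<open>X\<close> modulo constants, and \<open>D x\<close>
  for \<open>x \<in> X0\<close>. All are combinations of the \<open>D t\<close> with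
  \<open>t \<in> S\<close>, so they number at most \<open>card S\<close>. Schanuel's conjecture
  makes \<open>S1\<close> at least as large as the linear dimension of the constants in the span of
  \<open>X\<close>.\<close>

theorem exp_predimension:
  assumes SC: "schanuel_conjecture" and X: "finite X" "X0 \<subseteq> X"
    and E: "\<And>x. x \<in> X0 \<Longrightarrow> exp_derivation (E x)" "\<And>x. x \<in> X0 \<Longrightarrow> E x x = 1"
      "\<And>x y. x \<in> X0 \<Longrightarrow> y \<in> X0 \<Longrightarrow> x \<noteq> y \<Longrightarrow> E x y = 0"
    and S: "finite S" "X \<union> exp ` X \<subseteq> der_cl S"
  shows "rat_complex.dim X + card X0 \<le> card S"
proof -
  define C where "C = {x. \<forall>E'\<in>E ` X0. E' x = 0}"
  have C: "is_subfield C"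
  proof -
    have "C = \<Inter>((\<lambda>x. {y. E x y = 0}) ` X0)" by (auto simp: C_def)
    then show ?thesis
      using E(1) by (auto intro!: is_subfield_Inter is_subfield_derivation_kernel exp_derivation_derivation)
  qed
  define V where "V = rat_complex.span X"
  \<comment> \<open>\<open>b\<close> is a basis of the constant part of the span and is extended to
    a basis \<open>B\<close> of the whole; \<open>z = B - b\<close> is then independent modulo
    constants.\<close>
  obtain b where b: "b \<subseteq> V \<inter> C" "rat_complex.independent b" "V \<inter> C \<subseteq> rat_complex.span b"
    using rat_complex.maximal_independent_subset[of "V \<inter> C"] by blast
  obtain B where B: "b \<subseteq> B" "B \<subseteq> V" "rat_complex.independent B" "V \<subseteq> rat_complex.span B"
    using rat_complex.maximal_independent_subset_extend[of b V] b by blast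
  have finB: "finite B"
    using rat_complex.independent_span_bound[OF X(1) B(3)] B(2) by (simp add: V_def)
  have dimX: "card B = rat_complex.dim X"
    using rat_complex.basis_card_eq_dim[OF B(2,4,3)] by (simp add: V_def)
  define z where "z = B - b"
  have finb: "finite b" and finz: "finite z" using finB B(1) finite_subset by (auto simp: z_def)
  have indz: "rat_complex.independent z" using rat_complex.independent_mono[OF B(3)] by (simp add: z_def)
  have zC: "v = 0" if v: "v \<in> rat_complex.span z" "v \<in> C" for v
  proof -
    have "v \<in> V" using v(1) B(2) rat_complex.span_mono[of z V] rat_complex.span_span[of X]
      unfolding z_def V_def by blast
    then have vb: "v \<in> rat_complex.span b" using b(3) v(2) by blast
    have "rat_complex.representation B v = rat_complex.representation b v"
      by (rule rat_complex.representation_extend[OF B(3) vb B(1)])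
    moreover have "rat_complex.representation B v = rat_complex.representation z v"
      by (rule rat_complex.representation_extend[OF B(3) v(1)]) (simp add: z_def)
    ultimately have "rat_complex.representation b v x = 0" for x
      using rat_complex.representation_ne_zero[of b v x] rat_complex.representation_ne_zero[of z v x]
      by (auto simp: z_def)
    then show ?thesis using rat_complex.sum_representation_eq[OF b(2) vb finb subset_refl] by simp
  qed
  have spanS: "v \<in> der_cl S" "exp v \<in> der_cl S" if "v \<in> V" for v
    using span_der_cl[of X S v] exp_span_der_cl[of X S v] S(2) that by (auto simp: V_def)
  obtain bl where bl: "set bl = b" using finite_list[OF finb] by blast
  have "enat (card b) \<le> trdeg \<rat> (exp_field bl)"
    using SC rat_complex.dim_eq_card_independent[OF b(2)] unfolding schanuel_conjecture_def
    by (metis bl ldim_rat_def)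
  then obtain S1 where S1: "finite S1" "S1 \<subseteq> exp_field bl" "card b \<le> card S1"
    "\<And>s. s \<in> S1 \<Longrightarrow> s \<notin> der_cl (S1 - {s})"
    using trdeg_ge_independent by metis
  have "exp_field bl \<subseteq> C"
    unfolding exp_field_def
  proof (rule adjoin_least[OF C])
    have "b \<subseteq> C" using b(1) by blast
    moreover have "exp ` C \<subseteq> C" using E(1) by (auto simp: C_def exp_derivation_exp)
    ultimately show "\<rat> \<union> (set bl \<union> exp ` set bl) \<subseteq> C"
      using subfield_of_rat[OF C] by (auto simp: bl elim: Rats_cases)
  qed
  then have S1C: "S1 \<subseteq> C" using S1(2) by blast
  have "exp_field bl \<subseteq> der_cl S"
    unfolding exp_field_def
  proof (rule adjoin_least[OF is_subfield_der_cl])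
    show "\<rat> \<union> (set bl \<union> exp ` set bl) \<subseteq> der_cl S"
      using spanS b(1) der_cl_of_rat by (auto simp: bl elim: Rats_cases)
  qed
  then have S1S: "S1 \<subseteq> der_cl S" using S1(2) by blast
  have lin: "\<exists>c. \<forall>D. derivation D \<longrightarrow> D x = (\<Sum>t\<in>S. c t * D t)" if "x \<in> der_cl S" for x
    using der_cl_lincomb[OF S(1), of x "{}"] that by simp
  \<comment> \<open>A sum type indexes the three families, so a number belonging to more than one of
    them is counted with multiplicity.\<close>
  define u :: "complex + complex + complex \<Rightarrow> (complex \<Rightarrow> complex) \<Rightarrow> complex" where
    "u = (\<lambda>i D. case i of Inl s \<Rightarrow> D s | Inr (Inl a) \<Rightarrow> ax_form D a | Inr (Inr x) \<Rightarrow> D x)"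
  define I where "I = S1 <+> (z <+> X0)"
  have "\<exists>c. \<forall>D. derivation D \<longrightarrow> u i D = (\<Sum>t\<in>S. c t * D t)" if i: "i \<in> I" for i
  proof -
    consider s where "i = Inl s" "s \<in> S1" | a where "i = Inr (Inl a)" "a \<in> z" | x where "i = Inr (Inr x)" "x \<in> X0"
      using i by (auto simp: I_def)
    then show ?thesis
    proof cases
      case 1
      then show ?thesis using lin S1S by (auto simp: u_def)
    next
      case 2
      then have "a \<in> V" using B(2) by (auto simp: z_def)
      then obtain c d where cd: "\<And>D. derivation D \<Longrightarrow> D a = (\<Sum>t\<in>S. c t * D t)"
        "\<And>D. derivation D \<Longrightarrow> D (exp a) = (\<Sum>t\<in>S. d t * D t)"
        using lin[OF spanS(1)] lin[OF spanS(2)] by metis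
      then have "ax_form D a = (\<Sum>t\<in>S. (c t - d t / exp a) * D t)" if "derivation D" for D
        unfolding ax_form_def dlog_exp_def cd[OF that]
        by (simp add: left_diff_distrib sum_subtractf sum_divide_distrib)
      then show ?thesis using 2 by (auto simp: u_def)
    next
      case 3
      then show ?thesis using lin[of x] S(2) X(2) by (auto simp: u_def)
    qed
  qed
  then obtain m where m: "\<And>i D. i \<in> I \<Longrightarrow> derivation D \<Longrightarrow> u i D = (\<Sum>t\<in>S. m i t * D t)" by metis
  have finX0: "finite X0" using X finite_subset by blast
  have finI: "finite I" using S1(1) finz finX0 by (simp add: I_def)
  have cardI: "card I = card S1 + (card z + card X0)"
    using S1(1) finz finX0 by (simp add: I_def card_Plus)
  have "card I \<le> card S"
  proof (rule ccontr)
    assume "\<not> card I \<le> card S"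
    then obtain k where k: "\<exists>i\<in>I. k i \<noteq> 0" "\<And>t. t \<in> S \<Longrightarrow> (\<Sum>i\<in>I. k i * m i t) = 0"
      using nontrivial_solution[OF S(1) finI, of m] by auto
    have "(\<Sum>i\<in>I. k i * u i D) = 0" if "derivation D" for D
    proof -
      have "(\<Sum>i\<in>I. k i * u i D) = (\<Sum>i\<in>I. \<Sum>t\<in>S. k i * m i t * D t)"
        using m[OF _ that] by (simp add: sum_distrib_left mult_ac)
      also have "\<dots> = (\<Sum>t\<in>S. \<Sum>i\<in>I. k i * m i t * D t)" by (rule sum.swap)
      also have "\<dots> = 0" by (simp add: sum_distrib_right[symmetric] k(2))
      finally show ?thesis .
    qed
    moreover have "(\<Sum>i\<in>I. k i * u i D) = (\<Sum>s\<in>S1. k (Inl s) * D s) +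
      ((\<Sum>a\<in>z. k (Inr (Inl a)) * ax_form D a) + (\<Sum>x\<in>X0. k (Inr (Inr x)) * D x))" for D
      unfolding I_def using S1(1) finz finX0 by (simp add: sum.Plus u_def)
    ultimately have rel: "(\<Sum>s\<in>S1. k (Inl s) * D s) +
      ((\<Sum>a\<in>z. k (Inr (Inl a)) * ax_form D a) + (\<Sum>x\<in>X0. k (Inr (Inr x)) * D x)) = 0"
      if "derivation D" for D using that by metis
    \<comment> \<open>The order of elimination matters. At \<open>E x\<close> the constants
      \<open>S1\<close> and all Ax forms vanish, leaving the coefficient of \<open>x\<close>; next,
      derivations over \<open>C\<close> isolate the Ax forms; only then can arbitrary derivations be
      used on \<open>S1\<close>.\<close>
    have kx: "k (Inr (Inr x)) = 0" if x: "x \<in> X0" for x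
    proof -
      have "(\<Sum>s\<in>S1. k (Inl s) * E x s) = 0" using S1C x by (intro sum.neutral) (auto simp: C_def)
      moreover have "(\<Sum>y\<in>X0 - {x}. k (Inr (Inr y)) * E x y) = 0"
        using E(3)[OF x] by (intro sum.neutral) auto
      then have "(\<Sum>y\<in>X0. k (Inr (Inr y)) * E x y) = k (Inr (Inr x))"
        using E(2)[OF x] by (simp add: sum.remove[OF finX0 x])
      ultimately show ?thesis
        using rel[OF exp_derivation_derivation[OF E(1)[OF x]]] ax_form_exp_derivation[OF E(1)[OF x]] by simp
    qed
    have ka: "k (Inr (Inl a)) = 0" if a: "a \<in> z" for a
    proof (rule ax_form_independent[of "E ` X0" C z "\<lambda>a. k (Inr (Inl a))"])
      fix D assume D: "derivation D" "\<And>c. c \<in> C \<Longrightarrow> D c = 0"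
      have "(\<Sum>s\<in>S1. k (Inl s) * D s) = 0" using S1C D(2) by (intro sum.neutral) auto
      then show "(\<Sum>a\<in>z. k (Inr (Inl a)) * ax_form D a) = 0" using rel[OF D(1)] kx by simp
    qed (use E(1) C_def finz indz zC a in auto)
    have ks: "k (Inl s) = 0" if s: "s \<in> S1" for s
    proof -
      obtain D where D: "derivation D" "\<And>a. a \<in> S1 - {s} \<Longrightarrow> D a = 0" "D s = 1"
        using not_der_clE[OF S1(4)[OF s]] by metis
      have "(\<Sum>t\<in>S1. k (Inl t) * D t) = k (Inl s)"
        using s D S1(1) by (simp add: sum.remove[of S1 s])
      then show ?thesis using rel[OF D(1)] kx ka by simp
    qed
    show False using k(1) kx ka ks by (auto simp: I_def)
  qed
  moreover have "card z = card B - card b" using finb B(1) by (simp add: z_def card_Diff_subset)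
  moreover have "card b \<le> card B" using finB B(1) by (simp add: card_mono)
  ultimately show ?thesis using cardI S1(3) dimX by linarith
qed

text \<open>The definition of \<open>edim\<close> provides dual elements in the closure
  \<open>ecl\<close> of the tuple, but the counting argument needs them inside every larger finite
  set. They are replaced here by entries of the tuple, in at least the same number, with new dual
  derivations.\<close>

lemma convenient_exp_derivations:
  assumes conv: "convenient t"
  obtains S0 X0 E where "finite S0" "set t \<union> exp ` set t \<subseteq> der_cl S0"
    "card S0 \<le> rat_complex.dim (set t) + card X0" "X0 \<subseteq> set t"
    "\<And>x. x \<in> X0 \<Longrightarrow> exp_derivation (E x)" "\<And>x. x \<in> X0 \<Longrightarrow> E x x = 1"
    "\<And>x y. x \<in> X0 \<Longrightarrow> y \<in> X0 \<Longrightarrow> x \<noteq> y \<Longrightarrow> E x y = 0"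
proof -
  define T where "T = set t"
  have T: "finite T" by (simp add: T_def)
  obtain S0 where S0: "S0 \<subseteq> T \<union> exp ` T" "T \<union> exp ` T \<subseteq> der_cl S0" "\<And>s. s \<in> S0 \<Longrightarrow> s \<notin> der_cl (S0 - {s})"
    using der_cl_basis_exists[of "T \<union> exp ` T"] T by blast
  have finS0: "finite S0" using S0(1) T finite_subset by blast
  have "S0 \<subseteq> exp_field t"
    using S0(1) subset_adjoin[of \<rat> "T \<union> exp ` T"] unfolding exp_field_def T_def by blast
  then have "enat (card S0) \<le> enat (ldim_rat T) + edim T {}"
    using card_le_trdeg[OF finS0 _ S0(3), of "exp_field t"] conv unfolding convenient_def T_def by simp
  \<comment> \<open>The truncated subtraction is harmless: if it cuts off at \<open>0\<close>, the
    wanted bound on \<open>card S0\<close> holds anyway.\<close>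
  then have "enat (card S0 - ldim_rat T) \<le> edim T {}"
    by (cases "edim T {}") auto
  then obtain a D where aD: "\<And>i. i < card S0 - ldim_rat T \<Longrightarrow> a i \<in> ecl T"
    "\<And>i. i < card S0 - ldim_rat T \<Longrightarrow> exp_derivation (D i)"
    "\<And>i. i < card S0 - ldim_rat T \<Longrightarrow> D i (a i) = 1"
    "\<And>i k. i < card S0 - ldim_rat T \<Longrightarrow> k < card S0 - ldim_rat T \<Longrightarrow> i \<noteq> k \<Longrightarrow> D i (a k) = 0"
    unfolding edim_ge_iff edim_at_least_def by blast
  define n where "n = card S0 - ldim_rat T"
  note aD = aD[folded n_def]
  \<comment> \<open>A least subset of the entries that controls all exponential derivations on
    \<open>T\<close>. By minimality each of its elements has a derivation that is nonzero there and
    vanishes on the others.\<close>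
  let ?P = "\<lambda>X. X \<subseteq> T \<and> (\<forall>E. exp_derivation E \<longrightarrow> (\<forall>x\<in>X. E x = 0) \<longrightarrow> (\<forall>x\<in>T. E x = 0))"
  have "?P T" by simp
  then obtain X0 where X0: "?P X0" "\<And>X. ?P X \<Longrightarrow> card X0 \<le> card X"
    using ex_has_least_nat[of ?P T card] by blast
  have finX0: "finite X0" using X0(1) T finite_subset by blast
  have "\<exists>E. exp_derivation E \<and> E x = 1 \<and> (\<forall>y\<in>X0. x \<noteq> y \<longrightarrow> E y = 0)" if x: "x \<in> X0" for x
  proof -
    have "\<not> card X0 \<le> card (X0 - {x})" using card_Diff1_less[OF finX0 x] by simp
    then have "\<not> ?P (X0 - {x})" using X0(2) by blast
    then obtain E where E: "exp_derivation E" "\<forall>y\<in>X0 - {x}. E y = 0" "\<not> (\<forall>x\<in>T. E x = 0)"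
      using X0(1) by blast
    then have "E x \<noteq> 0" using X0(1) by (metis Diff_iff singletonD)
    then show ?thesis using E(2) exp_derivation_scale[OF E(1), of "inverse (E x)"]
      by (intro exI[of _ "\<lambda>y. inverse (E x) * E y"]) auto
  qed
  then obtain E where E: "\<And>x. x \<in> X0 \<Longrightarrow> exp_derivation (E x) \<and> E x x = 1 \<and> (\<forall>y\<in>X0. x \<noteq> y \<longrightarrow> E x y = 0)"
    by metis
  have "n \<le> card X0"
  proof (rule ccontr)
    assume "\<not> n \<le> card X0"
    then obtain c where c: "\<exists>i\<in>{..<n}. c i \<noteq> 0" "\<And>x. x \<in> X0 \<Longrightarrow> (\<Sum>i<n. c i * D i x) = 0"
      using nontrivial_solution[OF finX0, of "{..<n}" D] by auto
    \<comment> \<open>If \<open>X0\<close> were too small, some nontrivial combination of the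
      \<open>D i\<close> would vanish on \<open>X0\<close>, hence on \<open>T\<close> and on
      \<open>ecl T\<close>; but its value at \<open>a k\<close> is \<open>c k\<close>.\<close>
    let ?E = "\<lambda>x. \<Sum>i<n. c i * D i x"
    have E: "exp_derivation ?E" using aD(2) by (intro exp_derivation_lincomb) simp
    then have "\<forall>x\<in>T. ?E x = 0" using X0(1) c(2) by blast
    then have "?E (a k) = 0" if "k < n" for k
      using aD(1)[OF that] E unfolding ecl_def by blast
    moreover have "?E (a k) = c k" if "k < n" for k
      using that aD(3,4) by (simp add: sum.remove[of "{..<n}" k])
    ultimately show False using c(1) by auto
  qed
  then have "card S0 \<le> rat_complex.dim T + card X0" by (simp add: n_def ldim_rat_def)
  then show ?thesis using that[of S0 X0 E] finS0 S0(2) X0(1) E by (simp add: T_def)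
qed


section \<open>Linear disjointness of the exponential and logarithmic towers\<close>

subsection \<open>Linear disjointness\<close>

text \<open>For \<open>x\<close> outside \<open>K\<close> the pair \<open>1, x\<close> is
  independent over \<open>K\<close>, but \<open>x * 1 - 1 * x = 0\<close> is a relation over
  \<open>M\<close>. In the double induction only this consequence of the hypothesis is used.\<close>

lemma linearly_disjoint_Int:
  assumes "linearly_disjoint M N K" "is_subfield M" "is_subfield N" "is_subfield K"
  shows "M \<inter> N \<subseteq> K"
proof
  fix x assume x: "x \<in> M \<inter> N"
  show "x \<in> K"
  proof (rule ccontr)
    assume nK: "x \<notin> K"
    have "lin_indep K [1, x]" unfolding lin_indep_def
    proof (intro allI impI)
      fix c i assume c: "\<forall>i<length [1, x]. c i \<in> K" "(\<Sum>i<length [1, x]. c i * [1, x] ! i) = 0"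
        and i: "i < length [1, x]"
      have c01: "c 0 + c 1 * x = 0" "c 0 \<in> K" "c 1 \<in> K" using c by (simp_all add: numeral_2_eq_2)
      have "c 1 = 0"
      proof (rule ccontr)
        assume "c 1 \<noteq> 0"
        then have "x = - c 0 / c 1" using c01(1) by (simp add: field_simps add_eq_0_iff)
        then show False using nK c01(2,3) subfieldD(5,8)[OF assms(4)] by metis
      qed
      then show "c i = 0" using c01(1) i by (auto simp: less_Suc_eq)
    qed
    moreover have "set [1, x] \<subseteq> N" using x subfieldD(2)[OF assms(3)] by simp
    ultimately have ind: "lin_indep M [1, x]" using assms(1) by (simp add: linearly_disjoint_def)
    define c where "c i = (if i = 0 then x else - 1)" for i :: nat
    have "\<forall>i<length [1, x]. c i \<in> M"
      using x subfieldD(5)[OF assms(2) subfieldD(2)[OF assms(2)]] by (simp add: c_def)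
    moreover have "(\<Sum>i<length [1, x]. c i * [1, x] ! i) = 0" by (simp add: c_def numeral_2_eq_2)
    ultimately have "c 1 = 0" using ind by (simp add: lin_indep_def)
    then show False by (simp add: c_def)
  qed
qed

lemma rat_dim_Un:
  assumes "finite Q" "finite P" and ind: "\<And>p. p \<in> P \<Longrightarrow> p \<notin> rat_complex.span (Q \<union> (P - {p}))"
  shows "rat_complex.dim (Q \<union> P) = rat_complex.dim Q + card P"
proof -
  obtain b where b: "b \<subseteq> Q" "rat_complex.independent b" "Q \<subseteq> rat_complex.span b" "card b = rat_complex.dim Q"
    using rat_complex.basis_exists[of Q] by metis
  have finb: "finite b" using b(1) assms(1) finite_subset by blast
  have "rat_complex.independent (b \<union> P') \<and> card (b \<union> P') = card b + card P'" if "P' \<subseteq> P" for P'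
    using finite_subset[OF that assms(2)] that
  proof (induction P')
    case (insert p P')
    have "p \<notin> rat_complex.span (Q \<union> (P - {p}))" using insert.prems ind by blast
    moreover have "b \<union> P' \<subseteq> Q \<union> (P - {p})" using b(1) insert by blast
    ultimately have p: "p \<notin> rat_complex.span (b \<union> P')" using rat_complex.span_mono by blast
    then have "p \<notin> b \<union> P'" using rat_complex.span_base by blast
    then show ?case
      using insert rat_complex.independent_insertI[OF p] finb by simp
  qed (use b in simp)
  then have *: "rat_complex.independent (b \<union> P)" "card (b \<union> P) = card b + card P" by auto
  have "Q \<union> P \<subseteq> rat_complex.span (b \<union> P)"
    using b(3) rat_complex.span_mono[of b "b \<union> P"] rat_complex.span_superset[of "b \<union> P"] by blast
  then have "card (b \<union> P) = rat_complex.dim (Q \<union> P)"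
    using b(1) by (intro rat_complex.basis_card_eq_dim *(1)) auto
  then show ?thesis using * b(4) by simp
qed

lemma rat_basis_modulo:
  assumes "finite A"
  obtains A' where "A' \<subseteq> A" "A \<subseteq> rat_complex.span (Q \<union> A')"
    "\<And>a. a \<in> A' \<Longrightarrow> a \<notin> rat_complex.span (Q \<union> (A' - {a}))"
proof -
  let ?P = "\<lambda>A'. A' \<subseteq> A \<and> A \<subseteq> rat_complex.span (Q \<union> A')"
  have "?P A" using rat_complex.span_superset by blast
  then obtain A' where A': "?P A'" "\<And>B. ?P B \<Longrightarrow> card A' \<le> card B"
    using ex_has_least_nat[of ?P A card] by blast
  have "a \<notin> rat_complex.span (Q \<union> (A' - {a}))" if a: "a \<in> A'" for a
  proof
    assume "a \<in> rat_complex.span (Q \<union> (A' - {a}))"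
    then have "Q \<union> A' \<subseteq> rat_complex.span (Q \<union> (A' - {a}))"
      using rat_complex.span_superset[of "Q \<union> (A' - {a})"] by blast
    then have "rat_complex.span (Q \<union> A') \<subseteq> rat_complex.span (Q \<union> (A' - {a}))"
      by (intro rat_complex.span_minimal rat_complex.subspace_span)
    then have "?P (A' - {a})" using A'(1) by blast
    then have "card A' \<le> card (A' - {a})" by (rule A'(2))
    moreover have "finite A'" using A'(1) assms finite_subset by blast
    ultimately show False using card_Diff1_less[of A' a] a by linarith
  qed
  then show ?thesis using A'(1) that by blast
qed


subsection \<open>The two towers over a convenient tuple\<close>

text \<open>\<open>n\<close> stands for the exponential dimension of \<open>T\<close>.\<close>

locale strong_tuple =
  fixes T S0 :: "complex set" and n :: nat
  assumes finite_T: "finite T" and finite_S0: "finite S0"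
    and span_S0: "T \<union> exp ` T \<subseteq> der_cl S0"
    and card_S0: "card S0 \<le> rat_complex.dim T + n"
    and predim: "\<And>X S. finite X \<Longrightarrow> T \<subseteq> X \<Longrightarrow> finite S \<Longrightarrow> X \<union> exp ` X \<subseteq> der_cl S \<Longrightarrow>
      rat_complex.dim X + n \<le> card S"
begin

definition T' :: "complex set" where "T' = T \<union> exp ` T"

text \<open>Otherwise adding \<open>a\<close> would raise the linear dimension while
  \<open>S0\<close> still generates everything, against the minimality of \<open>T\<close>.\<close>

lemma span_T_imp:
  assumes "a \<in> der_cl T'" "exp a \<in> der_cl T'"
  shows "a \<in> rat_complex.span T"
proof (rule ccontr)
  assume "a \<notin> rat_complex.span T"
  then have "rat_complex.dim (T \<union> {a}) = rat_complex.dim T + card {a}"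
    using finite_T by (intro rat_dim_Un) auto
  moreover have "der_cl T' \<subseteq> der_cl S0" unfolding T'_def by (rule der_cl_least[OF span_S0])
  then have "rat_complex.dim (T \<union> {a}) + n \<le> card S0"
    using assms finite_T span_S0 by (intro predim finite_S0) auto
  ultimately show False using card_S0 by simp
qed

text \<open>The closure assumptions mean that \<open>exp\<close>
  A\<open>and\<close>B\<open>together with\<close>T'\<open>generate\<close>A\<open>and\<close>exp
  \<open>B\<close> as well. If some \<open>exp a\<close> depended on the rest, the set
  \<open>T \<union> A' \<union> B'\<close> and its exponentials would be generated by fewer numbers
  than \<open>predim\<close> allows. Each non-membership in the conclusion provides a derivation
  that is \<open>1\<close> at \<open>exp a\<close> and \<open>0\<close> on the other
  generators.\<close>

lemma dual_derivations:
  assumes A: "finite A" "A \<subseteq> der_cl (T' \<union> exp ` A)" and B: "finite B" "exp ` B \<subseteq> der_cl (T' \<union> B)"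
    and AB: "\<And>a b. a \<in> rat_complex.span A \<Longrightarrow> b \<in> rat_complex.span B \<Longrightarrow>
      a + b \<in> rat_complex.span T \<Longrightarrow> a \<in> rat_complex.span T"
  obtains A' where "A' \<subseteq> A" "der_cl (T' \<union> exp ` A) = der_cl (T' \<union> exp ` A')"
    "\<And>a. a \<in> A' \<Longrightarrow> exp a \<notin> der_cl (T' \<union> exp ` (A' - {a}) \<union> B)"
proof -
  obtain A' where A': "A' \<subseteq> A" "A \<subseteq> rat_complex.span (T \<union> A')"
    "\<And>a. a \<in> A' \<Longrightarrow> a \<notin> rat_complex.span (T \<union> (A' - {a}))"
    using rat_basis_modulo[OF A(1), of T] by metis
  obtain B' where B': "B' \<subseteq> B" "B \<subseteq> rat_complex.span (T \<union> B')"
    "\<And>b. b \<in> B' \<Longrightarrow> b \<notin> rat_complex.span (T \<union> (B' - {b}))"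
    using rat_basis_modulo[OF B(1), of T] by metis
  have fin: "finite A'" "finite B'" using A' B' A(1) B(1) finite_subset by blast+
  \<comment> \<open>\<open>A'\<close> and \<open>B'\<close> are each independent modulo
    \<open>T\<close>; the assumption on sums \<open>a + b\<close> is what excludes a relation mixing
    them.\<close>
  have B'ind: "b \<notin> rat_complex.span (T \<union> A' \<union> (B' - {b}))" if b: "b \<in> B'" for b
  proof
    assume "b \<in> rat_complex.span (T \<union> A' \<union> (B' - {b}))"
    then have "b \<in> rat_complex.span (A' \<union> (T \<union> (B' - {b})))" by (simp add: Un_ac)
    then obtain a y where ay: "a \<in> rat_complex.span A'" "y \<in> rat_complex.span (T \<union> (B' - {b}))" "b = a + y"
      unfolding rat_complex.span_Un[of A'] by blast
    then obtain t v where tv: "t \<in> rat_complex.span T" "v \<in> rat_complex.span (B' - {b})" "y = t + v"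
      unfolding rat_complex.span_Un[of T] by blast
    have "a \<in> rat_complex.span A" using ay(1) rat_complex.span_mono[OF A'(1)] by blast
    moreover have "v - b \<in> rat_complex.span B"
    proof (rule rat_complex.span_diff)
      have "B' - {b} \<subseteq> B" using B'(1) by blast
      then show "v \<in> rat_complex.span B" using tv(2) rat_complex.span_mono by blast
      show "b \<in> rat_complex.span B" using b B'(1) by (intro rat_complex.span_base) auto
    qed
    moreover have "a + (v - b) \<in> rat_complex.span T"
      using rat_complex.span_neg[OF tv(1)] ay(3) tv(3) by (simp add: algebra_simps)
    ultimately have "a \<in> rat_complex.span T" by (rule AB)
    then have "a \<in> rat_complex.span (T \<union> (B' - {b}))" using rat_complex.span_mono[of T] by blast
    then have "b \<in> rat_complex.span (T \<union> (B' - {b}))" using ay(2,3) rat_complex.span_add by blast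
    then show False using B'(3)[OF b] by blast
  qed
  have dim: "rat_complex.dim (T \<union> A' \<union> B') = rat_complex.dim T + card A' + card B'"
    using rat_dim_Un[of "T \<union> A'" B'] rat_dim_Un[of T A'] fin finite_T B'ind A'(3) by simp
  have expA: "exp ` A \<subseteq> der_cl (T' \<union> exp ` A')"
  proof -
    have "exp ` (T \<union> A') \<subseteq> der_cl (T' \<union> exp ` A')"
      using der_cl_superset[of "T' \<union> exp ` A'"] by (auto simp: T'_def)
    then show ?thesis using exp_span_der_cl A'(2) by blast
  qed
  have eq: "der_cl (T' \<union> exp ` A) = der_cl (T' \<union> exp ` A')"
  proof (intro subset_antisym der_cl_least)
    show "T' \<union> exp ` A \<subseteq> der_cl (T' \<union> exp ` A')" using expA der_cl_superset[of "T' \<union> exp ` A'"] by blast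
    show "T' \<union> exp ` A' \<subseteq> der_cl (T' \<union> exp ` A)"
      using A'(1) der_cl_superset[of "T' \<union> exp ` A"] by blast
  qed
  have "exp a \<notin> der_cl (T' \<union> exp ` (A' - {a}) \<union> B)" if a: "a \<in> A'" for a
  proof
    \<comment> \<open>One element short: \<open>exp a\<close> is left out, and the assumed
      dependence brings it back into the closure.\<close>
    define S where "S = S0 \<union> exp ` (A' - {a}) \<union> B'"
    assume ea: "exp a \<in> der_cl (T' \<union> exp ` (A' - {a}) \<union> B)"
    have S: "S \<subseteq> der_cl S" by (rule der_cl_superset)
    have T'S: "T' \<subseteq> der_cl S"
      using span_S0 der_cl_mono[of S0 S] by (auto simp: T'_def S_def)
    have "T \<union> B' \<subseteq> der_cl S" using T'S S by (auto simp: T'_def S_def)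
    then have BS: "B \<subseteq> der_cl S" using span_der_cl B'(2) by blast
    have "T' \<union> exp ` (A' - {a}) \<union> B \<subseteq> der_cl S" using T'S S BS by (auto simp: S_def)
    then have "exp a \<in> der_cl S" using ea der_cl_least by blast
    moreover have "exp ` (A' - {a}) \<subseteq> der_cl S" using S by (auto simp: S_def)
    ultimately have expA'S: "exp ` A' \<subseteq> der_cl S" using a by blast
    then have "T' \<union> exp ` A' \<subseteq> der_cl S" using T'S by blast
    then have "der_cl (T' \<union> exp ` A') \<subseteq> der_cl S" by (rule der_cl_least)
    then have AS: "A \<subseteq> der_cl S" using A(2) by (simp add: eq)
    have "der_cl (T' \<union> B) \<subseteq> der_cl S" using T'S BS by (intro der_cl_least) auto
    then have expBS: "exp ` B \<subseteq> der_cl S" using B(2) by blast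
    have "rat_complex.dim (T \<union> A' \<union> B') + n \<le> card S"
    proof (rule predim)
      show "T \<union> A' \<union> B' \<union> exp ` (T \<union> A' \<union> B') \<subseteq> der_cl S"
      proof -
        have "T \<union> A' \<union> B' \<subseteq> der_cl S" using T'S AS A'(1) BS B'(1) by (auto simp: T'_def)
        moreover have "exp ` B' \<subseteq> der_cl S" using image_mono[OF B'(1), of exp] expBS by (rule subset_trans)
        then have "exp ` (T \<union> A' \<union> B') \<subseteq> der_cl S" using T'S expA'S by (simp add: image_Un T'_def)
        ultimately show ?thesis by simp
      qed
    qed (use fin finite_T finite_S0 in \<open>auto simp: S_def\<close>)
    moreover have "card S \<le> card S0 + card (A' - {a}) + card B'"
      unfolding S_def using card_Un_le[of "S0 \<union> exp ` (A' - {a})" B'] card_Un_le[of S0 "exp ` (A' - {a})"]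
        card_image_le[of "A' - {a}" exp] fin by force
    moreover have "card (A' - {a}) < card A'" using fin a by (intro card_Diff1_less)
    ultimately show False using card_S0 dim by linarith
  qed
  then show ?thesis using A'(1) eq that by blast
qed

lemma closed_sets_disjoint:
  assumes A: "finite A" "A \<subseteq> der_cl (T' \<union> exp ` A)" and B: "finite B" "exp ` B \<subseteq> der_cl (T' \<union> B)"
    and AB: "\<And>a b. a \<in> rat_complex.span A \<Longrightarrow> b \<in> rat_complex.span B \<Longrightarrow>
      a + b \<in> rat_complex.span T \<Longrightarrow> a \<in> rat_complex.span T"
    and vs: "set vs \<subseteq> der_cl (T' \<union> B)" "lin_indep (der_cl T') vs"
    and c: "\<And>i. i < length vs \<Longrightarrow> c i \<in> der_cl (T' \<union> exp ` A)" "(\<Sum>i<length vs. c i * vs ! i) = 0"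
    and i: "i < length vs"
  shows "c i = 0"
proof (rule ccontr)
  assume nz: "c i \<noteq> 0"
  obtain A' where A': "A' \<subseteq> A" "der_cl (T' \<union> exp ` A) = der_cl (T' \<union> exp ` A')"
    "\<And>a. a \<in> A' \<Longrightarrow> exp a \<notin> der_cl (T' \<union> exp ` (A' - {a}) \<union> B)"
    by (rule dual_derivations[OF A B AB]) auto
  define G where "G = der_cl (T' \<union> exp ` A')"
  have "\<exists>D. derivation D \<and> (\<forall>x\<in>T' \<union> exp ` (A' - {a}) \<union> B. D x = 0) \<and> D (exp a) = 1" if "a \<in> A'" for a
    using not_der_clE[OF A'(3)[OF that]] by metis
  then obtain \<delta> where \<delta>: "\<And>a. a \<in> A' \<Longrightarrow> derivation (\<delta> a)"
    "\<And>a x. a \<in> A' \<Longrightarrow> x \<in> T' \<union> exp ` (A' - {a}) \<union> B \<Longrightarrow> \<delta> a x = 0"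
    "\<And>a. a \<in> A' \<Longrightarrow> \<delta> a (exp a) = 1" by metis
  have finA': "finite A'" using A'(1) A(1) finite_subset by blast
  \<comment> \<open>On the generators of \<open>G\<close> each \<open>\<delta> a\<close> takes only
    the values \<open>0\<close> and \<open>1\<close>, so applying it to a relation keeps the
    coefficients in \<open>G\<close>.\<close>
  have \<delta>G: "\<delta> a x \<in> G" if a: "a \<in> A'" and x: "x \<in> G" for a x
    unfolding G_def
  proof (rule derivation_preserves_der_cl[OF \<delta>(1)[OF a] _ x[unfolded G_def]])
    fix y assume "y \<in> T' \<union> exp ` A'"
    then have "\<delta> a y = 0 \<or> \<delta> a y = 1" using \<delta>(2,3)[OF a] by blast
    then show "\<delta> a y \<in> der_cl (T' \<union> exp ` A')" using subfieldD(1,2)[OF is_subfield_der_cl] by metis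
  qed
  define Rel where "Rel c \<longleftrightarrow> (\<forall>i<length vs. c i \<in> G) \<and> (\<Sum>i<length vs. c i * vs ! i) = 0" for c
  have "Rel c" using c by (simp add: Rel_def G_def A'(2))
  have scale: "Rel (\<lambda>j. c j / c i)" if "Rel c" "i \<in> {..<length vs}" for c i
    using that unfolding Rel_def G_def
    by (auto simp: sum_divide_distrib[symmetric] intro!: subfieldD[OF is_subfield_der_cl])
  show False
  proof (rule minimal_relation[of "{..<length vs}" Rel c i, OF _ \<open>Rel c\<close> _ nz scale], goal_cases)
    case (5 c i)
    note c = 5(1-3)
    have "\<delta> a (c j) = 0" if a: "a \<in> A'" and j: "j \<in> {..<length vs}" for a j
    proof (rule 5(4)[OF _ _ _ j])
      note D = \<delta>(1)[OF a]
      \<comment> \<open>The vectors lie over \<open>T'\<close> and \<open>B\<close>, where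
        \<open>\<delta> a\<close> vanishes, so it acts on a relation through the coefficients
        only.\<close>
      have v0: "\<delta> a (vs ! j) = 0" if "j < length vs" for j
        using der_clD[OF subsetD[OF vs(1) nth_mem[OF that]] D] \<delta>(2)[OF a] by blast
      have "0 = \<delta> a (\<Sum>j<length vs. c j * vs ! j)" using c(1) by (simp add: Rel_def derivation_0[OF D])
      also have "\<dots> = (\<Sum>j<length vs. \<delta> a (c j) * vs ! j)"
        by (simp add: derivation_sum[OF D] derivation_mult[OF D] v0 mult.commute)
      finally show "Rel (\<lambda>j. \<delta> a (c j))" using c(1) \<delta>G[OF a] by (simp add: Rel_def)
      show "\<delta> a (c i) = 0" using c(3) by (simp add: derivation_1[OF D])
      show "\<delta> a (c j) = 0" if "c j = 0" for j using that by (simp add: derivation_0[OF D])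
    qed
    note \<delta>c = this
    have "c j \<in> der_cl T'" if j: "j < length vs" for j
    proof (rule der_clI)
      fix D assume D: "derivation D" "\<And>x. x \<in> T' \<Longrightarrow> D x = 0"
      define D' where "D' x = D x - (\<Sum>a\<in>A'. D (exp a) * \<delta> a x)" for x
      have D': "derivation D'" unfolding D'_def
        by (rule derivation_diff_fun[OF D(1) derivation_lincomb[OF \<delta>(1)]])
      have "D' y = 0" if y: "y \<in> T' \<union> exp ` A'" for y
      proof (cases "y \<in> T'")
        case True
        then show ?thesis using D(2) \<delta>(2) by (simp add: D'_def)
      next
        case False
        then obtain a where a: "a \<in> A'" "y = exp a" using y by blast
        have "\<delta> b (exp a) = 0" if "b \<in> A' - {a}" for b using that a(1) \<delta>(2)[of b "exp a"] by auto
        then have "(\<Sum>b\<in>A'. D (exp b) * \<delta> b (exp a)) = D (exp a)"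
          using a(1) \<delta>(3) by (simp add: sum.remove[OF finA' a(1)])
        then show ?thesis by (simp add: D'_def a(2))
      qed
      moreover have "c j \<in> der_cl (T' \<union> exp ` A')" using c(1) j by (simp add: Rel_def G_def)
      ultimately have "D' (c j) = 0" using der_clD[OF _ D'] by blast
      then show "D (c j) = 0" using \<delta>c j by (simp add: D'_def)
    qed
    then have "c i = 0" using vs(2) c(1,2) unfolding lin_indep_def Rel_def by blast
    then show False using c(3) by simp
  qed (use i in auto)
qed

abbreviation EE :: "nat \<Rightarrow> complex set" where "EE \<equiv> exp_tower (adjoin \<rat> T')"
abbreviation LL :: "nat \<Rightarrow> complex set" where "LL \<equiv> log_tower (adjoin \<rat> T')"

lemma EE_0: "EE 0 = der_cl T'" and LL_0: "LL 0 = der_cl T'"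
  by (simp_all add: alg_closure_adjoin_Rats)

lemma EE_Suc: "EE (Suc m) = der_cl (EE m \<union> exp ` EE m)"
  and LL_Suc: "LL (Suc m) = der_cl (LL m \<union> {x. exp x \<in> LL m})"
  by (simp_all add: alg_closure_adjoin)

lemma EE_der_cl: "der_cl (EE m) = EE m" and LL_der_cl: "der_cl (LL m) = LL m"
  by (cases m; simp only: EE_0 EE_Suc LL_0 LL_Suc der_cl_idem)+

lemma EE_subfield: "is_subfield (EE m)" and LL_subfield: "is_subfield (LL m)"
  by (metis EE_der_cl LL_der_cl is_subfield_der_cl)+

lemma EE_exp: "exp ` EE m \<subseteq> EE (Suc m)" and EE_le_Suc: "EE m \<subseteq> EE (Suc m)"
  and LL_log: "{x. exp x \<in> LL m} \<subseteq> LL (Suc m)" and LL_le_Suc: "LL m \<subseteq> LL (Suc m)"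
  unfolding EE_Suc LL_Suc using der_cl_superset[of "EE m \<union> exp ` EE m"]
    der_cl_superset[of "LL m \<union> {x. exp x \<in> LL m}"] by blast+

lemma EE_mono: "m \<le> k \<Longrightarrow> EE m \<subseteq> EE k" and LL_mono: "m \<le> k \<Longrightarrow> LL m \<subseteq> LL k"
  by (rule lift_Suc_mono_le[of EE, OF EE_le_Suc], assumption)
    (rule lift_Suc_mono_le[of LL, OF LL_le_Suc])

lemma base_le_LL: "der_cl T' \<subseteq> LL m"
  using LL_mono[of 0 m] by (simp only: LL_0 le0 simp_thms)

lemma EE_span: "A \<subseteq> EE m \<Longrightarrow> v \<in> rat_complex.span A \<Longrightarrow> v \<in> EE m"
  and LL_span: "A \<subseteq> LL m \<Longrightarrow> v \<in> rat_complex.span A \<Longrightarrow> v \<in> LL m"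
  and LL_exp_span: "exp ` A \<subseteq> LL m \<Longrightarrow> v \<in> rat_complex.span A \<Longrightarrow> exp v \<in> LL m"
  using span_der_cl[of A "EE m" v] span_der_cl[of A "LL m" v] exp_span_der_cl[of A "LL m" v]
  unfolding EE_der_cl LL_der_cl by blast+

text \<open>Including \<open>A\<close> among the generated elements is essential:
  \<open>dual_derivations\<close> needs the exponents to be algebraic over their own exponentials.
  They lie one level lower, so they can be passed to the induction hypothesis.\<close>

lemma EE_finite_closed:
  assumes "finite X" "X \<subseteq> EE (Suc m)"
  obtains A where "finite A" "A \<subseteq> EE m" "X \<union> A \<subseteq> der_cl (T' \<union> exp ` A)"
proof -
  have "\<exists>A. finite A \<and> A \<subseteq> EE m \<and> X \<union> A \<subseteq> der_cl (T' \<union> exp ` A)" using assms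
  proof (induction m arbitrary: X)
    case 0
    have "X \<subseteq> der_cl (EE 0 \<union> exp ` EE 0)" using "0.prems"(2) unfolding EE_Suc[of 0] .
    then obtain Y where Y: "finite Y" "Y \<subseteq> EE 0 \<union> exp ` EE 0" "X \<subseteq> der_cl Y"
      by (rule der_cl_finite_char_set[OF "0.prems"(1)])
    obtain A where A: "finite A" "A \<subseteq> EE 0" "Y \<subseteq> EE 0 \<union> exp ` A"
      using Y(1,2) finite_subset_image[of "Y - EE 0" exp "EE 0"] by (metis Diff_subset_conv finite_Diff subset_refl)
    have sub: "EE 0 \<subseteq> der_cl (T' \<union> exp ` A)" unfolding EE_0 by (intro der_cl_mono) auto
    then have "Y \<subseteq> der_cl (T' \<union> exp ` A)" using A(3) der_cl_superset[of "T' \<union> exp ` A"] by blast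
    then have "X \<subseteq> der_cl (T' \<union> exp ` A)" using Y(3) der_cl_least by blast
    then show ?case using A(1,2) sub by (intro exI[of _ A]) blast
  next
    case (Suc m)
    have "X \<subseteq> der_cl (EE (Suc m) \<union> exp ` EE (Suc m))" using Suc.prems(2) unfolding EE_Suc[of "Suc m"] .
    then obtain Y where Y: "finite Y" "Y \<subseteq> EE (Suc m) \<union> exp ` EE (Suc m)" "X \<subseteq> der_cl Y"
      by (rule der_cl_finite_char_set[OF Suc.prems(1)])
    obtain A1 where A1: "finite A1" "A1 \<subseteq> EE (Suc m)" "Y - EE (Suc m) = exp ` A1"
      using Y(1,2) finite_subset_image[of "Y - EE (Suc m)" exp "EE (Suc m)"] by (metis Diff_subset_conv finite_Diff)
    \<comment> \<open>Besides the generators already present at the lower level, the exponents of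
      the new exponentials must be generated.\<close>
    define X1 where "X1 = A1 \<union> (Y \<inter> EE (Suc m))"
    have "finite X1" "X1 \<subseteq> EE (Suc m)" using A1 Y(1) by (auto simp: X1_def)
    from Suc.IH[OF this] obtain A2 where A2: "finite A2" "A2 \<subseteq> EE m" "X1 \<union> A2 \<subseteq> der_cl (T' \<union> exp ` A2)"
      by blast
    define A where "A = A1 \<union> A2"
    have sub: "der_cl (T' \<union> exp ` A2) \<subseteq> der_cl (T' \<union> exp ` A)" by (intro der_cl_mono) (auto simp: A_def)
    have "A \<subseteq> der_cl (T' \<union> exp ` A)" using A2(3) sub by (auto simp: A_def X1_def)
    moreover have "Y \<subseteq> der_cl (T' \<union> exp ` A)"
    proof
      fix y assume "y \<in> Y"
      then have "y \<in> X1 \<or> y \<in> exp ` A1" using A1(3) by (auto simp: X1_def)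
      then show "y \<in> der_cl (T' \<union> exp ` A)"
        using A2(3) sub der_cl_superset[of "T' \<union> exp ` A"] by (auto simp: A_def)
    qed
    then have "X \<subseteq> der_cl (T' \<union> exp ` A)" using Y(3) der_cl_least by blast
    ultimately show ?case
      using A1 A2 EE_le_Suc[of m] by (intro exI[of _ A]) (auto simp: A_def)
  qed
  then show ?thesis using that by blast
qed

text \<open>The mirror image of \<open>EE_finite_closed\<close>: the logarithms \<open>B\<close> are
  the generators, and their exponentials are what lies one level lower and has to be generated
  too.\<close>

lemma LL_finite_closed:
  assumes "finite X" "X \<subseteq> LL (Suc m)"
  obtains B where "finite B" "exp ` B \<subseteq> LL m" "X \<union> exp ` B \<subseteq> der_cl (T' \<union> B)"
proof -
  have "\<exists>B. finite B \<and> exp ` B \<subseteq> LL m \<and> X \<union> exp ` B \<subseteq> der_cl (T' \<union> B)" using assms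
  proof (induction m arbitrary: X)
    case 0
    have "X \<subseteq> der_cl (LL 0 \<union> {x. exp x \<in> LL 0})" using "0.prems"(2) unfolding LL_Suc[of 0] .
    then obtain Y where Y: "finite Y" "Y \<subseteq> LL 0 \<union> {x. exp x \<in> LL 0}" "X \<subseteq> der_cl Y"
      by (rule der_cl_finite_char_set[OF "0.prems"(1)])
    define B where "B = Y - LL 0"
    have sub: "LL 0 \<subseteq> der_cl (T' \<union> B)" unfolding LL_0 by (intro der_cl_mono) auto
    then have "Y \<subseteq> der_cl (T' \<union> B)" using der_cl_superset[of "T' \<union> B"] by (auto simp: B_def)
    then have "X \<subseteq> der_cl (T' \<union> B)" using Y(3) der_cl_least by blast
    moreover have "exp ` B \<subseteq> LL 0" using Y(2) unfolding B_def by blast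
    ultimately show ?case using Y(1) sub by (intro exI[of _ B]) (auto simp: B_def)
  next
    case (Suc m)
    have "X \<subseteq> der_cl (LL (Suc m) \<union> {x. exp x \<in> LL (Suc m)})" using Suc.prems(2) unfolding LL_Suc[of "Suc m"] .
    then obtain Y where Y: "finite Y" "Y \<subseteq> LL (Suc m) \<union> {x. exp x \<in> LL (Suc m)}" "X \<subseteq> der_cl Y"
      by (rule der_cl_finite_char_set[OF Suc.prems(1)])
    define B1 where "B1 = Y - LL (Suc m)"
    define X1 where "X1 = exp ` B1 \<union> (Y \<inter> LL (Suc m))"
    have eB1: "exp ` B1 \<subseteq> LL (Suc m)" using Y(2) unfolding B1_def by blast
    then have "finite X1" "X1 \<subseteq> LL (Suc m)" using Y(1) by (auto simp: X1_def B1_def)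
    from Suc.IH[OF this] obtain B2 where
      B2: "finite B2" "exp ` B2 \<subseteq> LL m" "X1 \<union> exp ` B2 \<subseteq> der_cl (T' \<union> B2)" by blast
    define B where "B = B1 \<union> B2"
    have sub: "der_cl (T' \<union> B2) \<subseteq> der_cl (T' \<union> B)" by (intro der_cl_mono) (auto simp: B_def)
    have "exp ` B \<subseteq> der_cl (T' \<union> B)" using B2(3) sub by (auto simp: B_def X1_def)
    moreover have "Y \<subseteq> der_cl (T' \<union> B)"
    proof
      fix y assume "y \<in> Y"
      then have "y \<in> X1 \<or> y \<in> B1" by (auto simp: X1_def B1_def)
      then show "y \<in> der_cl (T' \<union> B)"
        using B2(3) sub der_cl_superset[of "T' \<union> B"] by (auto simp: B_def)
    qed
    then have "X \<subseteq> der_cl (T' \<union> B)" using Y(3) der_cl_least by blast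
    moreover have "exp ` B \<subseteq> LL (Suc m)" using eB1 B2(2) LL_le_Suc[of m] by (auto simp: B_def)
    moreover have "finite B" using B2(1) Y(1) by (simp add: B_def B1_def)
    ultimately show ?case by (intro exI[of _ B]) blast
  qed
  then show ?thesis using that by blast
qed

text \<open>Let \<open>a + b\<close> lie in the span of \<open>T\<close>, with \<open>a\<close> and
  \<open>b\<close> in the spans of \<open>A\<close> and \<open>B\<close>. Then \<open>a\<close>
  belongs to level \<open>k - 1\<close> of the exponential and level \<open>m\<close> of the
  logarithmic tower, while \<open>exp a\<close> belongs to levels \<open>k\<close> and
  \<open>m - 1\<close>. Exponentiation climbs one tower and descends the other, so both
  intersections fall under the induction on \<open>k + m\<close>; then \<open>a\<close> and
  \<open>exp a\<close> are algebraic over the base, and \<open>span_T_imp\<close> applies.\<close>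

lemma towers_disjoint: "linearly_disjoint (EE k) (LL m) (der_cl T')"
proof (induction "k + m" arbitrary: k m)
  case 0
  then show ?case by (simp add: linearly_disjoint_def EE_0 del: exp_tower.simps log_tower.simps)
next
  case (Suc km)
  show ?case
  proof (cases k)
    case 0
    then show ?thesis by (simp add: linearly_disjoint_def EE_0 del: exp_tower.simps log_tower.simps)
  next
    case k: (Suc k')
    show ?thesis unfolding linearly_disjoint_def lin_indep_def[of "EE k"]
    proof (intro allI impI)
      fix vs c i
      assume vs: "set vs \<subseteq> LL m" "lin_indep (der_cl T') vs" and c: "\<forall>i<length vs. c i \<in> EE k"
        "(\<Sum>i<length vs. c i * vs ! i) = 0" and i: "i < length vs"
      have "finite (c ` {..<length vs})" "c ` {..<length vs} \<subseteq> EE (Suc k')" using c(1) k by auto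
      then obtain A where A: "finite A" "A \<subseteq> EE k'" "c ` {..<length vs} \<union> A \<subseteq> der_cl (T' \<union> exp ` A)"
        by (rule EE_finite_closed)
      have A2: "A \<subseteq> der_cl (T' \<union> exp ` A)" and cA: "\<And>i. i < length vs \<Longrightarrow> c i \<in> der_cl (T' \<union> exp ` A)"
        using A(3) by auto
      show "c i = 0"
      proof (cases m)
        case 0
        \<comment> \<open>No logarithms are involved at level \<open>0\<close>; with
          \<open>B = {}\<close> the condition on sums is trivial.\<close>
        then have "set vs \<subseteq> der_cl (T' \<union> {})" using vs(1) by (simp add: LL_0 del: log_tower.simps)
        then show ?thesis
          using closed_sets_disjoint[OF A(1) A2, of "{}" vs c i] vs(2) cA c(2) i by simp
      next
        case m: (Suc m')
        then obtain B where B: "finite B" "exp ` B \<subseteq> LL m'" "set vs \<union> exp ` B \<subseteq> der_cl (T' \<union> B)"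
          using LL_finite_closed[of "set vs" m'] vs(1) by blast
        have IH1: "EE k' \<inter> LL m \<subseteq> der_cl T'"
          by (rule linearly_disjoint_Int[OF Suc.hyps(1) EE_subfield LL_subfield is_subfield_der_cl])
            (use Suc.hyps(2) k in simp)
        have IH2: "EE k \<inter> LL m' \<subseteq> der_cl T'"
          by (rule linearly_disjoint_Int[OF Suc.hyps(1) EE_subfield LL_subfield is_subfield_der_cl])
            (use Suc.hyps(2) m in simp)
        have AB: "a \<in> rat_complex.span T"
          if a: "a \<in> rat_complex.span A" and b: "b \<in> rat_complex.span B" and ab: "a + b \<in> rat_complex.span T" for a b
        proof (rule span_T_imp)
          have aE: "a \<in> EE k'" by (rule EE_span[OF A(2) a])
          have "B \<subseteq> {x. exp x \<in> LL m'}" using B(2) by auto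
          then have "B \<subseteq> LL m" using LL_log[of m'] m by blast
          then have bL: "b \<in> LL m" by (rule LL_span[OF _ b])
          have ebL: "exp b \<in> LL m'" by (rule LL_exp_span[OF B(2) b])
          have TT: "T \<subseteq> der_cl T'" "exp ` T \<subseteq> der_cl T'" using der_cl_superset[of T'] by (auto simp: T'_def)
          have t: "a + b \<in> der_cl T'" "exp (a + b) \<in> der_cl T'"
            using span_der_cl[OF TT(1) ab] exp_span_der_cl[OF TT(2) ab] by auto
          \<comment> \<open>The logarithmic tower sees \<open>a\<close> only through
            \<open>b\<close>: the sum is algebraic over the base, which is contained in every
            level.\<close>
          have "(a + b) - b \<in> LL m" by (rule subfieldD(7)[OF LL_subfield]) (use t(1) base_le_LL bL in blast)+
          then have "a \<in> LL m" by simp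
          then show "a \<in> der_cl T'" using IH1 aE by blast
          have "exp (a + b) / exp b \<in> LL m'"
            by (rule subfieldD(8)[OF LL_subfield]) (use t(2) base_le_LL ebL in blast)+
          then have "exp a \<in> LL m'" by (simp add: exp_add)
          moreover have "exp a \<in> EE k" using EE_exp[of k'] aE k by blast
          ultimately show "exp a \<in> der_cl T'" using IH2 by blast
        qed
        show ?thesis
          by (rule closed_sets_disjoint[OF A(1) A2 B(1) _ AB _ vs(2) cA c(2) i]) (use B(3) in auto)
      qed
    qed
  qed
qed

end

lemma finite_subset_UN_chain:
  fixes f :: "nat \<Rightarrow> 'a set"
  assumes "finite X" "X \<subseteq> (\<Union>n\<in>N. f n)" and mono: "\<And>m k. m \<le> k \<Longrightarrow> f m \<subseteq> f k"
  obtains k where "X \<subseteq> f k"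
proof -
  have "\<forall>x\<in>X. \<exists>n. x \<in> f n" using assms(2) by blast
  then obtain n where n: "\<And>x. x \<in> X \<Longrightarrow> x \<in> f (n x)" by metis
  have "X \<subseteq> f (Max (n ` X))"
  proof
    fix x assume "x \<in> X"
    then have "n x \<le> Max (n ` X)" using assms(1) by simp
    then show "x \<in> f (Max (n ` X))" using mono n[OF \<open>x \<in> X\<close>] by blast
  qed
  then show ?thesis by (rule that)
qed

theorem theorem4p2:
  fixes t :: "complex list" and F E L :: "complex set"
  assumes SC: "schanuel_conjecture"
    and conv: "convenient t"
    and F: "F = adjoin \<rat> (set t \<union> exp ` set t)"
    and E: "E = (\<Union>n\<in>{1..}. exp_tower F n)"
    and L: "L = (\<Union>n\<in>{1..}. log_tower F n)"
  shows "linearly_disjoint E L (alg_closure F)"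
proof (rule convenient_exp_derivations[OF conv], goal_cases)
  case (1 S0 X0 D)
  note * = 1
  \<comment> \<open>The derivations dual to \<open>X0\<close> can be reused for every finite
    \<open>X\<close> containing the tuple, since \<open>X0\<close> is a part of it; so one number
    \<open>card X0\<close> serves for all these sets.\<close>
  interpret strong_tuple "set t" S0 "card X0"
  proof
    fix X S assume X: "finite X" "set t \<subseteq> X" "finite S" "X \<union> exp ` X \<subseteq> der_cl S"
    show "rat_complex.dim X + card X0 \<le> card S"
      by (rule exp_predimension[OF SC X(1) _ *(5-7) X(3,4)]) (use X(2) *(4) in auto)
  qed (use * in auto)
  have FT: "F = adjoin \<rat> T'" by (simp add: F T'_def)
  show ?case unfolding linearly_disjoint_def lin_indep_def[of E]
  proof (intro allI impI)
    fix vs c i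
    assume vs: "set vs \<subseteq> L" "lin_indep (alg_closure F) vs" and c: "\<forall>i<length vs. c i \<in> E"
      "(\<Sum>i<length vs. c i * vs ! i) = 0" and i: "i < length vs"
    have "set vs \<subseteq> (\<Union>n\<in>{1..}. LL n)" using vs(1) by (simp only: L FT)
    \<comment> \<open>A single relation involves finitely many elements, so it already lives at
      finite levels of both towers.\<close>
    then obtain m where m: "set vs \<subseteq> LL m"
      by (rule finite_subset_UN_chain[OF finite_set _ LL_mono])
    have "c ` {..<length vs} \<subseteq> (\<Union>n\<in>{1..}. EE n)" using c(1) by (auto simp only: E FT lessThan_iff)
    then obtain k where "c ` {..<length vs} \<subseteq> EE k"
      by (rule finite_subset_UN_chain[OF finite_imageI[OF finite_lessThan] _ EE_mono])
    then have k: "\<forall>i<length vs. c i \<in> EE k" by auto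
    have "alg_closure F = der_cl T'" by (simp add: FT alg_closure_adjoin_Rats)
    then have "lin_indep (EE k) vs"
      using towers_disjoint[of k m] vs(2) m by (simp add: linearly_disjoint_def)
    then show "c i = 0" using k c(2) i by (simp add: lin_indep_def)
  qed
qed

end
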